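(* Let $(V(u),\,u\in\mathcal T)$ be a branching random walk with reproduction point process $\aleph$ and intensity $\mu$ satisfying $\mu(\mathbb R)>1$. Suppose that (H1') (defined in the context, with the associated $t^*>0$) holds and that there exist $1<\alpha_1\le\alpha_2$ such that $$\mathbb E\Big[\sum_{|u|=1}e^{-t^*V(u)}|V(u)|^{\alpha_1}\Big]<\infty$$ and, for all $y>0$ large enough, $$\mathbb P\bigl(\exists\,|u|=1:\ V(u)\le -y\bigr)\ \ge\ e^{-t^*y}\,y^{-\alpha_2}.$$ Assume further that $\mathbb E[\Sigma_V\log_+\Sigma_V]<\infty$, where $\Sigma_V:=\sum_{|u|=1}e^{-t^*V(u)}$ and $\log_+x:=\max(\log x,0)$ for $x>0$. Then there exists a (deterministic) constant $a_1\in(0,\infty)$ such that $\mathbb P^*$-a.s. $$\inf_{\xi}\ \limsup_{n\to\infty}\frac{V(\xi_n)}{\sqrt{n\log n}}=a_1,$$ where the infimum is over all infinite rays $\xi$ of $\mathcal T$.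
   Context: Branching random walk: $\aleph$ is a point process on $\mathbb R$. A single particle $\varnothing$ (the root) starts at $V(\varnothing)=0$ in generation $0$. Its children, together with their positions, form the point process $\aleph=\sum_{|u|=1}\delta_{V(u)}$. Recursively, each particle $u$ of generation $n$ gives birth in generation $n+1$ to children whose positions form an independent copy of $\aleph$ shifted by $V(u)$. $\mathcal T$ is the resulting genealogical (Ulam–Harris) tree, $|u|$ is the generation of $u$ and $V(u)\in\mathbb R$ its position. Let $\mu(\mathrm dx):=\mathbb E[\aleph(\mathrm dx)]$, and assume $\mu(\mathbb R)>1$ (supercriticality; $\mu(\mathbb R)=\infty$ is not excluded). Let $\mathcal S$ be the event that $\mathcal T$ is infinite (non-extinction) and $\mathbb P^*:=\mathbb P(\cdot\mid\mathcal S)$. Put $\varphi(t):=\log\int_{\mathbb R}e^{-tx}\mu(\mathrm dx)\in(-\infty,\infty]$ for $t\in\mathbb R$. An infinite ray is an infinite path $\xi=(\xi_0=\varnothing,\xi_1,\xi_2,\dots)$ in $\mathcal T$ with $\xi_n$ the parent of $\xi_{n+1}$ for all $n\ge0$. (H1'): there exists $t>0$ with $\varphi(t)=0$; $t^*$ denotes the minimal such $t$; the integral $\int_{\mathbb R}xe^{-t^*x}\mu(\mathrm dx)$ is well-defined (i.e. at least one of $\int_{(-\infty,0)}|x|e^{-t^*x}\mu(\mathrm dx)$, $\int_{(0,\infty)}xe^{-t^*x}\mu(\mathrm dx)$ is finite) and strictly positive; and $\mu((-\infty,0))>0$. *)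

theory Defs
  imports "HOL-Probability.Probability"
begin

text \<open>
  Particles carry Ulam--Harris labels of type \<^typ>\<open>nat list\<close>: the root is \<^term>\<open>[]\<close> and the
  children of \<open>u\<close> are \<open>u @ [0], u @ [1], \<dots>\<close>.  The reproduction of a particle is a pair
  \<open>(k, d)\<close>: a number of children \<open>k\<close>, possibly infinite, and the displacement \<open>d i\<close> of its
  \<open>i\<close>-th child relative to the particle, which is meaningful for \<open>i < k\<close> only.  It encodes the
  point process formed by the atoms \<open>d i\<close> with \<open>i < k\<close>.
\<close>

type_synonym offspring = "enat \<times> (nat \<Rightarrow> real)"

definition offspring_space :: "offspring measure" where
  "offspring_space = count_space UNIV \<Otimes>\<^sub>M (\<Pi>\<^sub>M i\<in>UNIV. borel)"

locale branching_random_walk = prob_space M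
  for M :: "'w measure" and X :: "nat list \<Rightarrow> 'w \<Rightarrow> offspring" +
  assumes indep_offspring: "indep_vars (\<lambda>_. offspring_space) X UNIV"
    and identically_distributed_offspring:
      "distr M offspring_space (X u) = distr M offspring_space (X [])"

definition tree :: "(nat list \<Rightarrow> 'w \<Rightarrow> offspring) \<Rightarrow> 'w \<Rightarrow> nat list set" where
  "tree X \<omega> = {u. \<forall>k<length u. enat (u ! k) < fst (X (take k u) \<omega>)}"

definition generation :: "(nat list \<Rightarrow> 'w \<Rightarrow> offspring) \<Rightarrow> nat \<Rightarrow> 'w \<Rightarrow> nat list set" where
  "generation X n \<omega> = {u \<in> tree X \<omega>. length u = n}"

definition position :: "(nat list \<Rightarrow> 'w \<Rightarrow> offspring) \<Rightarrow> 'w \<Rightarrow> nat list \<Rightarrow> real" where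
  "position X \<omega> u = (\<Sum>k<length u. snd (X (take k u) \<omega>) (u ! k))"

lemma tree_Nil: "[] \<in> tree X \<omega>"
  by (simp add: tree_def)

lemma tree_snoc: "u @ [i] \<in> tree X \<omega> \<longleftrightarrow> u \<in> tree X \<omega> \<and> enat i < fst (X u \<omega>)"
  by (auto simp: tree_def nth_append less_Suc_eq)

lemma position_Nil: "position X \<omega> [] = 0"
  by (simp add: position_def)

lemma position_snoc: "position X \<omega> (u @ [i]) = position X \<omega> u + snd (X u \<omega>) i"
proof -
  have "(\<Sum>k<length u. snd (X (take k (u @ [i])) \<omega>) ((u @ [i]) ! k))
      = (\<Sum>k<length u. snd (X (take k u) \<omega>) (u ! k))"
    by (rule sum.cong) (auto simp: nth_append)
  then show ?thesis by (simp add: position_def)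
qed

definition infinite_rays :: "(nat list \<Rightarrow> 'w \<Rightarrow> offspring) \<Rightarrow> 'w \<Rightarrow> (nat \<Rightarrow> nat list) set" where
  "infinite_rays X \<omega> =
    {\<xi>. \<xi> 0 = [] \<and> (\<forall>n. \<xi> n \<in> tree X \<omega>) \<and> (\<forall>n. \<exists>i. \<xi> (Suc n) = \<xi> n @ [i])}"

definition survival :: "'w measure \<Rightarrow> (nat list \<Rightarrow> 'w \<Rightarrow> offspring) \<Rightarrow> 'w set" where
  "survival M X = {\<omega> \<in> space M. infinite (tree X \<omega>)}"

text \<open>
  The point process \<open>\<Sum>\<^bsub>|u|=1\<^esub> \<delta>\<^bsub>V(u)\<^esub>\<close>: the image of counting measure on the first
  generation under the positions.
\<close>

definition reproduction :: "(nat list \<Rightarrow> 'w \<Rightarrow> offspring) \<Rightarrow> 'w \<Rightarrow> real measure" where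
  "reproduction X \<omega> = distr (count_space (generation X 1 \<omega>)) borel (position X \<omega>)"

definition intensity :: "'w measure \<Rightarrow> (nat list \<Rightarrow> 'w \<Rightarrow> offspring) \<Rightarrow> real measure" where
  "intensity M X =
    measure_of UNIV (sets borel) (\<lambda>A. \<integral>\<^sup>+\<omega>. emeasure (reproduction X \<omega>) A \<partial>M)"

lemma sets_intensity [simp, measurable_cong]: "sets (intensity M X) = sets borel"
  using sets.sigma_sets_eq[of "borel :: real measure"] by (simp add: intensity_def)

context branching_random_walk
begin

lemma measurable_offspring [measurable]: "X u \<in> M \<rightarrow>\<^sub>M offspring_space"
  using indep_offspring by (auto simp: indep_vars_def)

lemma measurable_number [measurable]: "(\<lambda>\<omega>. fst (X u \<omega>)) \<in> M \<rightarrow>\<^sub>M count_space UNIV"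
  using measurable_compose[OF measurable_offspring[of u]] measurable_fst
  unfolding offspring_space_def by blast

lemma measurable_displacement [measurable]: "(\<lambda>\<omega>. snd (X u \<omega>) i) \<in> borel_measurable M"
proof -
  have "snd \<in> offspring_space \<rightarrow>\<^sub>M (\<Pi>\<^sub>M i\<in>UNIV. (borel :: real measure))"
    unfolding offspring_space_def by (rule measurable_snd)
  then have "(\<lambda>x :: offspring. snd x i) \<in> offspring_space \<rightarrow>\<^sub>M borel"
    by (rule measurable_compose) (simp add: measurable_component_singleton)
  from measurable_compose[OF measurable_offspring[of u] this] show ?thesis .
qed

lemma measurable_position [measurable]: "(\<lambda>\<omega>. position X \<omega> u) \<in> borel_measurable M"
  unfolding position_def by measurable

lemma measurable_tree [measurable]: "Measurable.pred M (\<lambda>\<omega>. u \<in> tree X \<omega>)"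
  unfolding tree_def by measurable

lemma emeasure_reproduction:
  assumes "A \<in> sets borel"
  shows "emeasure (reproduction X \<omega>) A =
    (\<integral>\<^sup>+u. (if u \<in> tree X \<omega> \<and> length u = 1 \<and> position X \<omega> u \<in> A then 1 else 0) \<partial>count_space UNIV)"
proof -
  have "emeasure (reproduction X \<omega>) A =
      emeasure (count_space (generation X 1 \<omega>)) (position X \<omega> -` A \<inter> generation X 1 \<omega>)"
    using assms by (simp add: reproduction_def emeasure_distr)
  also have "\<dots> = emeasure (count_space UNIV) (position X \<omega> -` A \<inter> generation X 1 \<omega>)"
    by (cases "finite (position X \<omega> -` A \<inter> generation X 1 \<omega>)")
       (simp_all add: emeasure_count_space)
  also have "\<dots> = (\<integral>\<^sup>+u. indicator (position X \<omega> -` A \<inter> generation X 1 \<omega>) u \<partial>count_space UNIV)"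
    by simp
  finally show ?thesis
    by (auto simp: generation_def indicator_def intro!: nn_integral_cong elim: trans)
qed

lemma measurable_emeasure_reproduction:
  assumes [measurable]: "A \<in> sets borel"
  shows "(\<lambda>\<omega>. emeasure (reproduction X \<omega>) A) \<in> borel_measurable M"
proof -
  interpret C: sigma_finite_measure "count_space (UNIV :: nat list set)"
    by (rule sigma_finite_measure_count_space)
  have "(\<lambda>(\<omega>, u). if u \<in> tree X \<omega> \<and> length u = 1 \<and> position X \<omega> u \<in> A then 1 else 0 :: ennreal)
      \<in> borel_measurable (M \<Otimes>\<^sub>M count_space UNIV)"
    by (subst measurable_pair_swap_iff)
       (auto intro!: measurable_pair_measure_countable1 simp: pred_def[symmetric])
  then show ?thesis
    unfolding emeasure_reproduction[OF assms] by (rule C.borel_measurable_nn_integral)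
qed

lemma emeasure_intensity:
  assumes "A \<in> sets borel"
  shows "emeasure (intensity M X) A = (\<integral>\<^sup>+\<omega>. emeasure (reproduction X \<omega>) A \<partial>M)"
proof (rule emeasure_measure_of[OF intensity_def])
  show "positive (sets (intensity M X)) (\<lambda>A. \<integral>\<^sup>+\<omega>. emeasure (reproduction X \<omega>) A \<partial>M)"
    by (simp add: positive_def)
  show "countably_additive (sets (intensity M X)) (\<lambda>A. \<integral>\<^sup>+\<omega>. emeasure (reproduction X \<omega>) A \<partial>M)"
    unfolding sets_intensity
  proof (rule countably_additiveI)
    fix B :: "nat \<Rightarrow> real set"
    assume B: "range B \<subseteq> sets borel" "disjoint_family B"
    have "(\<Sum>i. \<integral>\<^sup>+\<omega>. emeasure (reproduction X \<omega>) (B i) \<partial>M)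
        = (\<integral>\<^sup>+\<omega>. (\<Sum>i. emeasure (reproduction X \<omega>) (B i)) \<partial>M)"
      using B by (intro nn_integral_suminf[symmetric] measurable_emeasure_reproduction) auto
    also have "\<dots> = (\<integral>\<^sup>+\<omega>. emeasure (reproduction X \<omega>) (\<Union>i. B i) \<partial>M)"
      using B by (intro nn_integral_cong suminf_emeasure) (auto simp: reproduction_def)
    finally show "(\<Sum>i. \<integral>\<^sup>+\<omega>. emeasure (reproduction X \<omega>) (B i) \<partial>M)
        = (\<integral>\<^sup>+\<omega>. emeasure (reproduction X \<omega>) (\<Union>i. B i) \<partial>M)" .
  qed
qed (use assms in simp_all)

lemma survival_in_sets [measurable]: "survival M X \<in> sets M"
proof -
  have "infinite (tree X \<omega>) \<longleftrightarrow> (\<forall>us. \<exists>u. u \<in> tree X \<omega> \<and> u \<notin> set us)" for \<omega>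
    by (metis List.finite_set finite_list finite_subset subsetI)
  moreover have "Measurable.pred M (\<lambda>\<omega>. \<forall>us. \<exists>u. u \<in> tree X \<omega> \<and> u \<notin> set us)"
    by measurable
  ultimately show ?thesis
    by (simp add: survival_def pred_def)
qed

end

text \<open>The logarithm on \<open>[0, \<infinity>]\<close>, with \<open>log 0 = -\<infinity>\<close> (whereas \<^term>\<open>ln (0 :: real) = 0\<close>).\<close>

definition ext_ln :: "ennreal \<Rightarrow> ereal" where
  "ext_ln x = (if x = 0 then -\<infinity> else if x = \<infinity> then \<infinity> else ereal (ln (enn2real x)))"

definition ext_ln_plus :: "ennreal \<Rightarrow> ennreal" where
  "ext_ln_plus x = e2ennreal (max (ext_ln x) 0)"

definition log_laplace :: "real measure \<Rightarrow> real \<Rightarrow> ereal" where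
  "log_laplace \<mu> t = ext_ln (\<integral>\<^sup>+x. ennreal (exp (- t * x)) \<partial>\<mu>)"

text \<open>
  Condition (H1'), for the value \<open>t\<close> of \<open>t\<^sup>*\<close>.  The integral of \<open>x exp (- t x)\<close> is an extended real,
  the difference of the integrals \<open>p\<close> and \<open>n\<close> of the positive and negative parts; it is
  well-defined when these are not both infinite, and may take the value \<open>\<infinity>\<close>.
\<close>

definition H1' :: "real measure \<Rightarrow> real \<Rightarrow> bool" where
  "H1' \<mu> t \<longleftrightarrow>
    t > 0 \<and> log_laplace \<mu> t = 0 \<and> (\<forall>s>0. log_laplace \<mu> s = 0 \<longrightarrow> t \<le> s) \<and>
    (let p = \<integral>\<^sup>+x\<in>{0<..}. ennreal (x * exp (- t * x)) \<partial>\<mu>;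
         n = \<integral>\<^sup>+x\<in>{..<0}. ennreal (\<bar>x\<bar> * exp (- t * x)) \<partial>\<mu>
     in (n < \<infinity> \<or> p < \<infinity>) \<and> enn2ereal p - enn2ereal n > 0) \<and>
    emeasure \<mu> {..<0} > 0"

text \<open>\<open>\<Sum>\<^bsub>|u|=1\<^esub> f(V(u))\<close>, as an element of \<open>[0, \<infinity>]\<close>\<close>

definition sum_gen1 :: "(nat list \<Rightarrow> 'w \<Rightarrow> offspring) \<Rightarrow> (real \<Rightarrow> real) \<Rightarrow> 'w \<Rightarrow> ennreal" where
  "sum_gen1 X f \<omega> =
    (\<integral>\<^sup>+u. ennreal (f (position X \<omega> u)) \<partial>count_space (generation X 1 \<omega>))"

end

theory Submission
  imports Defs "HOL-Real_Asymp.Real_Asymp"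
begin

text \<open>
  Size biasing by \<open>exp (- t x)\<close>, \<open>t = t\<^sup>*\<close>, turns the branching random walk into a random walk \<open>S\<close>
  with drift \<open>m > 0\<close> and a moment of order greater than \<open>1\<close>.

  Lower bound: a path of length \<open>n\<close> below \<open>L = a sqrt (n ln n)\<close> forces \<open>S\<close> to stay in an interval
  of length about \<open>L\<close> for \<open>n\<close> steps.  Every \<open>2 L / m\<close> steps or so this requires an atypical downward
  jump, which costs a power of \<open>L\<close>; the total cost \<open>exp (- const n ln n / L)\<close> beats the factor
  \<open>exp (t L)\<close> of the change of measure if \<open>a\<close> is small.

  Upper bound: climbing freely for \<open>T\<close> generations produces about \<open>exp (t y)\<close> particles at heights
  \<open>y\<close> of order \<open>T\<close>; with probability bounded below one of them has a child at height at most
  \<open>const ln T\<close>.  Chaining such cycles of lengths \<open>T\<^sub>j\<close> of order \<open>j ln j\<close> gives paths that reach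
  heights of order \<open>j ln j\<close> after about \<open>j\<^sup>2 ln j\<close> generations.

  The existence of a ray below \<open>C + a sqrt (n ln n)\<close> for some \<open>C\<close> is inherited from any child, so its
  probability is \<open>0\<close> or that of survival, and \<open>a\<^sub>1\<close> is the critical value of \<open>a\<close>.  Up to a null set
  this event is measurable, because by Koenig's lemma it can be read off the finite paths: almost
  surely every family has finitely many members below each level.
\<close>

section \<open>The branching property\<close>

text \<open>Under the size-biased law a large downward jump costs a power of its length on both
  sides: at least a power by the moment assumption, at most a power because the weight
  \<open>exp (- t x)\<close> cancels the exponential part of the jump tail. Hence the cost
  \<open>(n / L) * ln n\<close> and the gain \<open>t * L\<close> balance exactly for
  \<open>L\<close> of order \<open>sqrt (n * ln n)\<close>.

  Only a moment of order above 1 and an L log L condition are at hand, so neither the variance of a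
  step nor second moments of particle numbers need be finite. Everything rests on the recursion for
  the probability \<open>W n b x\<close> of a path below \<open>b\<close> started at
  \<open>x\<close>: the upper estimate linearises it by the union bound, the lower one by
  \<open>s / (1 + s)\<close>, and both become expectations along the same walk.

  No constant factor may be lost per cycle, since infinitely many cycles follow one another: the
  success probability assumed after a cycle must be recovered before it. The constant in front of
  \<open>ln T\<close> pays for that.\<close>

definition join_env :: "'a \<times> (nat \<Rightarrow> nat list \<Rightarrow> 'a) \<Rightarrow> nat list \<Rightarrow> 'a" where
  "join_env = (\<lambda>(x, es) u. case u of [] \<Rightarrow> x | i # v \<Rightarrow> es i v)"

lemma join_env_simps [simp]:
  "join_env (x, es) [] = x" "join_env (x, es) (i # v) = es i v"
  by (simp_all add: join_env_def)

lemma measurable_join_env [measurable]: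
  "join_env \<in> P \<Otimes>\<^sub>M (\<Pi>\<^sub>M i\<in>UNIV. \<Pi>\<^sub>M u\<in>UNIV. P) \<rightarrow>\<^sub>M (\<Pi>\<^sub>M u\<in>UNIV. P)"
proof (rule measurable_PiM_single')
  fix u :: "nat list"
  show "(\<lambda>z. join_env z u) \<in> P \<Otimes>\<^sub>M (\<Pi>\<^sub>M i\<in>UNIV. \<Pi>\<^sub>M u\<in>UNIV. P) \<rightarrow>\<^sub>M P"
  proof (cases u)
    case (Cons i v)
    have "(\<lambda>z. snd z i v) \<in> P \<Otimes>\<^sub>M (\<Pi>\<^sub>M i\<in>UNIV. \<Pi>\<^sub>M u\<in>UNIV. P) \<rightarrow>\<^sub>M P"
      by (intro measurable_compose[OF measurable_compose[OF measurable_snd measurable_component_singleton]]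
          measurable_component_singleton) auto
    then show ?thesis by (simp add: join_env_def Cons split_beta)
  qed (simp add: join_env_def split_beta)
qed (auto simp: space_pair_measure space_PiM join_env_def PiE_iff split: list.splits)

text \<open>The set of labels is the root together with one copy of itself for each first letter, so
  gluing independent pieces only regroups the coordinates of a product measure; cylinders over
  finitely many labels suffice to see this. Every label carries a mark, in the tree or not, so
  independence of the subtrees needs no conditioning on the family of the root.\<close>

lemma (in prob_space) distr_join_env:
  fixes E
  defines "E \<equiv> \<Pi>\<^sub>M u\<in>(UNIV :: nat list set). M"
  shows "distr (M \<Otimes>\<^sub>M (\<Pi>\<^sub>M i\<in>UNIV. E)) E join_env = E"
proof -
  interpret prod_M: product_prob_space "\<lambda>_. M" "UNIV :: nat list set" ..
  interpret E: prob_space E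
    unfolding E_def by (rule prod_M.prob_space_axioms)
  interpret prod_E: product_prob_space "\<lambda>_. E" "UNIV :: nat set" ..
  show ?thesis
    unfolding E_def
  proof (rule prod_M.PiM_eq)
    fix J :: "nat list set" and F
    assume J: "finite J" and F: "\<And>j. j \<in> J \<Longrightarrow> F j \<in> sets M"
    define I where "I = hd ` (J - {[]})"
    define K where "K i = Cons i -` J" for i
    define G where "G i = prod_emb UNIV (\<lambda>_. M) (K i) (\<Pi>\<^sub>E v\<in>K i. F (i # v))" for i
    define A where "A = (if [] \<in> J then F [] else space M)"
    have fin: "finite I" "finite (K i)" for i
      using J by (auto simp: I_def K_def intro!: finite_vimageI)
    have J_eq: "J - {[]} = (\<lambda>(i, v). i # v) ` Sigma I K"
    proof -
      have "u \<in> (\<lambda>(i, v). i # v) ` Sigma I K" if "u \<in> J - {[]}" for u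
        using that by (cases u) (force simp: I_def K_def)+
      then show ?thesis by (auto simp: K_def)
    qed
    have G [measurable]: "G i \<in> sets E" for i
      unfolding G_def E_def using fin F by (intro sets_PiM_I) (auto simp: K_def)
    have A [measurable]: "A \<in> sets M"
      using F by (simp add: A_def)
    have emG: "emeasure E (G i) = (\<Prod>v\<in>K i. emeasure M (F (i # v)))" for i
      unfolding G_def E_def using fin F by (intro prod_M.emeasure_PiM_emb) (auto simp: K_def)
    have emA: "emeasure M A = (\<Prod>u\<in>J \<inter> {[]}. emeasure M (F u))"
      by (auto simp: A_def emeasure_space_1 Int_insert_right)
    have "join_env -` prod_emb UNIV (\<lambda>_. M) J (Pi\<^sub>E J F) \<inter> space (M \<Otimes>\<^sub>M (\<Pi>\<^sub>M i\<in>UNIV. E))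
        = A \<times> prod_emb UNIV (\<lambda>_. E) I (\<Pi>\<^sub>E i\<in>I. G i)" (is "?L = ?R")
    proof -
      have "(x, es) \<in> ?L \<longleftrightarrow> (x, es) \<in> ?R" for x es
      proof (cases "x \<in> space M \<and> (\<forall>i u. es i u \<in> space M)")
        case True
        have 0: "(x, es) \<in> ?L \<longleftrightarrow> (\<forall>u\<in>J. join_env (x, es) u \<in> F u)"
          using True by (auto simp: prod_emb_def space_pair_measure space_PiM E_def PiE_iff Pi_iff
              join_env_def split: list.splits)
        have 1: "(\<forall>u\<in>J. join_env (x, es) u \<in> F u) \<longleftrightarrow> x \<in> A \<and> (\<forall>u\<in>J-{[]}. join_env (x, es) u \<in> F u)"
          using True by (auto simp: A_def)
        have 2: "(\<forall>u\<in>J-{[]}. join_env (x, es) u \<in> F u) \<longleftrightarrow> (\<forall>i\<in>I. \<forall>v\<in>K i. es i v \<in> F (i # v))"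
          unfolding J_eq by auto
        have 3: "es i \<in> G i \<longleftrightarrow> (\<forall>v\<in>K i. es i v \<in> F (i # v))" for i
          using True by (auto simp: G_def prod_emb_def PiE_iff Pi_iff space_PiM)
        have 4: "es i \<in> space E" for i using True by (auto simp: E_def space_PiM)
        have 5: "es \<in> prod_emb UNIV (\<lambda>_. E) I (\<Pi>\<^sub>E i\<in>I. G i) \<longleftrightarrow> (\<forall>i\<in>I. es i \<in> G i)"
          using 4 by (auto simp: prod_emb_def PiE_iff Pi_iff space_PiM)
        show ?thesis using 0 1 2 3 5 by auto
      next
        case False
        have "A \<subseteq> space M" using A by (rule sets.sets_into_space)
        then show ?thesis using False
          by (auto simp: space_pair_measure space_PiM E_def prod_emb_def PiE_iff Pi_iff)
      qed
      then show ?thesis by auto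
    qed
    moreover have "prod_emb UNIV (\<lambda>_. E) I (\<Pi>\<^sub>E i\<in>I. G i) \<in> sets (\<Pi>\<^sub>M i\<in>UNIV. E)"
      using fin by (intro sets_PiM_I) auto
    ultimately have "emeasure (distr (M \<Otimes>\<^sub>M (\<Pi>\<^sub>M i\<in>UNIV. E)) E join_env) (prod_emb UNIV (\<lambda>_. M) J (Pi\<^sub>E J F))
        = emeasure M A * emeasure (\<Pi>\<^sub>M i\<in>UNIV. E) (prod_emb UNIV (\<lambda>_. E) I (\<Pi>\<^sub>E i\<in>I. G i))"
      using J F by (subst emeasure_distr)
        (auto simp: E_def intro!: sets_PiM_I prod_E.emeasure_pair_measure_Times[unfolded E_def])
    also have "\<dots> = emeasure M A * (\<Prod>i\<in>I. emeasure E (G i))"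
      using fin by (subst prod_E.emeasure_PiM_emb) auto
    also have "(\<Prod>i\<in>I. emeasure E (G i)) = (\<Prod>u\<in>J - {[]}. emeasure M (F u))"
      unfolding J_eq emG
      by (subst prod.reindex) (auto simp: inj_on_def prod.Sigma fin split_beta)
    also have "emeasure M A * \<dots> = (\<Prod>u\<in>J. emeasure M (F u))"
      unfolding emA using J by (subst prod.union_disjoint[symmetric]) (auto intro!: prod.cong)
    finally show "emeasure (distr (M \<Otimes>\<^sub>M (\<Pi>\<^sub>M i\<in>UNIV. \<Pi>\<^sub>M u\<in>UNIV. M)) (\<Pi>\<^sub>M u\<in>UNIV. M) join_env)
        (prod_emb UNIV (\<lambda>_. M) J (Pi\<^sub>E J F)) = (\<Prod>u\<in>J. emeasure M (F u))"
      unfolding E_def .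
  qed simp
qed

section \<open>Environments and the probability of a path below a barrier\<close>

type_synonym environment = "nat list \<Rightarrow> offspring"

definition subenv :: "nat \<Rightarrow> (nat list \<Rightarrow> 'a) \<Rightarrow> nat list \<Rightarrow> 'a" where
  "subenv i e = (\<lambda>v. e (i # v))"

lemma subenv_join_env [simp]: "subenv i (join_env (x, es)) = es i"
  by (simp add: subenv_def)

lemma measurable_subenv [measurable]:
  "subenv i \<in> (\<Pi>\<^sub>M u\<in>(UNIV :: nat list set). P) \<rightarrow>\<^sub>M (\<Pi>\<^sub>M u\<in>UNIV. P)"
  unfolding subenv_def
  by (rule measurable_PiM_single') (auto simp: space_PiM PiE_iff)

text \<open>The recursion follows the first step of the path and shifts the barrier instead of
  carrying a clock. It matches the decomposition of an environment into root and subtrees, which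
  turns it into a recursion for probabilities; \<open>below_iff\<close> gives back the description
  by paths in the tree.\<close>

primrec below :: "nat \<Rightarrow> (nat \<Rightarrow> real) \<Rightarrow> real \<Rightarrow> environment \<Rightarrow> bool" where
  "below 0 b x e \<longleftrightarrow> x \<le> b 0"
| "below (Suc n) b x e \<longleftrightarrow> x \<le> b 0 \<and>
    (\<exists>i. enat i < fst (e []) \<and> below n (\<lambda>k. b (Suc k)) (x + snd (e []) i) (subenv i e))"

lemma below_antimono: "below n b x e \<Longrightarrow> y \<le> x \<Longrightarrow> below n b y e"
proof (induction n arbitrary: b x y e)
  case (Suc n)
  then obtain i where i: "enat i < fst (e [])"
    "below n (\<lambda>k. b (Suc k)) (x + snd (e []) i) (subenv i e)" by auto
  have "below n (\<lambda>k. b (Suc k)) (y + snd (e []) i) (subenv i e)"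
    by (rule Suc.IH[OF i(2)]) (use Suc.prems in auto)
  with i Suc.prems show ?case by auto
qed auto

lemma below_mono_barrier: "below n b x e \<Longrightarrow> (\<And>k. b k \<le> b' k) \<Longrightarrow> below n b' x e"
proof (induction n arbitrary: b b' x e)
  case (Suc n)
  then obtain i where i: "enat i < fst (e [])"
    "below n (\<lambda>k. b (Suc k)) (x + snd (e []) i) (subenv i e)" by auto
  have "below n (\<lambda>k. b' (Suc k)) (x + snd (e []) i) (subenv i e)"
    by (rule Suc.IH[OF i(2)]) (use Suc.prems in auto)
  moreover have "x \<le> b' 0"
    using Suc.prems(1) Suc.prems(2)[of 0] by auto
  ultimately show ?case using i by auto
qed (auto intro: order_trans)

lemma below_Suc_imp: "below (Suc n) b x e \<Longrightarrow> below n b x e"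
proof (induction n arbitrary: b x e)
  case (Suc n)
  then obtain i where i: "x \<le> b 0" "enat i < fst (e [])"
    "below (Suc n) (\<lambda>k. b (Suc k)) (x + snd (e []) i) (subenv i e)" by auto
  then show ?case using Suc.IH[OF i(3)] by auto
qed auto

lemma below_le: "below n b x e \<Longrightarrow> m \<le> n \<Longrightarrow> below m b x e"
  by (induction n) (auto simp: le_Suc_eq simp del: below.simps dest: below_Suc_imp)

lemma below_shift: "below n (\<lambda>k. b k + c) (x + c) e \<longleftrightarrow> below n b x e"
proof (induction n arbitrary: b x e)
  case (Suc n)
  have "x + c + y = x + y + c" for y by simp
  then show ?case using Suc[of "\<lambda>k. b (Suc k)"] by (simp only: below.simps) simp
qed auto

lemma measurable_fst_offspring [measurable]: "fst \<in> offspring_space \<rightarrow>\<^sub>M count_space UNIV"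
  by (simp add: offspring_space_def)

lemma measurable_snd_offspring [measurable]: "(\<lambda>p. snd p i) \<in> borel_measurable offspring_space"
proof -
  have "snd \<in> offspring_space \<rightarrow>\<^sub>M (\<Pi>\<^sub>M i\<in>UNIV. (borel :: real measure))"
    by (simp add: offspring_space_def)
  then show ?thesis
    by (rule measurable_compose) (simp add: measurable_component_singleton)
qed

lemma space_offspring_space [simp]: "space offspring_space = UNIV"
  by (auto simp: offspring_space_def space_pair_measure space_PiM)

locale offspring_law = prob_space P for P :: "offspring measure" +
  assumes sets_P [measurable_cong, simp]: "sets P = sets offspring_space"
begin

lemma space_P [simp]: "space P = UNIV"
  using sets_eq_imp_space_eq[OF sets_P] by simp

definition E :: "environment measure" where
  "E = (\<Pi>\<^sub>M u\<in>UNIV. P)"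

lemma space_E [simp]: "space E = UNIV"
  by (auto simp: E_def space_PiM)

lemma measurable_E_component [measurable]: "(\<lambda>e. e u) \<in> E \<rightarrow>\<^sub>M P"
  by (simp add: E_def measurable_component_singleton)

lemma measurable_E_subenv [measurable]: "subenv i \<in> E \<rightarrow>\<^sub>M E"
  by (simp add: E_def)

sublocale E: prob_space E
  unfolding E_def by (rule prob_space_PiM) unfold_locales

lemma measurable_below:
  "Measurable.pred (borel \<Otimes>\<^sub>M E) (\<lambda>z. below n b (fst z) (snd z))"
proof (induction n arbitrary: b)
  case (Suc n)
  have N [measurable]: "(\<lambda>z. fst (snd z [])) \<in> borel \<Otimes>\<^sub>M E \<rightarrow>\<^sub>M count_space UNIV"
    by (rule measurable_compose[OF measurable_compose[OF measurable_snd measurable_E_component]])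
      measurable
  have D: "(\<lambda>z. snd (snd z []) i) \<in> borel_measurable (borel \<Otimes>\<^sub>M E)" for i
    by (rule measurable_compose[OF measurable_compose[OF measurable_snd measurable_E_component]])
      measurable
  have "(\<lambda>z. (fst z + snd (snd z []) i, subenv i (snd z))) \<in> borel \<Otimes>\<^sub>M E \<rightarrow>\<^sub>M borel \<Otimes>\<^sub>M E" for i
    using D[of i] by measurable
  from measurable_compose[OF this Suc[of "\<lambda>k. b (Suc k)"]]
  have [measurable]: "Measurable.pred (borel \<Otimes>\<^sub>M E)
      (\<lambda>z. below n (\<lambda>k. b (Suc k)) (fst z + snd (snd z []) i) (subenv i (snd z)))" for i
    by simp
  show ?case by simp measurable
qed simp

lemma measurable_below_compose [measurable (raw)]:
  assumes "f \<in> borel_measurable N" "g \<in> N \<rightarrow>\<^sub>M E"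
  shows "Measurable.pred N (\<lambda>z. below n b (f z) (g z))"
  using measurable_compose[OF _ measurable_below, of "\<lambda>z. (f z, g z)" N n b] assms by simp

text \<open>By \<open>distr_join_env\<close> and Fubini: given the family \<open>p\<close> of the
  root, the subtrees are independent copies of the environment. Only the first \<open>m\<close>
  children are constrained, to keep the product finite; infinite families are reached by letting
  \<open>m\<close> grow.\<close>

lemma emeasure_E_branching:
  assumes R [measurable]: "Measurable.pred P R"
    and Q: "\<And>i. Measurable.pred (P \<Otimes>\<^sub>M E) (\<lambda>z. Q i (fst z) (snd z))"
  shows "emeasure E {e. R (e []) \<and> (\<forall>i<m. Q i (e []) (subenv i e))}
    = (\<integral>\<^sup>+p. indicator {p. R p} p * (\<Prod>i<m. emeasure E {e. Q i p e}) \<partial>P)"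
proof -
  interpret prod_E: product_prob_space "\<lambda>_. E" "UNIV :: nat set" ..
  let ?A = "{e. R (e []) \<and> (\<forall>i<m. Q i (e []) (subenv i e))}"
  have [measurable]: "Measurable.pred E (\<lambda>e. Q i (e []) (subenv i e))" for i
    using measurable_compose[OF _ Q[of i], of "\<lambda>e. (e [], subenv i e)" E] by simp
  have "Measurable.pred E (\<lambda>e. R (e []) \<and> (\<forall>i<m. Q i (e []) (subenv i e)))"
    by measurable
  then have A [measurable]: "?A \<in> sets E"
    by (simp add: pred_def)
  have join [measurable]: "join_env \<in> P \<Otimes>\<^sub>M (\<Pi>\<^sub>M i\<in>UNIV. E) \<rightarrow>\<^sub>M E"
    using measurable_join_env[of P] by (simp add: E_def)
  have "emeasure E ?A = emeasure (distr (P \<Otimes>\<^sub>M (\<Pi>\<^sub>M i\<in>UNIV. E)) E join_env) ?A"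
    using distr_join_env by (simp flip: E_def)
  also have "\<dots> = emeasure (P \<Otimes>\<^sub>M (\<Pi>\<^sub>M i\<in>UNIV. E)) (join_env -` ?A \<inter> space (P \<Otimes>\<^sub>M (\<Pi>\<^sub>M i\<in>UNIV. E)))"
    by (subst emeasure_distr) auto
  also have "\<dots> = (\<integral>\<^sup>+p. emeasure (\<Pi>\<^sub>M i\<in>UNIV. E) (Pair p -` (join_env -` ?A \<inter> space (P \<Otimes>\<^sub>M (\<Pi>\<^sub>M i\<in>UNIV. E)))) \<partial>P)"
    by (rule prod_E.emeasure_pair_measure_alt) measurable
  also have "\<dots> = (\<integral>\<^sup>+p. indicator {p. R p} p * (\<Prod>i<m. emeasure E {e. Q i p e}) \<partial>P)"
  proof (rule nn_integral_cong)
    fix p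
    have [measurable]: "{e. Q i p e} \<in> sets E" for i
      using measurable_compose[OF _ Q[of i], of "\<lambda>e. (p, e)" E] by (simp add: pred_def)
    have "Pair p -` (join_env -` ?A \<inter> space (P \<Otimes>\<^sub>M (\<Pi>\<^sub>M i\<in>UNIV. E)))
        = (if R p then {es \<in> space (\<Pi>\<^sub>M i\<in>UNIV. E). \<forall>i\<in>{..<m}. es i \<in> {e. Q i p e}} else {})"
      by (auto simp: space_pair_measure space_PiM)
    then show "emeasure (\<Pi>\<^sub>M i\<in>UNIV. E) (Pair p -` (join_env -` ?A \<inter> space (P \<Otimes>\<^sub>M (\<Pi>\<^sub>M i\<in>UNIV. E))))
        = indicator {p. R p} p * (\<Prod>i<m. emeasure E {e. Q i p e})"
      using prod_E.emeasure_PiM_Collect[of "{..<m}" "\<lambda>i. {e. Q i p e}"] by simp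
  qed
  finally show ?thesis .
qed

lemma borel_measurable_pair_nat:
  assumes "\<And>i. (\<lambda>p. f p i) \<in> borel_measurable P"
  shows "(\<lambda>z. f (fst z) (snd z)) \<in> borel_measurable (P \<Otimes>\<^sub>M count_space (UNIV :: nat set))"
  by (rule measurable_compose_countable'[of UNIV "\<lambda>i z. f (fst z) i" _ _ snd])
    (auto intro: measurable_compose[OF measurable_fst] assms)

definition W :: "nat \<Rightarrow> (nat \<Rightarrow> real) \<Rightarrow> real \<Rightarrow> real" where
  "W n b x = measure E {e. below n b x e}"

lemma sets_below [measurable]: "{e. below n b x e} \<in> sets E"
  using measurable_below_compose[of "\<lambda>_. x" E "\<lambda>e. e" n b] by (simp add: pred_def)

lemma W_nonneg [simp]: "0 \<le> W n b x" and W_le_1 [simp]: "W n b x \<le> 1"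
  by (auto simp: W_def)

lemma W_antimono: "x \<le> y \<Longrightarrow> W n b y \<le> W n b x"
  unfolding W_def by (intro E.finite_measure_mono) (auto intro: below_antimono)

lemma borel_measurable_W [measurable]: "W n b \<in> borel_measurable borel"
proof -
  have "mono (\<lambda>x. - W n b x)"
    by (auto simp: mono_def W_antimono)
  then have "(\<lambda>x. - (- W n b x)) \<in> borel_measurable borel"
    by (intro borel_measurable_uminus borel_measurable_mono)
  then show ?thesis by simp
qed

lemma W_mono_barrier: "(\<And>k. b k \<le> b' k) \<Longrightarrow> W n b x \<le> W n b' x"
  unfolding W_def by (intro E.finite_measure_mono) (auto intro: below_mono_barrier)

lemma W_le: "m \<le> n \<Longrightarrow> W n b x \<le> W m b x"
  unfolding W_def by (intro E.finite_measure_mono) (auto intro: below_le)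

lemma W_shift: "W n (\<lambda>k. b k + c) (x + c) = W n b x"
  by (simp add: W_def below_shift)

lemma W_0: "W 0 b x = (if x \<le> b 0 then 1 else 0)"
  using E.prob_space by (auto simp: W_def)

lemma W_eq_0: "b 0 < x \<Longrightarrow> W n b x = 0"
  by (cases n) (auto simp: W_def)

text \<open>Complement of the event that each of the first \<open>m\<close> children fails; an
  absent child contributes the factor 1.\<close>

lemma W_Suc_ge_prod:
  assumes "x \<le> b 0"
  shows "(\<integral>\<^sup>+p. ennreal (1 - (\<Prod>i<m. if enat i < fst p then 1 - W n (\<lambda>k. b (Suc k)) (x + snd p i) else 1)) \<partial>P)
    \<le> ennreal (W (Suc n) b x)"
proof -
  let ?b = "\<lambda>k. b (Suc k)"
  let ?Q = "\<lambda>i p e. enat i < fst p \<longrightarrow> \<not> below n ?b (x + snd p i) e"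
  let ?f = "\<lambda>p. \<Prod>i<m. if enat i < fst p then 1 - W n ?b (x + snd p i) else 1"
  have [measurable]: "?f \<in> borel_measurable P"
    by measurable
  have f: "0 \<le> ?f p" "?f p \<le> 1" for p
    by (auto intro!: prod_nonneg prod_le_1)
  have Q: "Measurable.pred (P \<Otimes>\<^sub>M E) (\<lambda>z. ?Q i (fst z) (snd z))" for i
    by measurable
  have meas: "{e. \<forall>i<m. ?Q i (e []) (subenv i e)} \<in> sets E"
  proof -
    have "Measurable.pred E (\<lambda>e. ?Q i (e []) (subenv i e))" for i
      using measurable_compose[OF _ Q[of i], of "\<lambda>e. (e [], subenv i e)" E] by simp
    then have "Measurable.pred E (\<lambda>e. \<forall>i<m. ?Q i (e []) (subenv i e))"
      by measurable
    then show ?thesis by (simp add: pred_def)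
  qed
  have em: "emeasure E {e. ?Q i p e} = ennreal (if enat i < fst p then 1 - W n ?b (x + snd p i) else 1)" for i p
  proof (cases "enat i < fst p")
    case True
    have "{e. ?Q i p e} = space E - {e. below n ?b (x + snd p i) e}"
      using True by auto
    then show ?thesis
      using True by (simp only: E.emeasure_eq_measure E.prob_compl[OF sets_below]) (simp add: W_def)
  qed (use E.emeasure_space_1 in simp)
  have "emeasure E {e. \<forall>i<m. ?Q i (e []) (subenv i e)}
      = (\<integral>\<^sup>+p. (\<Prod>i<m. emeasure E {e. ?Q i p e}) \<partial>P)"
    using emeasure_E_branching[of "\<lambda>_. True" ?Q m] Q by simp
  also have "\<dots> = (\<integral>\<^sup>+p. ennreal (?f p) \<partial>P)"
    unfolding em by (subst prod_ennreal) auto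
  also have "\<dots> = ennreal (\<integral>p. ?f p \<partial>P)"
    using f by (intro nn_integral_eq_integral integrable_const_bound[where B = 1]) auto
  finally have 1: "measure E {e. \<forall>i<m. ?Q i (e []) (subenv i e)} = (\<integral>p. ?f p \<partial>P)"
    by (simp add: measure_def integral_nonneg_AE f)
  have int: "integrable P ?f"
    using f by (intro integrable_const_bound[where B = 1]) auto
  have "(\<integral>\<^sup>+p. ennreal (1 - ?f p) \<partial>P) = ennreal (\<integral>p. 1 - ?f p \<partial>P)"
    using f int by (intro nn_integral_eq_integral) auto
  also have "\<dots> = ennreal (1 - (\<integral>p. ?f p \<partial>P))"
    using int prob_space by simp
  also have "1 - (\<integral>p. ?f p \<partial>P) = measure E (space E - {e. \<forall>i<m. ?Q i (e []) (subenv i e)})"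
    using meas by (subst E.prob_compl) (simp_all add: 1)
  also have "\<dots> \<le> W (Suc n) b x"
    unfolding W_def using assms by (intro E.finite_measure_mono) auto
  finally show ?thesis by (simp add: ennreal_leI)
qed

end

section \<open>Laws of large numbers under a moment of order greater than one\<close>

lemma powr_le_one_plus_powr:
  fixes x :: real
  assumes "0 \<le> a" "a \<le> b"
  shows "\<bar>x\<bar> powr a \<le> 1 + \<bar>x\<bar> powr b"
proof (cases "\<bar>x\<bar> \<le> 1")
  case True
  then have "\<bar>x\<bar> powr a \<le> 1 powr a" using assms by (intro powr_mono2) auto
  then show ?thesis by (simp add: add_increasing2)
next
  case False
  then have "\<bar>x\<bar> powr a \<le> \<bar>x\<bar> powr b" using assms by (intro powr_mono) auto
  then show ?thesis by simp
qed

lemma (in prob_space) expectation_square_sum_centered: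
  fixes Z :: "nat \<Rightarrow> 'a \<Rightarrow> real"
  assumes indep: "indep_vars (\<lambda>_. borel) Z UNIV"
    and bounded: "\<And>i \<omega>. \<omega> \<in> space M \<Longrightarrow> \<bar>Z i \<omega>\<bar> \<le> B"
    and centered: "\<And>i. expectation (Z i) = 0"
  shows "expectation (\<lambda>\<omega>. (\<Sum>i<n. Z i \<omega>)\<^sup>2) = (\<Sum>i<n. expectation (\<lambda>\<omega>. (Z i \<omega>)\<^sup>2))"
proof -
  have [measurable]: "Z i \<in> borel_measurable M" for i
    using indep by (auto simp: indep_vars_def)
  have int: "integrable M (Z i)" for i
    using bounded by (intro integrable_const_bound[where B = B]) auto
  have int2: "integrable M (\<lambda>\<omega>. Z i \<omega> * Z j \<omega>)" for i j
    using bounded by (intro integrable_const_bound[where B = "B * B"])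
      (auto simp: abs_mult intro!: mult_mono intro: order_trans[OF abs_ge_zero])
  have prod: "expectation (\<lambda>\<omega>. Z i \<omega> * Z j \<omega>) = (if i = j then expectation (\<lambda>\<omega>. (Z i \<omega>)\<^sup>2) else 0)" for i j
  proof (cases "i = j")
    case False
    have "expectation (\<lambda>\<omega>. \<Prod>k\<in>{i, j}. Z k \<omega>) = (\<Prod>k\<in>{i, j}. expectation (Z k))"
      using int by (intro indep_vars_lebesgue_integral indep_vars_subset[OF indep]) auto
    then show ?thesis using False centered by simp
  qed (simp add: power2_eq_square)
  have "expectation (\<lambda>\<omega>. (\<Sum>i<n. Z i \<omega>)\<^sup>2) = expectation (\<lambda>\<omega>. \<Sum>i<n. \<Sum>j<n. Z i \<omega> * Z j \<omega>)"
    by (simp add: power2_eq_square sum_product)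
  also have "\<dots> = (\<Sum>i<n. \<Sum>j<n. if i = j then expectation (\<lambda>\<omega>. (Z i \<omega>)\<^sup>2) else 0)"
    using int2 by (simp add: prod)
  also have "\<dots> = (\<Sum>i<n. expectation (\<lambda>\<omega>. (Z i \<omega>)\<^sup>2))"
    by simp
  finally show ?thesis .
qed

text \<open>
  Truncate the summands at level \<open>n\<close>: some summand is truncated with probability at most
  \<open>n K n\<^sup>-\<^sup>\<alpha>\<close>, and Chebyshev's inequality applies to the truncated sum, of variance at most
  \<open>n K n\<^sup>2\<^sup>-\<^sup>\<alpha>\<close>.
\<close>

lemma (in prob_space) weak_law_rate:
  fixes X :: "nat \<Rightarrow> 'a \<Rightarrow> real"
  assumes indep: "indep_vars (\<lambda>_. borel) X UNIV"
    and ident: "\<And>i. distr M borel (X i) = distr M borel (X 0)"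
    and \<alpha>: "1 < \<alpha>" "\<alpha> \<le> 2"
    and moment: "integrable M (\<lambda>\<omega>. \<bar>X 0 \<omega>\<bar> powr \<alpha>)"
    and \<epsilon>: "\<epsilon> > 0"
  shows "\<exists>C>0. \<forall>n\<ge>1. prob {\<omega> \<in> space M. \<epsilon> * real n \<le> \<bar>(\<Sum>i<n. X i \<omega>) - real n * expectation (X 0)\<bar>}
    \<le> C * real n powr (1 - \<alpha>)"
proof -
  have X [measurable]: "X i \<in> borel_measurable M" for i
    using indep by (auto simp: indep_vars_def)
  define K where "K = expectation (\<lambda>\<omega>. \<bar>X 0 \<omega>\<bar> powr \<alpha>)"
  define m where "m = expectation (X 0)"
  have K: "0 \<le> K" unfolding K_def by (intro integral_nonneg_AE) auto
  have le: "\<bar>x\<bar> \<le> 1 + \<bar>x\<bar> powr \<alpha>" for x :: real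
    using powr_le_one_plus_powr[of 1 \<alpha> x] \<alpha> by simp
  have intX: "integrable M (X 0)"
    by (rule Bochner_Integration.integrable_bound[of _ "\<lambda>\<omega>. 1 + \<bar>X 0 \<omega>\<bar> powr \<alpha>"])
      (use moment le in auto)
  have Ef: "expectation (\<lambda>\<omega>. f (X i \<omega>)) = expectation (\<lambda>\<omega>. f (X 0 \<omega>))"
    if [measurable]: "f \<in> borel_measurable borel" for i and f :: "real \<Rightarrow> real"
  proof -
    have "expectation (\<lambda>\<omega>. f (X i \<omega>)) = (\<integral>x. f x \<partial>distr M borel (X i))"
      by (rule integral_distr[symmetric]) auto
    also have "\<dots> = expectation (\<lambda>\<omega>. f (X 0 \<omega>))"
      unfolding ident[of i] by (rule integral_distr) auto
    finally show ?thesis .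
  qed
  have tail: "prob {\<omega> \<in> space M. real n < \<bar>X i \<omega>\<bar>} \<le> K * real n powr (-\<alpha>)" if "n \<ge> 1" for n i
  proof -
    define S where "S = {\<omega> \<in> space M. real n < \<bar>X i \<omega>\<bar>}"
    have "prob S = expectation (indicator S)"
      by (simp add: S_def)
    also have "\<dots> = expectation (\<lambda>\<omega>. indicator {x. real n < \<bar>x\<bar>} (X i \<omega>))"
      by (intro Bochner_Integration.integral_cong) (auto simp: S_def indicator_def)
    finally have "prob {\<omega> \<in> space M. real n < \<bar>X i \<omega>\<bar>} = expectation (\<lambda>\<omega>. indicator {x. real n < \<bar>x\<bar>} (X i \<omega>))"
      unfolding S_def .
    also have "\<dots> = expectation (\<lambda>\<omega>. indicator {x. real n < \<bar>x\<bar>} (X 0 \<omega>))"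
      by (rule Ef) simp
    also have "\<dots> \<le> expectation (\<lambda>\<omega>. \<bar>X 0 \<omega>\<bar> powr \<alpha> * real n powr (-\<alpha>))"
    proof (rule integral_mono)
      show "indicator {x. real n < \<bar>x\<bar>} (X 0 \<omega>) \<le> \<bar>X 0 \<omega>\<bar> powr \<alpha> * real n powr (-\<alpha>)" for \<omega>
      proof (cases "real n < \<bar>X 0 \<omega>\<bar>")
        case True
        have "1 = real n powr \<alpha> * real n powr (-\<alpha>)"
          using that by (simp add: powr_minus field_simps)
        also have "\<dots> \<le> \<bar>X 0 \<omega>\<bar> powr \<alpha> * real n powr (-\<alpha>)"
          using True \<alpha> by (intro mult_right_mono powr_mono2) auto
        finally show ?thesis using True by simp
      qed simp
    qed (use moment in \<open>auto intro!: integrable_const_bound[where B = 1] simp: indicator_def\<close>)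
    also have "\<dots> = K * real n powr (-\<alpha>)"
      by (simp add: K_def)
    finally show ?thesis .
  qed
  \<comment> \<open>The term \<open>K * (1 + 4 / \<epsilon>\<^sup>2)\<close> pays for truncation and
    Chebyshev's inequality, \<open>2 * K / \<epsilon>\<close> makes the bound trivial for small
    \<open>n\<close>, and 1 keeps the constant positive when \<open>K = 0\<close>.\<close>
  let ?C = "K * (1 + 4 / \<epsilon>\<^sup>2) + 2 * K / \<epsilon> + 1"
  have "prob {\<omega> \<in> space M. \<epsilon> * real n \<le> \<bar>(\<Sum>i<n. X i \<omega>) - real n * m\<bar>} \<le> ?C * real n powr (1 - \<alpha>)"
    if n: "n \<ge> 1" for n
  \<comment> \<open>The left side bounds the shift of the mean caused by truncation. If it exceeds
    \<open>\<epsilon> / 2\<close>, the claimed bound is at least 1.\<close>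
  proof (cases "K * real n powr (1 - \<alpha>) \<le> \<epsilon> / 2")
    case False
    then have "1 \<le> (2 * K / \<epsilon>) * real n powr (1 - \<alpha>)"
      using \<epsilon> by (simp add: field_simps)
    also have "\<dots> \<le> ?C * real n powr (1 - \<alpha>)"
      using K \<epsilon> by (intro mult_right_mono) auto
    finally show ?thesis by (rule order_trans[OF prob_le_1])
  next
    case True
    define \<tau> where "\<tau> x = (if \<bar>x\<bar> \<le> real n then x else 0)" for x :: real
    have [measurable]: "\<tau> \<in> borel_measurable borel"
      unfolding \<tau>_def by measurable
    have \<tau>_bound: "\<bar>\<tau> x\<bar> \<le> real n" for x by (simp add: \<tau>_def)
    define m' where "m' = expectation (\<lambda>\<omega>. \<tau> (X 0 \<omega>))"
    have int\<tau>: "integrable M (\<lambda>\<omega>. \<tau> (X i \<omega>))" for i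
      using \<tau>_bound by (intro integrable_const_bound[where B = "real n"]) auto
    have int\<tau>2: "integrable M (\<lambda>\<omega>. (\<tau> (X i \<omega>))\<^sup>2)" for i
    proof (rule integrable_const_bound[where B = "(real n)\<^sup>2"])
      show "AE \<omega> in M. norm ((\<tau> (X i \<omega>))\<^sup>2) \<le> (real n)\<^sup>2"
        using \<tau>_bound by (intro AE_I2) (simp add: power2_le_iff_abs_le)
    qed auto
    have "\<bar>m' - m\<bar> \<le> K * real n powr (1 - \<alpha>)"
    proof -
      have "\<bar>\<tau> x - x\<bar> \<le> \<bar>x\<bar> powr \<alpha> * real n powr (1 - \<alpha>)" for x
      proof (cases "\<bar>x\<bar> \<le> real n")
        case False
        then have "\<bar>x\<bar> = \<bar>x\<bar> powr \<alpha> * \<bar>x\<bar> powr (1 - \<alpha>)"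
          using n by (subst powr_add[symmetric]) auto
        also have "\<dots> \<le> \<bar>x\<bar> powr \<alpha> * real n powr (1 - \<alpha>)"
          using False \<alpha> n by (intro mult_left_mono powr_mono2') auto
        finally show ?thesis using False by (simp add: \<tau>_def)
      qed (simp add: \<tau>_def)
      then have "\<bar>expectation (\<lambda>\<omega>. \<tau> (X 0 \<omega>) - X 0 \<omega>)\<bar> \<le> expectation (\<lambda>\<omega>. \<bar>X 0 \<omega>\<bar> powr \<alpha> * real n powr (1 - \<alpha>))"
        using moment int\<tau> intX
        by (intro order_trans[OF integral_abs_bound] integral_mono) auto
      then show ?thesis
        using int\<tau> intX by (simp add: m'_def m_def K_def)
    qed
    then have m': "\<bar>m' - m\<bar> \<le> \<epsilon> / 2" using True by simp
    define Z where "Z i \<omega> = \<tau> (X i \<omega>) - m'" for i \<omega>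
    have indepZ: "indep_vars (\<lambda>_. borel) Z UNIV"
      unfolding Z_def by (rule indep_vars_compose2[OF indep]) measurable
    have Z [measurable]: "Z i \<in> borel_measurable M" for i
      unfolding Z_def by measurable
    have Zb: "\<bar>Z i \<omega>\<bar> \<le> real n + \<bar>m'\<bar>" for i \<omega>
      using \<tau>_bound[of "X i \<omega>"] by (auto simp: Z_def)
    have EZ: "expectation (Z i) = 0" for i
    proof -
      have "Z i = (\<lambda>\<omega>. \<tau> (X i \<omega>) - m')" by (rule ext) (simp add: Z_def)
      then show ?thesis
        using int\<tau>[of i] Ef[of \<tau> i] prob_space by (simp add: m'_def)
    qed
    have EZ2: "expectation (\<lambda>\<omega>. (Z i \<omega>)\<^sup>2) \<le> K * real n powr (2 - \<alpha>)" for i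
    proof -
      have "expectation (\<lambda>\<omega>. (Z i \<omega>)\<^sup>2) = variance (\<lambda>\<omega>. \<tau> (X i \<omega>))"
        using Ef[of \<tau> i] by (simp add: Z_def m'_def)
      also have "\<dots> \<le> expectation (\<lambda>\<omega>. (\<tau> (X i \<omega>))\<^sup>2)"
        using int\<tau>[of i] int\<tau>2[of i] by (subst variance_eq) auto
      also have "\<dots> = expectation (\<lambda>\<omega>. (\<tau> (X 0 \<omega>))\<^sup>2)"
        by (rule Ef) measurable
      also have "\<dots> \<le> expectation (\<lambda>\<omega>. \<bar>X 0 \<omega>\<bar> powr \<alpha> * real n powr (2 - \<alpha>))"
      proof (rule integral_mono)
        show "(\<tau> (X 0 \<omega>))\<^sup>2 \<le> \<bar>X 0 \<omega>\<bar> powr \<alpha> * real n powr (2 - \<alpha>)" for \<omega>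
        proof (cases "\<bar>X 0 \<omega>\<bar> \<le> real n \<and> X 0 \<omega> \<noteq> 0")
          case True
          then have "(\<tau> (X 0 \<omega>))\<^sup>2 = \<bar>X 0 \<omega>\<bar> powr 2"
            by (simp add: \<tau>_def powr_numeral)
          also have "\<dots> = \<bar>X 0 \<omega>\<bar> powr \<alpha> * \<bar>X 0 \<omega>\<bar> powr (2 - \<alpha>)"
            by (subst powr_add[symmetric]) auto
          also have "\<dots> \<le> \<bar>X 0 \<omega>\<bar> powr \<alpha> * real n powr (2 - \<alpha>)"
            using True \<alpha> by (intro mult_left_mono powr_mono2) auto
          finally show ?thesis .
        qed (auto simp: \<tau>_def)
      qed (use moment int\<tau>2 in auto)
      finally show ?thesis by (simp add: K_def)
    qed
    let ?A = "{\<omega> \<in> space M. \<epsilon> * real n \<le> \<bar>(\<Sum>i<n. X i \<omega>) - real n * m\<bar>}"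
    let ?B = "\<Union>i<n. {\<omega> \<in> space M. real n < \<bar>X i \<omega>\<bar>}"
    let ?D = "{\<omega> \<in> space M. (\<epsilon> / 2 * real n)\<^sup>2 \<le> (\<Sum>i<n. Z i \<omega>)\<^sup>2}"
    have "?A \<subseteq> ?B \<union> ?D"
    proof
      fix \<omega> assume \<omega>: "\<omega> \<in> ?A"
      show "\<omega> \<in> ?B \<union> ?D"
      proof (cases "\<exists>i<n. real n < \<bar>X i \<omega>\<bar>")
        case False
        have "\<tau> (X i \<omega>) = X i \<omega>" if "i < n" for i
        proof -
          have "\<not> real n < \<bar>X i \<omega>\<bar>" using False that by blast
          then show ?thesis by (simp add: \<tau>_def)
        qed
        then have "(\<Sum>i<n. \<tau> (X i \<omega>)) = (\<Sum>i<n. X i \<omega>)"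
          by (intro sum.cong) auto
        then have Z_eq: "(\<Sum>i<n. Z i \<omega>) = (\<Sum>i<n. X i \<omega>) - real n * m'"
          by (simp add: Z_def sum_subtractf)
        have aux: "e / 2 \<le> \<bar>s - u\<bar>" if "e \<le> \<bar>s - v\<bar>" "\<bar>u - v\<bar> \<le> e / 2" for e s u v :: real
          using that by arith
        have "\<bar>real n * m' - real n * m\<bar> = real n * \<bar>m' - m\<bar>"
          by (simp add: abs_mult flip: right_diff_distrib)
        also have "\<dots> \<le> real n * (\<epsilon> / 2)"
          using m' by (intro mult_left_mono) auto
        finally have "\<epsilon> / 2 * real n \<le> \<bar>\<Sum>i<n. Z i \<omega>\<bar>"
          using aux[of "\<epsilon> * real n" "\<Sum>i<n. X i \<omega>" "real n * m" "real n * m'"] \<omega>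
          by (simp add: Z_eq mult.commute)
        then have "(\<epsilon> / 2 * real n)\<^sup>2 \<le> (\<Sum>i<n. Z i \<omega>)\<^sup>2"
          using \<epsilon> by (subst abs_le_square_iff[symmetric]) (auto simp: abs_mult)
        then show ?thesis using \<omega> by auto
      qed (use \<omega> in auto)
    qed
    then have "prob ?A \<le> prob (?B \<union> ?D)"
      by (intro finite_measure_mono) measurable
    also have "\<dots> \<le> prob ?B + prob ?D"
      by (intro measure_Un_le) measurable
    also have "prob ?B \<le> (\<Sum>i<n. K * real n powr (-\<alpha>))"
      using n by (intro order_trans[OF measure_UNION_le] sum_mono tail) auto
    also have "\<dots> = K * real n powr (1 - \<alpha>)"
      using n by (simp add: powr_diff powr_minus divide_inverse)
    also have "prob ?D \<le> expectation (\<lambda>\<omega>. (\<Sum>i<n. Z i \<omega>)\<^sup>2) / (\<epsilon> / 2 * real n)\<^sup>2"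
    proof (rule integral_Markov_inequality_measure)
      have "\<bar>\<Sum>i<n. Z i \<omega>\<bar> \<le> real n * (real n + \<bar>m'\<bar>)" for \<omega>
        using order_trans[OF sum_abs sum_bounded_above[of "{..<n}" "\<lambda>i. \<bar>Z i \<omega>\<bar>"]] Zb by simp
      then show "integrable M (\<lambda>\<omega>. (\<Sum>i<n. Z i \<omega>)\<^sup>2)"
        by (intro integrable_const_bound[where B = "(real n * (real n + \<bar>m'\<bar>))\<^sup>2"])
          (auto simp: power2_le_iff_abs_le)
    qed (use \<epsilon> n in auto)
    also have "expectation (\<lambda>\<omega>. (\<Sum>i<n. Z i \<omega>)\<^sup>2) = (\<Sum>i<n. expectation (\<lambda>\<omega>. (Z i \<omega>)\<^sup>2))"
      by (rule expectation_square_sum_centered[OF indepZ Zb EZ])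
    also have "\<dots> \<le> (\<Sum>i<n. K * real n powr (2 - \<alpha>))"
      by (intro sum_mono EZ2)
    also have "(\<Sum>i<n. K * real n powr (2 - \<alpha>)) / (\<epsilon> / 2 * real n)\<^sup>2 = K * (4 / \<epsilon>\<^sup>2) * real n powr (1 - \<alpha>)"
    proof -
      have "real n powr (2 - \<alpha>) = real n * real n powr (1 - \<alpha>)"
        using n powr_add[of "real n" 1 "1 - \<alpha>"] by simp
      then show ?thesis using n \<epsilon> by (simp add: field_simps power2_eq_square)
    qed
    finally have "prob ?A \<le> K * real n powr (1 - \<alpha>) + K * (4 / \<epsilon>\<^sup>2) * real n powr (1 - \<alpha>)"
      by (simp add: divide_right_mono)
    also have "\<dots> = K * (1 + 4 / \<epsilon>\<^sup>2) * real n powr (1 - \<alpha>)"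
      by (simp add: algebra_simps)
    also have "\<dots> \<le> ?C * real n powr (1 - \<alpha>)"
      using K \<epsilon> by (intro mult_right_mono) auto
    finally show ?thesis .
  qed
  moreover have "?C > 0" using K \<epsilon> by (intro add_nonneg_pos add_nonneg_nonneg mult_nonneg_nonneg) auto
  ultimately show ?thesis unfolding m_def by blast
qed

text \<open>The weak law bounds the error at time \<open>n\<close> by a multiple of
  \<open>n powr (1 - \<alpha>)\<close>, which is not summable since \<open>\<alpha> \<le> 2\<close>.
  Along \<open>Suc j ^ p\<close> it is, by the choice of \<open>p\<close>, and the Borel-Cantelli
  lemma applies.\<close>

lemma (in prob_space) strong_law_subsequence:
  fixes X :: "nat \<Rightarrow> 'a \<Rightarrow> real"
  assumes indep: "indep_vars (\<lambda>_. borel) X UNIV"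
    and ident: "\<And>i. distr M borel (X i) = distr M borel (X 0)"
    and \<alpha>: "1 < \<alpha>" "\<alpha> \<le> 2"
    and moment: "integrable M (\<lambda>\<omega>. \<bar>X 0 \<omega>\<bar> powr \<alpha>)"
    and \<epsilon>: "\<epsilon> > 0" and p: "2 \<le> real p * (\<alpha> - 1)"
  shows "AE \<omega> in M. \<forall>\<^sub>F j in sequentially.
    \<bar>(\<Sum>i<Suc j ^ p. X i \<omega>) - real (Suc j ^ p) * expectation (X 0)\<bar> < \<epsilon> * real (Suc j ^ p)"
proof -
  have [measurable]: "X i \<in> borel_measurable M" for i
    using indep by (auto simp: indep_vars_def)
  define A where "A n = {\<omega> \<in> space M. \<epsilon> * real n \<le> \<bar>(\<Sum>i<n. X i \<omega>) - real n * expectation (X 0)\<bar>}" for n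
  have [measurable]: "A n \<in> sets M" for n
    unfolding A_def by measurable
  obtain C where C: "C > 0" "\<And>n. n \<ge> 1 \<Longrightarrow> prob (A n) \<le> C * real n powr (1 - \<alpha>)"
    using weak_law_rate[OF indep ident \<alpha> moment \<epsilon>] unfolding A_def by blast
  have "prob (A (Suc j ^ p)) \<le> C * inverse (real (Suc j) ^ 2)" for j
  proof -
    have "prob (A (Suc j ^ p)) \<le> C * real (Suc j ^ p) powr (1 - \<alpha>)"
      by (rule C) (simp add: Suc_le_eq)
    also have "real (Suc j ^ p) powr (1 - \<alpha>) = real (Suc j) powr (- (real p * (\<alpha> - 1)))"
      by (simp add: powr_powr algebra_simps flip: powr_realpow)
    also have "\<dots> \<le> real (Suc j) powr (- 2)"
      using p by (intro powr_mono) auto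
    also have "\<dots> = inverse (real (Suc j) ^ 2)"
      by (simp add: powr_minus)
    finally show ?thesis using C(1) by simp
  qed
  moreover have "summable (\<lambda>j. C * inverse (real (Suc j) ^ 2))"
    using inverse_power_summable[of 2, where ?'a = real]
      summable_Suc_iff[of "\<lambda>j. inverse (real j ^ 2)"]
    by (intro summable_mult) (simp only:)
  ultimately have "summable (\<lambda>j. prob (A (Suc j ^ p)))"
    by - (rule summable_comparison_test'[where N = 0], assumption, simp)
  then have "AE \<omega> in M. \<forall>\<^sub>F j in sequentially. \<omega> \<in> space M - A (Suc j ^ p)"
    by (intro borel_cantelli_AE1) (auto simp: less_top[symmetric])
  then show ?thesis
  proof eventually_elim
    case (elim \<omega>)
    then show ?case
      by (rule eventually_mono) (auto simp: A_def simp del: of_nat_power)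
  qed
qed

text \<open>Partial sums of nonnegative terms are monotone, so between consecutive times
  \<open>T j\<close> they are controlled by their values at the two ends, and these times differ by
  a factor tending to 1. The positive and negative parts of the steps will play \<open>f\<close> and
  \<open>g\<close>.\<close>

lemma sum_ge_of_subsequence:
  fixes f g :: "nat \<Rightarrow> real" and T :: "nat \<Rightarrow> nat"
  assumes nonneg: "\<And>i. 0 \<le> f i" "\<And>i. 0 \<le> g i"
    and T: "strict_mono T"
    and ratio: "(\<lambda>j. real (T j) / real (T (Suc j))) \<longlonglongrightarrow> 1"
    and f: "\<And>\<epsilon>. \<epsilon> > 0 \<Longrightarrow> \<forall>\<^sub>F j in sequentially. (a - \<epsilon>) * real (T j) \<le> (\<Sum>i<T j. f i)"
    and g: "\<And>\<epsilon>. \<epsilon> > 0 \<Longrightarrow> \<forall>\<^sub>F j in sequentially. (\<Sum>i<T j. g i) \<le> (b + \<epsilon>) * real (T j)"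
    and c: "0 < c" "c < a - b" and a: "0 \<le> a"
  shows "\<forall>\<^sub>F k in sequentially. c * real k \<le> (\<Sum>i<k. f i - g i)"
proof -
  \<comment> \<open>Three losses of size \<epsilon> occur: two in the rate of \<open>f\<close> (law
    of large numbers, ratio of consecutive times) and one in the rate of \<open>g\<close>; a quarter
    of the slack covers them. The \<open>+ 1\<close> in the definition of \<eta> admits
    \<open>a = 0\<close>.\<close>
  define \<epsilon> where "\<epsilon> = (a - b - c) / 4"
  define \<eta> where "\<eta> = \<epsilon> / (a + 1)"
  have \<epsilon>: "\<epsilon> > 0" and \<eta>: "\<eta> > 0"
    using c a by (auto simp: \<epsilon>_def \<eta>_def)
  have \<eta>a: "\<eta> * a \<le> \<epsilon>"
    using \<epsilon> a by (simp add: \<eta>_def field_simps)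
  have "\<forall>\<^sub>F j in sequentially. 1 - \<eta> < real (T j) / real (T (Suc j))"
    using ratio by (rule order_tendstoD) (use \<eta> in simp)
  then have ratio': "\<forall>\<^sub>F j in sequentially. (1 - \<eta>) * real (T (Suc j)) \<le> real (T j)"
  proof eventually_elim
    case (elim j)
    have "T (Suc j) > 0" using strict_monoD[OF T, of j "Suc j"] by simp
    then show ?case using elim by (simp add: field_simps)
  qed
  have "\<forall>\<^sub>F j in sequentially. (\<Sum>i<T (Suc j). g i) \<le> (b + \<epsilon>) * real (T (Suc j))"
    using g[OF \<epsilon>] by (rule eventually_compose_filterlim[OF _ filterlim_Suc])
  with ratio' f[OF \<epsilon>] have "\<forall>\<^sub>F j in sequentially. \<forall>k. T j \<le> k \<and> k \<le> T (Suc j) \<longrightarrow>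
      c * real k \<le> (\<Sum>i<k. f i - g i)"
  proof eventually_elim
    case (elim j)
    show ?case
    proof (intro allI impI)
      fix k assume k: "T j \<le> k \<and> k \<le> T (Suc j)"
      have "(a - 2 * \<epsilon>) * real (T (Suc j)) \<le> (a - \<epsilon>) * real (T j)"
      proof -
        have "real (T j) \<le> real (T (Suc j))" using k by simp
        then have "\<epsilon> * real (T j) \<le> \<epsilon> * real (T (Suc j))"
          using \<epsilon> by (intro mult_left_mono) auto
        moreover have "a * ((1 - \<eta>) * real (T (Suc j))) \<le> a * real (T j)"
          using elim(1) a by (rule mult_left_mono)
        moreover have "\<eta> * a * real (T (Suc j)) \<le> \<epsilon> * real (T (Suc j))"
          using \<eta>a by (intro mult_right_mono) auto
        ultimately show ?thesis by (simp add: algebra_simps)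
      qed
      moreover have "(\<Sum>i<T j. f i) \<le> (\<Sum>i<k. f i)"
        using k nonneg by (intro sum_mono2) auto
      moreover have "(\<Sum>i<k. g i) \<le> (\<Sum>i<T (Suc j). g i)"
        using k nonneg by (intro sum_mono2) auto
      ultimately have "(a - 2 * \<epsilon>) * real (T (Suc j)) - (b + \<epsilon>) * real (T (Suc j)) \<le> (\<Sum>i<k. f i - g i)"
        using elim by (simp add: sum_subtractf)
      moreover have "c * real k \<le> c * real (T (Suc j))"
        using k c by (intro mult_left_mono) auto
      moreover have "c * real (T (Suc j)) \<le> (a - 2 * \<epsilon> - (b + \<epsilon>)) * real (T (Suc j))"
        using c by (intro mult_right_mono) (auto simp: \<epsilon>_def field_simps)
      ultimately show "c * real k \<le> (\<Sum>i<k. f i - g i)" by (simp add: algebra_simps)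
    qed
  qed
  then obtain J where J: "\<And>j k. j \<ge> J \<Longrightarrow> T j \<le> k \<Longrightarrow> k \<le> T (Suc j) \<Longrightarrow>
      c * real k \<le> (\<Sum>i<k. f i - g i)"
    by (auto simp: eventually_sequentially)
  have "c * real k \<le> (\<Sum>i<k. f i - g i)" if k: "k \<ge> T J" for k
  proof -
    define j where "j = (LEAST j. k < T (Suc j))"
    have "k < T (Suc k)"
      using strict_mono_imp_increasing[OF T, of "Suc k"] by simp
    then have 1: "k < T (Suc j)"
      unfolding j_def by (rule LeastI[of "\<lambda>j. k < T (Suc j)"])
    have jJ: "J \<le> j"
    proof (rule ccontr)
      assume "\<not> J \<le> j"
      then have "T (Suc j) \<le> T J" using T by (simp add: strict_mono_less_eq)
      with 1 k show False by linarith
    qed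
    have 2: "T j \<le> k"
    proof (cases j)
      case (Suc i)
      then have "\<not> k < T (Suc i)"
        using not_less_Least[of i "\<lambda>j. k < T (Suc j)"] by (simp add: j_def)
      then show ?thesis using Suc by simp
    qed (use k jJ in simp)
    show ?thesis using J[OF jJ 2] 1 by simp
  qed
  then show ?thesis unfolding eventually_sequentially by blast
qed

lemma (in prob_space) sums_eventually_linear:
  fixes X :: "nat \<Rightarrow> 'a \<Rightarrow> real"
  assumes indep: "indep_vars (\<lambda>_. borel) X UNIV"
    and ident: "\<And>i. distr M borel (X i) = distr M borel (X 0)"
    and \<alpha>: "1 < \<alpha>" "\<alpha> \<le> 2"
    and moment: "integrable M (\<lambda>\<omega>. \<bar>X 0 \<omega>\<bar> powr \<alpha>)"
    and int: "integrable M (X 0)"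
    and c: "0 < c" "c < expectation (X 0)"
  shows "AE \<omega> in M. \<forall>\<^sub>F k in sequentially. c * real k \<le> (\<Sum>i<k. X i \<omega>)"
proof -
  have [measurable]: "X i \<in> borel_measurable M" for i
    using indep by (auto simp: indep_vars_def)
  define p where "p = nat \<lceil>2 / (\<alpha> - 1)\<rceil>"
  have "2 / (\<alpha> - 1) \<le> real p" unfolding p_def by linarith
  then have p: "2 \<le> real p * (\<alpha> - 1)" using \<alpha> by (simp add: field_simps)
  then have p0: "p > 0" by (cases p) auto
  define T where "T j = Suc j ^ p" for j
  have T: "strict_mono T"
    unfolding T_def strict_mono_def using p0 by (auto intro: power_strict_mono)
  have ratio: "(\<lambda>j. real (T j) / real (T (Suc j))) \<longlonglongrightarrow> 1"
  proof -
    have "(\<lambda>j. (real (Suc j) / real (Suc (Suc j))) ^ p) \<longlonglongrightarrow> 1 ^ p"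
      by (intro tendsto_power) real_asymp
    then show ?thesis by (simp add: T_def power_divide)
  qed
  define F where "F s x = max (s * x) 0" for s x :: real
  have [measurable]: "F s \<in> borel_measurable borel" for s unfolding F_def by measurable
  \<comment> \<open>Positive and negative parts, \<open>s = 1\<close> and \<open>s = - 1\<close>,
    are treated separately because monotone sums are required between the times \<open>T j\<close>.
    Countably many tolerances keep the exceptional set null.\<close>
  have AE: "AE \<omega> in M. \<forall>n. \<forall>\<^sub>F j in sequentially.
      \<bar>(\<Sum>i<T j. F s (X i \<omega>)) - real (T j) * expectation (\<lambda>\<omega>. F s (X 0 \<omega>))\<bar>
        < inverse (real (Suc n)) * real (T j)" if s: "\<bar>s\<bar> = 1" for s
    unfolding AE_all_countable T_def
  proof (intro allI strong_law_subsequence[OF _ _ \<alpha>])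
    show "indep_vars (\<lambda>_. borel) (\<lambda>i \<omega>. F s (X i \<omega>)) UNIV"
      by (rule indep_vars_compose2[OF indep]) measurable
    show "distr M borel (\<lambda>\<omega>. F s (X i \<omega>)) = distr M borel (\<lambda>\<omega>. F s (X 0 \<omega>))" for i
    proof -
      have "distr M borel (\<lambda>\<omega>. F s (X i \<omega>)) = distr (distr M borel (X i)) borel (F s)" for i
        by (simp add: distr_distr comp_def)
      then show ?thesis using ident[of i] by simp
    qed
    show "integrable M (\<lambda>\<omega>. \<bar>F s (X 0 \<omega>)\<bar> powr \<alpha>)"
    proof (rule Bochner_Integration.integrable_bound[OF moment])
      show "AE \<omega> in M. norm (\<bar>F s (X 0 \<omega>)\<bar> powr \<alpha>) \<le> norm (\<bar>X 0 \<omega>\<bar> powr \<alpha>)"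
      proof (rule AE_I2)
        fix \<omega>
        have "\<bar>F s (X 0 \<omega>)\<bar> \<le> \<bar>X 0 \<omega>\<bar>" using s by (auto simp: F_def abs_if split: if_splits)
        then show "norm (\<bar>F s (X 0 \<omega>)\<bar> powr \<alpha>) \<le> norm (\<bar>X 0 \<omega>\<bar> powr \<alpha>)"
          using \<alpha> by (auto intro: powr_mono2)
      qed
    qed measurable
  qed (use p in auto)
  have intF: "integrable M (\<lambda>\<omega>. F s (X 0 \<omega>))" for s
    unfolding F_def using int by (intro integrable_max) auto
  define a where "a = expectation (\<lambda>\<omega>. F 1 (X 0 \<omega>))"
  define b where "b = expectation (\<lambda>\<omega>. F (-1) (X 0 \<omega>))"
  have X_eq: "X i \<omega> = F 1 (X i \<omega>) - F (-1) (X i \<omega>)" for i \<omega>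
    by (auto simp: F_def)
  have "expectation (X 0) = expectation (\<lambda>\<omega>. F 1 (X 0 \<omega>) - F (-1) (X 0 \<omega>))"
    by (rule arg_cong[of _ _ expectation], rule ext, rule X_eq)
  also have "\<dots> = a - b"
    unfolding a_def b_def using intF by (intro Bochner_Integration.integral_diff)
  finally have "expectation (X 0) = a - b" .
  moreover have "0 \<le> a" unfolding a_def by (intro integral_nonneg_AE) (auto simp: F_def)
  ultimately have ab: "c < a - b" "0 \<le> a" using c by auto
  have abs_m1: "\<bar>- 1 :: real\<bar> = 1" by simp
  have "AE \<omega> in M. \<forall>\<^sub>F k in sequentially. c * real k \<le> (\<Sum>i<k. F 1 (X i \<omega>) - F (-1) (X i \<omega>))"
    using AE[OF abs_one] AE[OF abs_m1]
  proof eventually_elim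
    case (elim \<omega>)
    show ?case
    proof (rule sum_ge_of_subsequence[OF _ _ T ratio _ _ c(1) ab(1,2)])
      fix \<epsilon> :: real assume "\<epsilon> > 0"
      then obtain n where n: "inverse (real (Suc n)) < \<epsilon>" using reals_Archimedean by blast
      have *: "inverse (real (Suc n)) * real (T j) \<le> \<epsilon> * real (T j)" for j
        using n by (intro mult_right_mono) auto
      show "\<forall>\<^sub>F j in sequentially. (a - \<epsilon>) * real (T j) \<le> (\<Sum>i<T j. F 1 (X i \<omega>))"
        using elim(1)[rule_format, of n]
      proof eventually_elim
        case (elim j)
        from elim *[of j] show ?case
          unfolding a_def[symmetric] left_diff_distrib abs_less_iff mult.commute[of a]
          by linarith
      qed
      show "\<forall>\<^sub>F j in sequentially. (\<Sum>i<T j. F (-1) (X i \<omega>)) \<le> (b + \<epsilon>) * real (T j)"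
        using elim(2)[rule_format, of n]
      proof eventually_elim
        case (elim j)
        from elim *[of j] show ?case
          unfolding b_def[symmetric] distrib_right abs_less_iff mult.commute[of b]
          by linarith
      qed
    qed (auto simp: F_def)
  qed
  then show ?thesis by (simp flip: X_eq)
qed

lemma (in prob_space) indep_vars_coordinates:
  "prob_space.indep_vars (\<Pi>\<^sub>M i\<in>(UNIV :: nat set). M) (\<lambda>_. M) (\<lambda>i \<omega>. \<omega> i) UNIV"
proof -
  interpret S: product_prob_space "\<lambda>_. M" "UNIV :: nat set" ..
  have "distr (\<Pi>\<^sub>M i\<in>UNIV. M) (\<Pi>\<^sub>M i\<in>UNIV. M) (\<lambda>\<omega>. \<lambda>i\<in>UNIV. \<omega> i)
      = (\<Pi>\<^sub>M i\<in>UNIV. distr (\<Pi>\<^sub>M i\<in>(UNIV :: nat set). M) M (\<lambda>\<omega>. \<omega> i))"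
    unfolding S.PiM_component[OF UNIV_I] restrict_UNIV by (rule distr_id2) simp
  then show ?thesis
    by (subst S.P.indep_vars_iff_distr_eq_PiM) (auto simp: measurable_component_singleton)
qed

lemma (in prob_space)
  assumes f: "f \<in> M \<rightarrow>\<^sub>M N"
  shows indep_vars_coordinates_compose:
      "prob_space.indep_vars (\<Pi>\<^sub>M i\<in>(UNIV :: nat set). M) (\<lambda>_. N) (\<lambda>i \<omega>. f (\<omega> i)) UNIV"
    and distr_coordinate_compose:
      "distr (\<Pi>\<^sub>M i\<in>(UNIV :: nat set). M) N (\<lambda>\<omega>. f (\<omega> i)) = distr M N f"
proof -
  interpret S: product_prob_space "\<lambda>_. M" "UNIV :: nat set" ..
  show "S.P.indep_vars (\<lambda>_. N) (\<lambda>i \<omega>. f (\<omega> i)) UNIV"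
    using S.P.indep_vars_compose2[OF indep_vars_coordinates, of "\<lambda>_. f" "\<lambda>_. N"] f by blast
  have "distr (distr (\<Pi>\<^sub>M i\<in>(UNIV :: nat set). M) M (\<lambda>\<omega>. \<omega> i)) N f
      = distr (\<Pi>\<^sub>M i\<in>(UNIV :: nat set). M) N (f \<circ> (\<lambda>\<omega>. \<omega> i))"
    by (rule distr_distr[OF f]) (rule measurable_component_singleton[OF UNIV_I])
  then show "distr (\<Pi>\<^sub>M i\<in>(UNIV :: nat set). M) N (\<lambda>\<omega>. f (\<omega> i)) = distr M N f"
    unfolding S.PiM_component[OF UNIV_I] comp_def by (rule sym)
qed

section \<open>Size biasing\<close>

definition weight :: "real \<Rightarrow> offspring \<Rightarrow> nat \<Rightarrow> real" where
  "weight t p i = (if enat i < fst p then exp (- t * snd p i) else 0)"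

text \<open>This is the variable \<Sigma>_V of the theorem, read off the reproduction of a single
  particle; \<open>family_sum_eq_sum_gen1\<close> makes the identification.\<close>

definition family_sum :: "real \<Rightarrow> offspring \<Rightarrow> ennreal" where
  "family_sum t p = (\<Sum>i. ennreal (weight t p i))"

lemma weight_nonneg [simp]: "0 \<le> weight t p i"
  by (simp add: weight_def)

lemma borel_measurable_weight [measurable]:
  "(\<lambda>p. weight t p i) \<in> borel_measurable offspring_space"
  unfolding weight_def by measurable

lemma borel_measurable_family_sum [measurable]:
  "family_sum t \<in> borel_measurable offspring_space"
  unfolding family_sum_def[abs_def] by measurable

text \<open>
  Size biasing (the measure \<open>spine\<close> below): sums over the particles of a generation become
  expectations along the random walk with the displacements of the marked children as steps.
\<close>

definition step :: "offspring \<times> nat \<Rightarrow> real" where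
  "step z = snd (fst z) (snd z)"

definition walk :: "(nat \<Rightarrow> offspring \<times> nat) \<Rightarrow> nat \<Rightarrow> real" where
  "walk \<omega> k = (\<Sum>j<k. step (\<omega> j))"

lemma walk_0 [simp]: "walk \<omega> 0 = 0"
  by (simp add: walk_def)

lemma walk_case_nat_Suc [simp]: "walk (case_nat z \<omega>) (Suc k) = step z + walk \<omega> k"
  unfolding walk_def by (subst sum.lessThan_Suc_shift) simp

locale critical_law = offspring_law +
  fixes t :: real
  assumes t_pos: "t > 0"
    and critical: "(\<integral>\<^sup>+p. family_sum t p \<partial>P) = 1"
begin

definition spine :: "(offspring \<times> nat) measure" where
  "spine = density (P \<Otimes>\<^sub>M count_space UNIV) (\<lambda>z. ennreal (weight t (fst z) (snd z)))"

lemma sets_spine [measurable_cong, simp]: "sets spine = sets (P \<Otimes>\<^sub>M count_space UNIV)"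
  by (simp add: spine_def)

lemma space_spine [simp]: "space spine = UNIV"
  by (simp add: spine_def space_pair_measure)

lemma measurable_step [measurable]: "step \<in> borel_measurable spine"
proof -
  have "step \<in> borel_measurable (P \<Otimes>\<^sub>M count_space UNIV)"
    unfolding step_def[abs_def] by (rule borel_measurable_pair_nat) measurable
  then show ?thesis by simp
qed

lemma measurable_fst_spine [measurable]: "fst \<in> spine \<rightarrow>\<^sub>M P"
  by (simp add: spine_def)

lemma nn_integral_spine:
  assumes [measurable]: "f \<in> borel_measurable spine"
  shows "(\<integral>\<^sup>+z. f z \<partial>spine) = (\<integral>\<^sup>+p. (\<Sum>i. ennreal (weight t p i) * f (p, i)) \<partial>P)"
proof -
  interpret C: sigma_finite_measure "count_space (UNIV :: nat set)"
    by (rule sigma_finite_measure_count_space)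
  have [measurable]: "f \<in> borel_measurable (P \<Otimes>\<^sub>M count_space UNIV)"
    using assms by simp
  have [measurable]: "(\<lambda>z. weight t (fst z) (snd z)) \<in> borel_measurable (P \<Otimes>\<^sub>M count_space UNIV)"
    by (rule borel_measurable_pair_nat) measurable
  have m: "(\<lambda>z. ennreal (weight t (fst z) (snd z)) * f z) \<in> borel_measurable (P \<Otimes>\<^sub>M count_space UNIV)"
    by (intro borel_measurable_times_ennreal measurable_compose[OF _ measurable_ennreal]) measurable
  have "(\<integral>\<^sup>+z. f z \<partial>spine) = (\<integral>\<^sup>+z. ennreal (weight t (fst z) (snd z)) * f z \<partial>(P \<Otimes>\<^sub>M count_space UNIV))"
    unfolding spine_def by (rule nn_integral_density) measurable
  also have "\<dots> = (\<integral>\<^sup>+p. \<integral>\<^sup>+i. ennreal (weight t p i) * f (p, i) \<partial>count_space UNIV \<partial>P)"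
    using C.nn_integral_fst[OF m] by simp
  finally show ?thesis
    by (simp add: nn_integral_count_space_nat)
qed

sublocale spine: prob_space spine
proof
  have "emeasure spine (space spine) = (\<integral>\<^sup>+z. 1 \<partial>spine)"
    by simp
  also have "\<dots> = 1"
    using critical by (subst nn_integral_spine) (simp_all add: family_sum_def)
  finally show "emeasure spine (space spine) = 1" .
qed

definition S :: "(nat \<Rightarrow> offspring \<times> nat) measure" where
  "S = (\<Pi>\<^sub>M i\<in>UNIV. spine)"

lemma space_S [simp]: "space S = UNIV"
  by (auto simp: S_def space_PiM)

sublocale S: prob_space S
  unfolding S_def by (rule prob_space_PiM) unfold_locales

lemma measurable_S_component [measurable]: "(\<lambda>\<omega>. \<omega> k) \<in> S \<rightarrow>\<^sub>M spine"
  by (simp add: S_def measurable_component_singleton)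

lemma measurable_walk [measurable]: "(\<lambda>\<omega>. walk \<omega> k) \<in> borel_measurable S"
  unfolding walk_def by measurable

lemma measurable_family_component [measurable]:
  "(\<lambda>\<omega>. family_sum t (fst (\<omega> k))) \<in> borel_measurable S"
  by (rule measurable_compose[OF measurable_compose[OF measurable_S_component measurable_fst_spine]])
    measurable

lemma nn_integral_S_Suc:
  assumes [measurable]: "f \<in> borel_measurable S"
  shows "(\<integral>\<^sup>+\<omega>. f \<omega> \<partial>S) = (\<integral>\<^sup>+z. \<integral>\<^sup>+\<omega>. f (case_nat z \<omega>) \<partial>S \<partial>spine)"
proof -
  interpret seq: sequence_space spine ..
  have eq: "S = seq.S" by (simp add: S_def)
  have [measurable]: "(\<lambda>(z, \<omega>). case_nat z \<omega>) \<in> spine \<Otimes>\<^sub>M S \<rightarrow>\<^sub>M S"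
    unfolding S_def split_beta' by measurable
  have m: "(\<lambda>x. f (case x of (z, \<omega>) \<Rightarrow> case_nat z \<omega>)) \<in> borel_measurable (spine \<Otimes>\<^sub>M S)"
    by (rule measurable_compose[OF _ assms]) measurable
  have "(\<integral>\<^sup>+\<omega>. f \<omega> \<partial>S) = (\<integral>\<^sup>+\<omega>. f \<omega> \<partial>distr (spine \<Otimes>\<^sub>M S) S (\<lambda>(z, \<omega>). case_nat z \<omega>))"
    unfolding eq seq.PiM_iter ..
  also have "\<dots> = (\<integral>\<^sup>+x. f (case x of (z, \<omega>) \<Rightarrow> case_nat z \<omega>) \<partial>(spine \<Otimes>\<^sub>M S))"
    by (rule nn_integral_distr) measurable
  also have "\<dots> = (\<integral>\<^sup>+z. \<integral>\<^sup>+\<omega>. f (case_nat z \<omega>) \<partial>S \<partial>spine)"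
    using S.nn_integral_fst[OF m] by simp
  finally show ?thesis .
qed

lemma W_Suc_le:
  "ennreal (W (Suc n) b x) \<le> (\<integral>\<^sup>+p. (\<Sum>i. if enat i < fst p then ennreal (W n (\<lambda>k. b (Suc k)) (x + snd p i)) else 0) \<partial>P)"
proof -
  let ?b = "\<lambda>k. b (Suc k)"
  let ?A = "\<lambda>i. {e. enat i < fst (e []) \<and> below n ?b (x + snd (e []) i) (subenv i e)}"
  have Q: "Measurable.pred (P \<Otimes>\<^sub>M E) (\<lambda>z. below n ?b (x + snd (fst z) i) (snd z))" for i
    by measurable
  have meas: "?A i \<in> sets E" for i
  proof -
    have "Measurable.pred E (\<lambda>e. below n ?b (x + snd (e []) i) (subenv i e))"
      using measurable_compose[OF _ Q[of i], of "\<lambda>e. (e [], subenv i e)" E] by simp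
    moreover have "Measurable.pred E (\<lambda>e. enat i < fst (e []))"
      by (rule measurable_compose[OF measurable_E_component, where g = "\<lambda>p. enat i < fst p"]) measurable
    ultimately have "{e. enat i < fst (e [])} \<inter> {e. below n ?b (x + snd (e []) i) (subenv i e)} \<in> sets E"
      by (intro sets.Int) (simp_all add: pred_def)
    then show ?thesis by (simp add: Collect_conj_eq)
  qed
  have em: "emeasure E (?A i) = (\<integral>\<^sup>+p. (if enat i < fst p then ennreal (W n ?b (x + snd p i)) else 0) \<partial>P)" for i
  proof -
    let ?Q = "\<lambda>j p e. j = i \<longrightarrow> below n ?b (x + snd p i) e"
    have "?A i = {e. enat i < fst (e []) \<and> (\<forall>j<Suc i. ?Q j (e []) (subenv j e))}"
      by auto
    also have "emeasure E \<dots> = (\<integral>\<^sup>+p. indicator {p. enat i < fst p} p * (\<Prod>j<Suc i. emeasure E {e. ?Q j p e}) \<partial>P)"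
      using Q[of i] by (intro emeasure_E_branching) auto
    also have "\<dots> = (\<integral>\<^sup>+p. (if enat i < fst p then ennreal (W n ?b (x + snd p i)) else 0) \<partial>P)"
    proof (rule nn_integral_cong)
      fix p :: offspring
      have "(\<Prod>j<Suc i. emeasure E {e. ?Q j p e}) = emeasure E {e. below n ?b (x + snd p i) e}"
        using E.emeasure_space_1 by (subst prod.lessThan_Suc) simp
      then show "indicator {p. enat i < fst p} p * (\<Prod>j<Suc i. emeasure E {e. ?Q j p e})
          = (if enat i < fst p then ennreal (W n ?b (x + snd p i)) else 0)"
        by (simp add: W_def E.emeasure_eq_measure)
    qed
    finally show ?thesis .
  qed
  have "ennreal (W (Suc n) b x) = emeasure E {e. below (Suc n) b x e}"
    by (simp only: W_def E.emeasure_eq_measure)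
  also have "\<dots> \<le> emeasure E (\<Union>i. ?A i)"
    using meas by (intro emeasure_mono sets.countable_UN) auto
  also have "\<dots> \<le> (\<Sum>i. emeasure E (?A i))"
    using meas by (intro emeasure_subadditive_countably) auto
  also have "\<dots> = (\<integral>\<^sup>+p. (\<Sum>i. if enat i < fst p then ennreal (W n ?b (x + snd p i)) else 0) \<partial>P)"
    unfolding em by (rule nn_integral_suminf[symmetric]) measurable
  finally show ?thesis .
qed

text \<open>Multiplied by \<open>exp (t * x)\<close>, the union bound over the children absorbs the
  weights of the size-biased measure and becomes a one-step inequality along the walk.\<close>

lemma W_Suc_le_spine:
  "ennreal (exp (t * x) * W (Suc n) b x)
    \<le> (\<integral>\<^sup>+z. ennreal (exp (t * (x + step z)) * W n (\<lambda>k. b (Suc k)) (x + step z)) \<partial>spine)"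
proof -
  let ?b = "\<lambda>k. b (Suc k)"
  have "ennreal (exp (t * x) * W (Suc n) b x)
      \<le> ennreal (exp (t * x)) * (\<integral>\<^sup>+p. (\<Sum>i. if enat i < fst p then ennreal (W n ?b (x + snd p i)) else 0) \<partial>P)"
    unfolding ennreal_mult''[OF W_nonneg] by (rule mult_left_mono[OF W_Suc_le]) simp
  also have "\<dots> = (\<integral>\<^sup>+p. (\<Sum>i. ennreal (exp (t * x)) * (if enat i < fst p then ennreal (W n ?b (x + snd p i)) else 0)) \<partial>P)"
    by (subst nn_integral_cmult[symmetric]) auto
  also have "\<dots> = (\<integral>\<^sup>+p. (\<Sum>i. ennreal (weight t p i) *
      ennreal (exp (t * (x + step (p, i))) * W n ?b (x + step (p, i)))) \<partial>P)"
  proof (intro nn_integral_cong suminf_cong)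
    fix p :: offspring and i :: nat
    have "exp (t * x) = exp (- t * snd p i) * exp (t * (x + snd p i))"
      by (simp flip: exp_add add: algebra_simps)
    then show "ennreal (exp (t * x)) * (if enat i < fst p then ennreal (W n ?b (x + snd p i)) else 0)
        = ennreal (weight t p i) * ennreal (exp (t * (x + step (p, i))) * W n ?b (x + step (p, i)))"
      by (simp add: weight_def step_def mult.assoc flip: ennreal_mult)
  qed
  also have "\<dots> = (\<integral>\<^sup>+z. ennreal (exp (t * (x + step z)) * W n ?b (x + step z)) \<partial>spine)"
    by (rule nn_integral_spine[symmetric]) measurable
  finally show ?thesis .
qed

section \<open>Upper bounds for path probabilities: confinement of the walk to an interval\<close>

primrec stay :: "real \<Rightarrow> real \<Rightarrow> nat \<Rightarrow> real \<Rightarrow> ennreal" where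
  "stay c L 0 x = indicator {-c..L} x"
| "stay c L (Suc n) x = indicator {-c..L} x * (\<integral>\<^sup>+z. stay c L n (x + step z) \<partial>spine)"

lemma borel_measurable_stay [measurable]: "stay c L n \<in> borel_measurable borel"
  by (induction n) simp_all

text \<open>\<open>stay c L n x\<close> is the probability that the walk from \<open>x\<close>
  remains in \<open>[-c, L]\<close> up to time \<open>n\<close>. A particle below \<open>- c\<close>
  contributes at most \<open>exp (- t * c)\<close>, a probability of success being at most 1; a path
  that never gets there pays at most \<open>exp (t * L)\<close> for the change of measure.\<close>

lemma W_le_stay:
  assumes "\<And>k. k \<le> n \<Longrightarrow> b k \<le> L"
  shows "ennreal (exp (t * x) * W n b x) \<le> ennreal (exp (- t * c)) + ennreal (exp (t * L)) * stay c L n x"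
  using assms
proof (induction n arbitrary: b x)
  case 0
  show ?case
  proof (cases "x < - c")
    case True
    then have "exp (t * x) * W 0 b x \<le> exp (- t * c) * 1"
      using t_pos mult_left_mono[of x "- c" t] by (intro mult_mono) auto
    then show ?thesis by (intro add_increasing2) (auto intro: ennreal_leI)
  next
    case False
    then show ?thesis
      using 0[of 0] t_pos by (auto simp: W_0 indicator_def intro!: add_increasing ennreal_leI)
  qed
next
  case (Suc n)
  show ?case
  proof (cases "x < - c")
    case True
    then have "exp (t * x) * W (Suc n) b x \<le> exp (- t * c) * 1"
      using t_pos mult_left_mono[of x "- c" t] by (intro mult_mono) auto
    then show ?thesis by (intro add_increasing2) (auto intro: ennreal_leI)
  next
    case c: False
    show ?thesis
    proof (cases "L < x")
      case True
      then show ?thesis using Suc.prems[of 0] by (simp add: W_eq_0)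
    next
      case False
      have "ennreal (exp (t * x) * W (Suc n) b x)
          \<le> (\<integral>\<^sup>+z. ennreal (exp (t * (x + step z)) * W n (\<lambda>k. b (Suc k)) (x + step z)) \<partial>spine)"
        by (rule W_Suc_le_spine)
      also have "\<dots> \<le> (\<integral>\<^sup>+z. ennreal (exp (- t * c)) + ennreal (exp (t * L)) * stay c L n (x + step z) \<partial>spine)"
        using Suc.prems by (intro nn_integral_mono Suc.IH) auto
      also have "\<dots> = ennreal (exp (- t * c)) + ennreal (exp (t * L)) * (\<integral>\<^sup>+z. stay c L n (x + step z) \<partial>spine)"
        by (subst nn_integral_add) (auto simp: nn_integral_cmult spine.emeasure_space_1[simplified])
      finally show ?thesis using c False by simp
    qed
  qed
qed

lemma stay_add_le: "stay c L (n + j) x \<le> (\<integral>\<^sup>+\<omega>. stay c L n (x + walk \<omega> j) \<partial>S)"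
proof (induction j arbitrary: x)
  case 0
  show ?case by (simp add: S.emeasure_space_1[simplified])
next
  case (Suc j)
  have "stay c L (n + Suc j) x \<le> (\<integral>\<^sup>+z. stay c L (n + j) (x + step z) \<partial>spine)"
    by (auto simp: indicator_def)
  also have "\<dots> \<le> (\<integral>\<^sup>+z. \<integral>\<^sup>+\<omega>. stay c L n (x + step z + walk \<omega> j) \<partial>S \<partial>spine)"
    by (intro nn_integral_mono Suc.IH)
  also have "\<dots> = (\<integral>\<^sup>+\<omega>. stay c L n (x + walk \<omega> (Suc j)) \<partial>S)"
    by (subst nn_integral_S_Suc) (auto simp: add.assoc)
  finally show ?case .
qed

lemma stay_eq_0: "x \<notin> {-c..L} \<Longrightarrow> stay c L n x = 0"
  by (cases n) auto

text \<open>Both ends of a block of \<open>T\<close> steps lie in an interval of length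
  \<open>L + c\<close>, so its increment is at most \<open>L + c\<close>. Forgetting the constraint
  inside the block makes the bound independent of the starting point.\<close>

lemma stay_add_le_mult:
  assumes "\<And>y. stay c L n y \<le> r"
  shows "stay c L (n + T) x \<le> r * ennreal (S.prob {\<omega>. walk \<omega> T \<le> L + c})"
proof (cases "x \<in> {-c..L}")
  case True
  have [measurable]: "{\<omega>. walk \<omega> T \<le> L + c} \<in> sets S"
    using measurable_walk[of T] by (intro borel_measurable_le[of _ S, simplified]) auto
  have "stay c L (n + T) x \<le> (\<integral>\<^sup>+\<omega>. stay c L n (x + walk \<omega> T) \<partial>S)"
    by (rule stay_add_le)
  also have "\<dots> \<le> (\<integral>\<^sup>+\<omega>. r * indicator {\<omega>. walk \<omega> T \<le> L + c} \<omega> \<partial>S)"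
  proof (rule nn_integral_mono)
    fix \<omega>
    show "stay c L n (x + walk \<omega> T) \<le> r * indicator {\<omega>. walk \<omega> T \<le> L + c} \<omega>"
      using True assms by (cases "x + walk \<omega> T \<in> {-c..L}") (auto simp: stay_eq_0)
  qed
  also have "\<dots> = r * ennreal (S.prob {\<omega>. walk \<omega> T \<le> L + c})"
    by (simp add: nn_integral_cmult S.emeasure_eq_measure)
  finally show ?thesis .
qed (simp add: stay_eq_0)

lemma stay_mult_le_power: "stay c L (m * T) x \<le> ennreal (S.prob {\<omega>. walk \<omega> T \<le> L + c} ^ m)"
proof (induction m arbitrary: x)
  case (Suc m)
  have "stay c L (m * T + T) x \<le> ennreal (S.prob {\<omega>. walk \<omega> T \<le> L + c} ^ m) * ennreal (S.prob {\<omega>. walk \<omega> T \<le> L + c})"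
    by (rule stay_add_le_mult) (rule Suc.IH)
  then show ?case by (simp add: add.commute mult.commute flip: ennreal_mult)
qed (simp add: indicator_def)

lemma W_le_power:
  assumes "\<And>k. k \<le> n \<Longrightarrow> b k \<le> L"
  shows "W n b 0 \<le> exp (- t * c) + exp (t * L) * S.prob {\<omega>. walk \<omega> T \<le> L + c} ^ (n div T)"
proof -
  let ?m = "n div T"
  have le: "?m * T \<le> n" by simp
  have "ennreal (W n b 0) \<le> ennreal (exp (t * 0) * W (?m * T) b 0)"
    using W_le[OF le] by (simp add: ennreal_leI)
  also have "\<dots> \<le> ennreal (exp (- t * c)) + ennreal (exp (t * L)) * stay c L (?m * T) 0"
    by (intro W_le_stay assms) (rule order_trans[OF _ le])
  also have "\<dots> \<le> ennreal (exp (- t * c)) + ennreal (exp (t * L)) * ennreal (S.prob {\<omega>. walk \<omega> T \<le> L + c} ^ ?m)"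
    by (intro add_left_mono mult_left_mono stay_mult_le_power) auto
  also have "\<dots> = ennreal (exp (- t * c) + exp (t * L) * S.prob {\<omega>. walk \<omega> T \<le> L + c} ^ ?m)"
    by (simp flip: ennreal_mult ennreal_plus)
  finally show ?thesis
    by (subst (asm) ennreal_le_iff) (auto intro!: add_nonneg_nonneg)
qed

end

section \<open>Lower bounds by size biasing\<close>

lemma ennreal_inverse_antimono: "a \<le> b \<Longrightarrow> inverse b \<le> inverse (a :: ennreal)"
  by (simp add: less_eq_ennreal.rep_eq inverse_ennreal.rep_eq ereal_inverse_antimono)

text \<open>Through \<open>1 - v \<le> exp (- v)\<close> and
  \<open>exp (- s) \<le> 1 / (1 + s)\<close>. The quotient keeps the union bound \<open>s\<close> as
  its numerator, which is linear in the success probabilities and thus compatible with size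
  biasing.\<close>

lemma one_minus_prod_ge:
  fixes v :: "'i \<Rightarrow> real"
  assumes "finite A" and v: "\<And>i. i \<in> A \<Longrightarrow> 0 \<le> v i \<and> v i \<le> 1"
  shows "(\<Sum>i\<in>A. v i) / (1 + (\<Sum>i\<in>A. v i)) \<le> 1 - (\<Prod>i\<in>A. 1 - v i)"
proof -
  define s where "s = (\<Sum>i\<in>A. v i)"
  have s: "0 \<le> s" unfolding s_def using v by (intro sum_nonneg) auto
  have "(\<Prod>i\<in>A. 1 - v i) \<le> (\<Prod>i\<in>A. exp (- v i))"
  proof (rule prod_mono)
    fix i assume "i \<in> A"
    then show "0 \<le> 1 - v i \<and> 1 - v i \<le> exp (- v i)"
      using v[of i] exp_ge_add_one_self[of "- v i"] by auto
  qed
  also have "\<dots> = exp (- s)"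
    using \<open>finite A\<close> by (simp add: s_def exp_sum flip: sum_negf)
  also have "\<dots> \<le> 1 / (1 + s)"
    using s exp_ge_add_one_self[of s] by (simp add: exp_minus divide_inverse le_imp_inverse_le)
  finally have "1 - 1 / (1 + s) \<le> 1 - (\<Prod>i\<in>A. 1 - v i)" by simp
  moreover have "1 - 1 / (1 + s) = s / (1 + s)" using s by (simp add: field_simps)
  ultimately show ?thesis by (simp add: s_def)
qed

context offspring_law
begin

text \<open>The sum in the denominator of \<open>one_minus_prod_ge\<close> depends on the
  continuation. Replacing it by a bound \<open>G\<close> that depends on the family alone leaves an
  expression linear in \<open>V\<close>, to which the change of measure applies.\<close>

lemma W_Suc_ge:
  assumes x: "x \<le> b 0"
    and V [measurable]: "V \<in> borel_measurable borel"
    and V_le: "\<And>y. 0 \<le> V y \<and> V y \<le> W n (\<lambda>k. b (Suc k)) y"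
    and G [measurable]: "G \<in> borel_measurable P"
    and G_ge: "\<And>p. (\<Sum>i. ennreal (if enat i < fst p then V (x + snd p i) else 0)) \<le> G p"
  shows "(\<integral>\<^sup>+p. (\<Sum>i. ennreal (if enat i < fst p then V (x + snd p i) else 0)) * inverse (1 + G p) \<partial>P)
    \<le> ennreal (W (Suc n) b x)"
proof -
  let ?b = "\<lambda>k. b (Suc k)"
  define v where "v p i = (if enat i < fst p then V (x + snd p i) else 0)" for p :: offspring and i
  have v [measurable]: "(\<lambda>p. v p i) \<in> borel_measurable P" for i
    unfolding v_def by measurable
  have v01: "0 \<le> v p i" "v p i \<le> 1" for p i
    using V_le order_trans[OF V_le[THEN conjunct2] W_le_1] by (auto simp: v_def)
  have part: "(\<Sum>i<m. \<integral>\<^sup>+p. ennreal (v p i) * inverse (1 + G p) \<partial>P) \<le> ennreal (W (Suc n) b x)" for m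
  proof -
    have "(\<Sum>i<m. \<integral>\<^sup>+p. ennreal (v p i) * inverse (1 + G p) \<partial>P)
        = (\<integral>\<^sup>+p. (\<Sum>i<m. ennreal (v p i) * inverse (1 + G p)) \<partial>P)"
      by (rule nn_integral_sum[symmetric]) measurable
    also have "\<dots> \<le> (\<integral>\<^sup>+p. ennreal (1 - (\<Prod>i<m. if enat i < fst p then 1 - W n ?b (x + snd p i) else 1)) \<partial>P)"
    proof (rule nn_integral_mono)
      fix p :: offspring
      define s where "s = (\<Sum>i<m. v p i)"
      have s: "0 \<le> s" unfolding s_def using v01 by (intro sum_nonneg)
      have "ennreal s = (\<Sum>i<m. ennreal (v p i))"
        using v01 by (simp add: s_def sum_ennreal)
      also have "\<dots> \<le> (\<Sum>i. ennreal (v p i))"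
        by (rule sum_le_suminf) auto
      also have "\<dots> \<le> G p"
        using G_ge[of p] by (simp add: v_def)
      finally have sG: "ennreal s \<le> G p" .
      have "(\<Sum>i<m. ennreal (v p i) * inverse (1 + G p)) = ennreal s * inverse (1 + G p)"
        using v01 by (simp add: s_def sum_ennreal flip: sum_distrib_right)
      also have "\<dots> \<le> ennreal s * inverse (1 + ennreal s)"
        using sG by (intro mult_left_mono ennreal_inverse_antimono add_left_mono) auto
      also have "\<dots> = ennreal (s / (1 + s))"
        using s by (simp add: divide_inverse inverse_ennreal ennreal_mult flip: ennreal_1 ennreal_plus)
      also have "\<dots> \<le> ennreal (1 - (\<Prod>i<m. 1 - v p i))"
        unfolding s_def using v01 by (intro ennreal_leI one_minus_prod_ge) auto
      also have "\<dots> \<le> ennreal (1 - (\<Prod>i<m. if enat i < fst p then 1 - W n ?b (x + snd p i) else 1))"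
        using V_le by (intro ennreal_leI diff_left_mono prod_mono) (auto simp: v_def)
      finally show "(\<Sum>i<m. ennreal (v p i) * inverse (1 + G p))
          \<le> ennreal (1 - (\<Prod>i<m. if enat i < fst p then 1 - W n ?b (x + snd p i) else 1))" .
    qed
    also have "\<dots> \<le> ennreal (W (Suc n) b x)"
      by (rule W_Suc_ge_prod[of x b, OF x])
    finally show ?thesis .
  qed
  have "(\<integral>\<^sup>+p. (\<Sum>i. ennreal (v p i)) * inverse (1 + G p) \<partial>P)
      = (\<integral>\<^sup>+p. (\<Sum>i. ennreal (v p i) * inverse (1 + G p)) \<partial>P)"
    by simp
  also have "\<dots> = (\<Sum>i. \<integral>\<^sup>+p. ennreal (v p i) * inverse (1 + G p) \<partial>P)"
    by (rule nn_integral_suminf) measurable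
  also have "\<dots> \<le> ennreal (W (Suc n) b x)"
    by (rule suminf_le_const[OF summableI part])
  finally show ?thesis unfolding v_def .
qed

text \<open>One child at or below \<open>z\<close> is enough, since success is more likely from
  lower positions. The events for the first \<open>m\<close> children increase to the full
  event.\<close>

lemma W_Suc_ge_jump:
  assumes x: "x \<le> b 0" and s: "0 \<le> s" "s \<le> W n (\<lambda>k. b (Suc k)) z"
  shows "s * prob {p. \<exists>i. enat i < fst p \<and> snd p i \<le> z - x} \<le> W (Suc n) b x"
proof -
  let ?b = "\<lambda>k. b (Suc k)"
  define A where "A m = {p. \<exists>i<m. enat i < fst p \<and> snd p i \<le> z - x}" for m :: nat
  have A [measurable]: "A m \<in> sets P" for m
  proof -
    have "Measurable.pred P (\<lambda>p. \<exists>i<m. enat i < fst p \<and> snd p i \<le> z - x)"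
      by measurable
    then show ?thesis by (simp add: A_def pred_def)
  qed
  have W1: "s \<le> 1" using s W_le_1 order_trans by blast
  have "ennreal s * emeasure P (A m) \<le> ennreal (W (Suc n) b x)" for m
  proof -
    have "ennreal s * emeasure P (A m) = (\<integral>\<^sup>+p. ennreal s * indicator (A m) p \<partial>P)"
      by (rule nn_integral_cmult_indicator[symmetric]) (rule A)
    also have "\<dots> \<le> (\<integral>\<^sup>+p. ennreal (1 - (\<Prod>i<m. if enat i < fst p then 1 - W n ?b (x + snd p i) else 1)) \<partial>P)"
    proof (rule nn_integral_mono)
      fix p :: offspring
      let ?f = "\<lambda>i. if enat i < fst p then 1 - W n ?b (x + snd p i) else 1"
      have f01: "0 \<le> ?f i \<and> ?f i \<le> 1" for i by simp
      show "ennreal s * indicator (A m) p \<le> ennreal (1 - prod ?f {..<m})"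
      proof (cases "p \<in> A m")
        case True
        then obtain i where i: "i < m" "enat i < fst p" "x + snd p i \<le> z"
          by (auto simp: A_def)
        have "prod ?f {..<m} = ?f i * prod ?f ({..<m} - {i})"
          using i by (subst prod.remove[of _ i]) auto
        also have "\<dots> \<le> ?f i * 1"
          using f01 by (intro mult_left_mono prod_le_1) auto
        also have "\<dots> \<le> 1 - s"
          using i s W_antimono[OF i(3), of n ?b] by simp
        finally show ?thesis using True by (simp add: ennreal_leI)
      qed simp
    qed
    also have "\<dots> \<le> ennreal (W (Suc n) b x)"
      by (rule W_Suc_ge_prod[of x b, OF x])
    finally show ?thesis .
  qed
  then have "(SUP m. ennreal s * emeasure P (A m)) \<le> ennreal (W (Suc n) b x)"
    by (rule SUP_least)
  also have "(SUP m. ennreal s * emeasure P (A m)) = ennreal s * emeasure P (\<Union>m. A m)"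
  proof -
    have "incseq A"
    proof (rule incseq_SucI)
      show "A m \<le> A (Suc m)" for m
        unfolding A_def using less_SucI by blast
    qed
    then have "(SUP m. emeasure P (A m)) = emeasure P (\<Union>m. A m)"
      using A by (intro SUP_emeasure_incseq) auto
    then show ?thesis by (simp flip: SUP_mult_left_ennreal)
  qed
  also have "(\<Union>m. A m) = {p. \<exists>i. enat i < fst p \<and> snd p i \<le> z - x}"
    by (auto simp: A_def)
  finally show ?thesis
    using s by (simp add: emeasure_eq_measure flip: ennreal_mult)
qed

end

lemma all_le_Suc_split: "(\<forall>k\<le>Suc r. Q k) \<longleftrightarrow> Q 0 \<and> (\<forall>k\<le>r. Q (Suc k))"
  by (metis Suc_le_mono le0 not0_implies_Suc)

context critical_law
begin

text \<open>
  A lower bound for \<open>exp (t x)\<close> times the probability that some path of length \<open>r\<close> from \<open>x\<close> stays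
  below \<open>H\<close>, ends above \<open>lo\<close> and continues successfully.  The factor \<open>1 / (1 + \<dots>)\<close> is what
  \<open>one_minus_prod_ge\<close> loses against the union bound; it replaces a second moment computation, and
  is controlled by the \<open>L log L\<close> condition.
\<close>

primrec good :: "real \<Rightarrow> real \<Rightarrow> nat \<Rightarrow> real \<Rightarrow> ennreal" where
  "good lo H 0 x = indicator {lo..H} x"
| "good lo H (Suc r) x = indicator {..H} x *
    (\<integral>\<^sup>+z. inverse (1 + ennreal (exp (- t * x)) * family_sum t (fst z)) * good lo H r (x + step z) \<partial>spine)"

lemma measurable_family_spine [measurable]: "(\<lambda>z. family_sum t (fst z)) \<in> borel_measurable spine"
  by (rule measurable_compose[OF measurable_fst_spine]) measurable

lemma borel_measurable_good [measurable]: "good lo H r \<in> borel_measurable borel"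
proof (induction r)
  case (Suc r)
  have [measurable]: "(\<lambda>z. family_sum t (fst (snd z))) \<in> borel_measurable (borel \<Otimes>\<^sub>M spine)"
    by (rule measurable_compose[OF measurable_snd]) measurable
  have [measurable]: "(\<lambda>z. step (snd z)) \<in> borel_measurable (borel \<Otimes>\<^sub>M spine)"
    by (rule measurable_compose[OF measurable_snd]) measurable
  note Suc [measurable]
  have "(\<lambda>(x, z). inverse (1 + ennreal (exp (- t * x)) * family_sum t (fst z)) * good lo H r (x + step z))
      \<in> borel_measurable (borel \<Otimes>\<^sub>M spine)"
    unfolding split_beta' by measurable
  from spine.borel_measurable_nn_integral[OF this] show ?case by simp
qed simp

lemma inverse_ennreal_one_plus_le_1: "inverse (1 + a) \<le> (1 :: ennreal)"
  using ennreal_inverse_antimono[of 1 "1 + a"] by simp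

lemma good_le_1: "good lo H r x \<le> 1"
proof (induction r arbitrary: x)
  case (Suc r)
  have "(\<integral>\<^sup>+z. inverse (1 + ennreal (exp (- t * x)) * family_sum t (fst z)) * good lo H r (x + step z) \<partial>spine)
      \<le> (\<integral>\<^sup>+z. 1 * 1 \<partial>spine)"
    by (intro nn_integral_mono mult_mono Suc.IH inverse_ennreal_one_plus_le_1) auto
  also have "\<dots> = 1" using spine.emeasure_space_1 by simp
  finally show ?case by (auto simp: indicator_def)
qed (simp add: indicator_def)

text \<open>Induction on \<open>r\<close>, with \<open>exp (- t * y) * good lo H r y\<close> as the
  \<open>V\<close> of \<open>W_Suc_ge\<close>. Since \<open>good\<close> is at most 1, the sum over
  the children is at most \<open>exp (- t * x)\<close> times the family sum: this is the
  \<open>G\<close> built into \<open>good\<close>. At the end of the climb, success is required with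
  probability \<open>exp (- t * y)\<close>, the reciprocal of the typical number of particles at
  height \<open>y\<close>.\<close>

lemma W_ge_good:
  assumes "\<And>k. k \<le> r \<Longrightarrow> H \<le> b k"
    and "\<And>y. lo \<le> y \<Longrightarrow> y \<le> H \<Longrightarrow> exp (- t * y) \<le> W n (\<lambda>k. b (r + k)) y"
  shows "ennreal (exp (- t * x)) * good lo H r x \<le> ennreal (W (n + r) b x)"
  using assms
proof (induction r arbitrary: b x)
  case 0
  then show ?case by (auto simp: indicator_def intro: ennreal_leI)
next
  case (Suc r)
  let ?b = "\<lambda>k. b (Suc k)"
  define V where "V y = exp (- t * y) * enn2real (good lo H r y)" for y
  have [measurable]: "V \<in> borel_measurable borel"
    unfolding V_def by measurable
  have fin: "good lo H r y < \<infinity>" for y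
    using good_le_1[of lo H r y] by (rule order.strict_trans1) simp
  have V: "ennreal (V y) = ennreal (exp (- t * y)) * good lo H r y" for y
    using fin[of y] by (simp add: V_def ennreal_mult)
  have V_le: "0 \<le> V y \<and> V y \<le> W (n + r) ?b y" for y
  proof -
    have "ennreal (V y) \<le> ennreal (W (n + r) ?b y)"
      unfolding V by (rule Suc.IH) (use Suc.prems in auto)
    then show ?thesis by (subst (asm) ennreal_le_iff) (auto simp: V_def)
  qed
  show ?case
  proof (cases "x \<le> H")
    case False
    then show ?thesis by simp
  next
    case True
    then have x: "x \<le> b 0" using Suc.prems(1)[of 0] by simp
    let ?G = "\<lambda>p. ennreal (exp (- t * x)) * family_sum t p"
    have summand: "ennreal (if enat i < fst p then V (x + snd p i) else 0)
        = ennreal (weight t p i) * (ennreal (exp (- t * x)) * good lo H r (x + step (p, i)))" for p i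
    proof (cases "enat i < fst p")
      case True
      have "exp (- t * (x + snd p i)) = exp (- t * snd p i) * exp (- t * x)"
        by (simp flip: exp_add add: algebra_simps)
      then show ?thesis
        using True by (simp add: V weight_def step_def ennreal_mult mult.assoc)
    qed (simp add: weight_def)
    have "ennreal (exp (- t * x)) * good lo H (Suc r) x
        = ennreal (exp (- t * x)) * (\<integral>\<^sup>+z. inverse (1 + ?G (fst z)) * good lo H r (x + step z) \<partial>spine)"
      using True by simp
    also have "\<dots> = (\<integral>\<^sup>+z. ennreal (exp (- t * x)) * (inverse (1 + ?G (fst z)) * good lo H r (x + step z)) \<partial>spine)"
      by (rule nn_integral_cmult[symmetric]) measurable
    also have "\<dots> = (\<integral>\<^sup>+p. (\<Sum>i. ennreal (weight t p i) *
        (ennreal (exp (- t * x)) * (inverse (1 + ?G (fst (p, i))) * good lo H r (x + step (p, i))))) \<partial>P)"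
      by (rule nn_integral_spine) measurable
    also have "\<dots> = (\<integral>\<^sup>+p. (\<Sum>i. ennreal (if enat i < fst p then V (x + snd p i) else 0)) * inverse (1 + ?G p) \<partial>P)"
      unfolding summand
      by (intro nn_integral_cong) (subst ennreal_suminf_multc[symmetric], intro suminf_cong, simp add: mult_ac)
    also have "\<dots> \<le> ennreal (W (Suc (n + r)) b x)"
    proof (rule W_Suc_ge[of x b, OF x _ V_le])
      fix p :: offspring
      have "(\<Sum>i. ennreal (if enat i < fst p then V (x + snd p i) else 0))
          \<le> (\<Sum>i. ennreal (weight t p i) * (ennreal (exp (- t * x)) * 1))"
        unfolding summand by (intro suminf_le mult_left_mono good_le_1) auto
      also have "\<dots> = ?G p"
        by (simp add: family_sum_def mult.commute)
      finally show "(\<Sum>i. ennreal (if enat i < fst p then V (x + snd p i) else 0)) \<le> ?G p" .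
    qed measurable
    finally show ?thesis by simp
  qed
qed

text \<open>Iterating the recursion separates the two requirements: the walk has to end high without
  exceeding \<open>H\<close>, and the product of the accumulated factors has to stay away from
  0.\<close>

lemma good_eq:
  "good lo H r x = (\<integral>\<^sup>+\<omega>. indicator {\<omega>. (\<forall>k\<le>r. x + walk \<omega> k \<le> H) \<and> lo \<le> x + walk \<omega> r} \<omega> *
    (\<Prod>k<r. inverse (1 + ennreal (exp (- t * (x + walk \<omega> k))) * family_sum t (fst (\<omega> k)))) \<partial>S)"
proof (induction r arbitrary: x)
  case 0
  show ?case using S.emeasure_space_1
    by (cases "x \<in> {lo..H}") (auto simp: indicator_def)
next
  case (Suc r)
  let ?A = "\<lambda>r x. {\<omega>. (\<forall>k\<le>r. x + walk \<omega> k \<le> H) \<and> lo \<le> x + walk \<omega> r}"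
  let ?D = "\<lambda>r x \<omega>. \<Prod>k<r. inverse (1 + ennreal (exp (- t * (x + walk \<omega> k))) * family_sum t (fst (\<omega> k)))"
  have A [measurable]: "?A r x \<in> sets S" for r x
  proof -
    have "Measurable.pred S (\<lambda>\<omega>. (\<forall>k\<le>r. x + walk \<omega> k \<le> H) \<and> lo \<le> x + walk \<omega> r)"
      by measurable
    then show ?thesis by (simp add: pred_def)
  qed
  have mD [measurable]: "?D r x \<in> borel_measurable S" for r x
    by measurable
  have ind: "indicator (?A (Suc r) x) (case_nat z \<omega>) = indicator {..H} x * (indicator (?A r (x + step z)) \<omega> :: ennreal)" for z \<omega>
  proof -
    have "(\<forall>k\<le>Suc r. x + walk (case_nat z \<omega>) k \<le> H) \<longleftrightarrow> x \<le> H \<and> (\<forall>k\<le>r. x + step z + walk \<omega> k \<le> H)"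
      by (auto simp: add.assoc all_le_Suc_split)
    then show ?thesis by (auto simp: indicator_def add.assoc)
  qed
  have D: "?D (Suc r) x (case_nat z \<omega>)
      = inverse (1 + ennreal (exp (- t * x)) * family_sum t (fst z)) * ?D r (x + step z) \<omega>" for z \<omega>
    by (subst prod.lessThan_Suc_shift) (simp add: add.assoc)
  have "(\<integral>\<^sup>+\<omega>. indicator (?A (Suc r) x) \<omega> * ?D (Suc r) x \<omega> \<partial>S)
      = (\<integral>\<^sup>+z. \<integral>\<^sup>+\<omega>. indicator (?A (Suc r) x) (case_nat z \<omega>) * ?D (Suc r) x (case_nat z \<omega>) \<partial>S \<partial>spine)"
    by (rule nn_integral_S_Suc) measurable
  also have "\<dots> = (\<integral>\<^sup>+z. \<integral>\<^sup>+\<omega>. (indicator {..H} x * inverse (1 + ennreal (exp (- t * x)) * family_sum t (fst z))) *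
      (indicator (?A r (x + step z)) \<omega> * ?D r (x + step z) \<omega>) \<partial>S \<partial>spine)"
    unfolding ind D by (simp only: mult_ac)
  also have "\<dots> = (\<integral>\<^sup>+z. (indicator {..H} x * inverse (1 + ennreal (exp (- t * x)) * family_sum t (fst z))) *
      good lo H r (x + step z) \<partial>spine)"
    unfolding Suc.IH by (intro nn_integral_cong nn_integral_cmult) measurable
  also have "\<dots> = good lo H (Suc r) x"
    by (simp add: mult.assoc nn_integral_cmult)
  finally show ?case ..
qed

end

section \<open>The random walk with positive drift\<close>

lemma sum_if_less_le:
  assumes "0 \<le> (y :: real)"
  shows "(\<Sum>k<n. if real k + 1 < y then 1 else 0) \<le> y"
proof -
  have "(\<Sum>k<n. if real k + 1 < y then 1 else 0) \<le> min (real n) y"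
    by (induction n) (use assms in auto)
  then show ?thesis by simp
qed

lemma ext_ln_plus_ennreal: "1 \<le> f \<Longrightarrow> ext_ln_plus (ennreal f) = ennreal (ln f)"
  by (simp add: ext_ln_plus_def ext_ln_def max_def)

lemma ext_ln_plus_top: "ext_ln_plus top = top"
  by (simp add: ext_ln_plus_def ext_ln_def max_def)

lemma borel_measurable_ext_ln_plus: "ext_ln_plus \<in> borel_measurable borel"
proof -
  have eq: "ext_ln_plus = (\<lambda>x. if x = top then top else if 1 \<le> x then ennreal (ln (enn2real x)) else 0)"
  proof
    fix x :: ennreal
    show "ext_ln_plus x = (if x = top then top else if 1 \<le> x then ennreal (ln (enn2real x)) else 0)"
    proof (cases x)
      case (real f)
      have "ext_ln_plus x = 0" if "f < 1"
        using real that by (cases "f = 0") (auto simp: ext_ln_plus_def ext_ln_def max_def ln_le_zero_iff)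
      then show ?thesis using real by (auto simp: ext_ln_plus_ennreal not_le)
    qed (simp add: ext_ln_plus_top)
  qed
  show ?thesis
    unfolding eq by measurable
qed

locale walk_law = critical_law +
  fixes \<alpha> :: real
  assumes \<alpha>: "1 < \<alpha>" "\<alpha> \<le> 2"
    and moment: "(\<integral>\<^sup>+z. ennreal (\<bar>step z\<bar> powr \<alpha>) \<partial>spine) < \<infinity>"
    and drift_pos: "0 < (\<integral>z. step z \<partial>spine)"
    and log_moment: "(\<integral>\<^sup>+z. ext_ln_plus (family_sum t (fst z)) \<partial>spine) < \<infinity>"
begin

definition drift :: real where
  "drift = (\<integral>z. step z \<partial>spine)"

lemma drift_gt_0 [simp]: "0 < drift"
  using drift_pos by (simp add: drift_def)

lemma integrable_moment: "integrable spine (\<lambda>z. \<bar>step z\<bar> powr \<alpha>)"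
  using moment by (intro integrableI_bounded) auto

lemma integrable_step: "integrable spine step"
proof (rule Bochner_Integration.integrable_bound[of _ "\<lambda>z. 1 + \<bar>step z\<bar> powr \<alpha>"])
  have "\<bar>x\<bar> \<le> 1 + \<bar>x\<bar> powr \<alpha>" for x :: real
    using powr_le_one_plus_powr[of 1 \<alpha> x] \<alpha> by simp
  then show "AE z in spine. norm (step z) \<le> norm (1 + \<bar>step z\<bar> powr \<alpha>)"
    by (intro AE_I2) simp
qed (use integrable_moment in auto)

lemma distr_S_component: "distr S spine (\<lambda>\<omega>. \<omega> i) = spine"
  using spine.distr_coordinate_compose[of "\<lambda>z. z" spine i] by (simp add: S_def distr_id2)

lemma
  assumes [measurable]: "f \<in> borel_measurable spine"
  shows S_integral_component: "(\<integral>\<omega>. f (\<omega> i) \<partial>S) = (\<integral>z. f z \<partial>spine :: real)"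
    and S_integrable_component: "integrable S (\<lambda>\<omega>. f (\<omega> i)) \<longleftrightarrow> integrable spine (f :: _ \<Rightarrow> real)"
proof -
  show "(\<integral>\<omega>. f (\<omega> i) \<partial>S) = (\<integral>z. f z \<partial>spine)"
    using integral_distr[of "\<lambda>\<omega>. \<omega> i" S spine f] by (simp add: distr_S_component)
  show "integrable S (\<lambda>\<omega>. f (\<omega> i)) \<longleftrightarrow> integrable spine f"
    using integrable_distr_eq[of "\<lambda>\<omega>. \<omega> i" S spine f] by (simp add: distr_S_component)
qed

lemma emeasure_S_component:
  assumes [measurable]: "B \<in> sets spine"
  shows "emeasure S {\<omega>. \<omega> i \<in> B} = emeasure spine B"
proof -
  have "emeasure (distr S spine (\<lambda>\<omega>. \<omega> i)) B = emeasure S ((\<lambda>\<omega>. \<omega> i) -` B \<inter> space S)"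
    by (rule emeasure_distr) measurable
  then show ?thesis by (simp add: distr_S_component vimage_def)
qed

lemma iid_steps:
  "S.indep_vars (\<lambda>_. borel) (\<lambda>i \<omega>. step (\<omega> i)) UNIV"
  "distr S borel (\<lambda>\<omega>. step (\<omega> i)) = distr S borel (\<lambda>\<omega>. step (\<omega> 0))"
  using spine.indep_vars_coordinates_compose[of step borel]
    spine.distr_coordinate_compose[of step borel i] spine.distr_coordinate_compose[of step borel 0]
  by (simp_all add: S_def)

lemma walk_slow_le:
  "\<exists>C>0. \<forall>n\<ge>1. S.prob {\<omega>. walk \<omega> n \<le> drift / 2 * real n} \<le> C * real n powr (1 - \<alpha>)"
proof -
  have "integrable S (\<lambda>\<omega>. \<bar>step (\<omega> 0)\<bar> powr \<alpha>)"
    using integrable_moment by (subst S_integrable_component) auto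
  from S.weak_law_rate[OF iid_steps \<alpha> this, of "drift / 2"] obtain C where C: "C > 0"
    "\<And>n. n \<ge> 1 \<Longrightarrow> S.prob {\<omega> \<in> space S. drift / 2 * real n \<le> \<bar>(\<Sum>i<n. step (\<omega> i)) - real n * drift\<bar>}
      \<le> C * real n powr (1 - \<alpha>)"
    by (auto simp: S_integral_component drift_def[symmetric])
  have "S.prob {\<omega>. walk \<omega> n \<le> drift / 2 * real n} \<le> C * real n powr (1 - \<alpha>)" if "n \<ge> 1" for n
  proof -
    have "S.prob {\<omega>. walk \<omega> n \<le> drift / 2 * real n}
        \<le> S.prob {\<omega> \<in> space S. drift / 2 * real n \<le> \<bar>(\<Sum>i<n. step (\<omega> i)) - real n * drift\<bar>}"
    proof (rule S.finite_measure_mono)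
      show "{\<omega>. walk \<omega> n \<le> drift / 2 * real n}
          \<subseteq> {\<omega> \<in> space S. drift / 2 * real n \<le> \<bar>(\<Sum>i<n. step (\<omega> i)) - real n * drift\<bar>}"
      proof
        fix \<omega> assume "\<omega> \<in> {\<omega>. walk \<omega> n \<le> drift / 2 * real n}"
        then have "walk \<omega> n \<le> drift / 2 * real n" by simp
        moreover have "drift / 2 * real n + drift / 2 * real n = real n * drift" by simp
        ultimately have "drift / 2 * real n \<le> \<bar>walk \<omega> n - real n * drift\<bar>" by linarith
        then show "\<omega> \<in> {\<omega> \<in> space S. drift / 2 * real n \<le> \<bar>(\<Sum>i<n. step (\<omega> i)) - real n * drift\<bar>}"
          by (simp add: walk_def)
      qed
    qed measurable
    then show ?thesis using C(2)[OF that] by linarith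
  qed
  with C(1) show ?thesis by blast
qed

lemma AE_walk_ge: "AE \<omega> in S. \<forall>\<^sub>F k in sequentially. drift / 2 * real k \<le> walk \<omega> k"
  unfolding walk_def
proof (rule S.sums_eventually_linear[OF iid_steps \<alpha>])
  show "integrable S (\<lambda>\<omega>. \<bar>step (\<omega> 0)\<bar> powr \<alpha>)"
    using integrable_moment by (subst S_integrable_component) auto
  show "integrable S (\<lambda>\<omega>. step (\<omega> 0))"
    using integrable_step by (subst S_integrable_component) auto
  show "drift / 2 < S.expectation (\<lambda>\<omega>. step (\<omega> 0))"
    by (subst S_integral_component) (auto simp flip: drift_def)
qed simp

text \<open>Markov's inequality for the sum of the positive parts of the steps, which dominates
  every partial sum. For \<open>H = K * r\<close> the bound is a constant over \<open>K\<close>,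
  uniformly in \<open>r\<close>.\<close>

lemma walk_high_le:
  assumes "H > 0"
  shows "S.prob {\<omega>. \<exists>k\<le>r. H < walk \<omega> k} \<le> real r * (\<integral>z. max (step z) 0 \<partial>spine) / H"
proof -
  let ?u = "\<lambda>\<omega>. \<Sum>j<r. max (step (\<omega> j)) 0"
  have int: "integrable S (\<lambda>\<omega>. max (step (\<omega> j)) 0)" for j
    using integrable_step by (subst S_integrable_component) auto
  have "S.prob {\<omega>. \<exists>k\<le>r. H < walk \<omega> k} \<le> S.prob {\<omega> \<in> space S. H \<le> ?u \<omega>}"
  proof (rule S.finite_measure_mono)
    show "{\<omega>. \<exists>k\<le>r. H < walk \<omega> k} \<subseteq> {\<omega> \<in> space S. H \<le> ?u \<omega>}"
    proof
      fix \<omega> assume "\<omega> \<in> {\<omega>. \<exists>k\<le>r. H < walk \<omega> k}"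
      then obtain k where k: "k \<le> r" "H < walk \<omega> k" by auto
      have "walk \<omega> k \<le> (\<Sum>j<k. max (step (\<omega> j)) 0)"
        unfolding walk_def by (intro sum_mono) auto
      also have "\<dots> \<le> ?u \<omega>"
        using k by (intro sum_mono2) auto
      finally show "\<omega> \<in> {\<omega> \<in> space S. H \<le> ?u \<omega>}" using k by simp
    qed
  qed measurable
  also have "\<dots> \<le> S.expectation ?u / H"
    using assms int by (intro integral_Markov_inequality_measure[where A = "{}"]) (auto intro!: AE_I2 sum_nonneg)
  also have "S.expectation ?u = real r * (\<integral>z. max (step z) 0 \<partial>spine)"
    using int S_integral_component[of "\<lambda>z. max (step z) 0"] by simp
  finally show ?thesis .
qed

lemma AE_family_finite: "AE \<omega> in S. \<forall>k. family_sum t (fst (\<omega> k)) < \<infinity>"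
proof -
  have "emeasure spine {z. family_sum t (fst z) = top} = 0"
  proof -
    have "Measurable.pred spine (\<lambda>z. family_sum t (fst z) = top)" by measurable
    then have B [measurable]: "{z. family_sum t (fst z) = top} \<in> sets spine" by (simp add: pred_def)
    have "top * emeasure spine {z. family_sum t (fst z) = top}
        = (\<integral>\<^sup>+z. top * indicator {z. family_sum t (fst z) = top} z \<partial>spine)"
      by (rule nn_integral_cmult_indicator[symmetric]) (rule B)
    also have "\<dots> \<le> (\<integral>\<^sup>+z. ext_ln_plus (family_sum t (fst z)) \<partial>spine)"
      by (intro nn_integral_mono) (auto simp: indicator_def ext_ln_plus_top)
    also have "\<dots> < top" using log_moment by simp
    finally show ?thesis by (auto simp: ennreal_top_mult split: if_splits)
  qed
  moreover have B: "{z. family_sum t (fst z) = top} \<in> sets spine"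
  proof -
    have "Measurable.pred spine (\<lambda>z. family_sum t (fst z) = top)" by measurable
    then show ?thesis by (simp add: pred_def)
  qed
  ultimately have "emeasure S {\<omega>. \<omega> k \<in> {z. family_sum t (fst z) = top}} = 0" for k
    by (simp only: emeasure_S_component)
  moreover have "{\<omega>. \<omega> k \<in> {z. family_sum t (fst z) = top}} \<in> sets S" for k
    using measurable_sets[OF measurable_S_component B, of k] by (simp add: vimage_def)
  ultimately have "AE \<omega> in S. family_sum t (fst (\<omega> k)) < \<infinity>" for k
    by (intro AE_I[of _ _ "{\<omega>. \<omega> k \<in> {z. family_sum t (fst z) = top}}"]) (auto simp flip: less_top)
  then show ?thesis by (simp add: AE_all_countable)
qed

text \<open>Under the size-biased law the L log L condition says that \<open>ext_ln_plus\<close> of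
  the family sum is integrable. At most \<open>ln f / \<kappa>\<close> indices \<open>k\<close>
  satisfy \<open>\<kappa> * (k + 1) < ln f\<close> when \<open>f \<ge> 1\<close>, so the
  probabilities of the exceptional events are summable.\<close>

lemma AE_family_le:
  assumes \<kappa>: "\<kappa> > 0"
  shows "AE \<omega> in S. \<forall>\<^sub>F k in sequentially. family_sum t (fst (\<omega> k)) \<le> ennreal (exp (\<kappa> * (real k + 1)))"
proof -
  define B where "B k = {z :: offspring \<times> nat. ennreal (exp (\<kappa> * (real k + 1))) < family_sum t (fst z)}" for k
  have B [measurable]: "B k \<in> sets spine" for k
  proof -
    have "Measurable.pred spine (\<lambda>z. ennreal (exp (\<kappa> * (real k + 1))) < family_sum t (fst z))"
      by measurable
    then show ?thesis by (simp add: pred_def B_def)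
  qed
  have pointwise: "(\<Sum>k. indicator (B k) z) \<le> ennreal (1 / \<kappa>) * ext_ln_plus (family_sum t (fst z))" for z
  proof (cases "family_sum t (fst z)")
    case top
    then show ?thesis using \<kappa> by (simp add: ext_ln_plus_top ennreal_mult_top)
  next
    case (real f)
    have part: "(\<Sum>k<n. indicator (B k) z) \<le> ennreal (1 / \<kappa>) * ext_ln_plus (family_sum t (fst z))" for n
    proof (cases "1 \<le> f")
      case False
      have "z \<notin> B k" for k
      proof -
        have "f < exp 0" using False by simp
        also have "\<dots> \<le> exp (\<kappa> * (real k + 1))" using \<kappa> by (subst exp_le_cancel_iff) auto
        finally show ?thesis using real by (simp add: B_def ennreal_less_iff)
      qed
      then show ?thesis by simp
    next
      case True
      have "(\<Sum>k<n. indicator (B k) z) \<le> (\<Sum>k<n. ennreal (if real k + 1 < ln f / \<kappa> then 1 else 0))"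
      proof (rule sum_mono)
        fix k
        have "real k + 1 < ln f / \<kappa>" if "z \<in> B k"
        proof -
          have "exp (\<kappa> * (real k + 1)) < f" using that real by (simp add: B_def ennreal_less_iff)
          then have "exp (\<kappa> * (real k + 1)) < exp (ln f)" using True by simp
          then have "\<kappa> * (real k + 1) < ln f" by (simp only: exp_less_cancel_iff)
          then show ?thesis using \<kappa> by (simp add: field_simps)
        qed
        then show "indicator (B k) z \<le> ennreal (if real k + 1 < ln f / \<kappa> then 1 else 0)"
          by (auto simp: indicator_def)
      qed
      also have "\<dots> = ennreal (\<Sum>k<n. if real k + 1 < ln f / \<kappa> then 1 else 0)"
        by (rule sum_ennreal) auto
      also have "\<dots> \<le> ennreal (ln f / \<kappa>)"
        using True \<kappa> by (intro ennreal_leI sum_if_less_le) auto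
      also have "\<dots> = ennreal (1 / \<kappa>) * ext_ln_plus (family_sum t (fst z))"
        using True \<kappa> real by (simp add: ext_ln_plus_ennreal flip: ennreal_mult)
      finally show ?thesis .
    qed
    show ?thesis by (rule suminf_le_const[OF summableI part])
  qed
  define A where "A k = {\<omega>. \<omega> k \<in> B k}" for k
  have A [measurable]: "A k \<in> sets S" for k
    unfolding A_def using measurable_sets[OF measurable_S_component B, of k k] by (simp add: vimage_def)
  have "(\<Sum>k. ennreal (S.prob (A k))) = (\<Sum>k. emeasure spine (B k))"
    unfolding A_def S.emeasure_eq_measure[symmetric] emeasure_S_component[OF B] ..
  also have "\<dots> = (\<Sum>k. \<integral>\<^sup>+z. indicator (B k) z \<partial>spine)"
    by (simp only: nn_integral_indicator[OF B])
  also have "\<dots> = (\<integral>\<^sup>+z. (\<Sum>k. indicator (B k) z) \<partial>spine)"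
    by (rule nn_integral_suminf[symmetric]) measurable
  also have "\<dots> \<le> (\<integral>\<^sup>+z. ennreal (1 / \<kappa>) * ext_ln_plus (family_sum t (fst z)) \<partial>spine)"
    by (intro nn_integral_mono pointwise)
  also have "\<dots> = ennreal (1 / \<kappa>) * (\<integral>\<^sup>+z. ext_ln_plus (family_sum t (fst z)) \<partial>spine)"
  proof (rule nn_integral_cmult)
    show "(\<lambda>z. ext_ln_plus (family_sum t (fst z))) \<in> borel_measurable spine"
      by (rule measurable_compose[OF measurable_family_spine borel_measurable_ext_ln_plus])
  qed
  also have "\<dots> < \<infinity>"
    using log_moment by (simp add: ennreal_mult_less_top)
  finally have "summable (\<lambda>k. S.prob (A k))"
    by (intro summable_suminf_not_top) auto
  then have "AE \<omega> in S. \<forall>\<^sub>F k in sequentially. \<omega> \<in> space S - A k"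
    by (intro borel_cantelli_AE1) (auto simp: less_top[symmetric])
  then show ?thesis
  proof eventually_elim
    case (elim \<omega>)
    then show ?case
      by (rule eventually_mono) (auto simp: A_def B_def)
  qed
qed

section \<open>A climb succeeds with probability bounded away from 0\<close>

definition damping :: "nat \<Rightarrow> (nat \<Rightarrow> offspring \<times> nat) \<Rightarrow> ennreal" where
  "damping r \<omega> = (\<Prod>k<r. inverse (1 + ennreal (exp (- t * walk \<omega> k)) * family_sum t (fst (\<omega> k))))"

lemma measurable_damping [measurable]: "damping r \<in> borel_measurable S"
  unfolding damping_def by measurable

lemma damping_le_1: "damping r \<omega> \<le> 1"
  unfolding damping_def by (induction r) (auto intro: mult_le_one inverse_ennreal_one_plus_le_1)

text \<open>The walk eventually exceeds \<open>drift / 2 * k\<close>, whereas the family sums grow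
  at most like \<open>exp (\<kappa> * k)\<close> for any \<open>\<kappa> > 0\<close>. So the
  products of \<open>exp (- t * walk)\<close> and family sum decay geometrically, and the infinite
  product of the factors has a positive limit. Finiteness of every family sum takes care of the
  early factors.\<close>

lemma AE_damping_pos: "AE \<omega> in S. 0 < (INF r. damping r \<omega>)"
proof -
  \<comment> \<open>Half of the decay rate \<open>t * drift / 2\<close> of the weights; the other
    half remains as geometric decay.\<close>
  define \<kappa> where "\<kappa> = t * drift / 4"
  have \<kappa>: "\<kappa> > 0" using t_pos by (simp add: \<kappa>_def)
  from AE_walk_ge AE_family_finite AE_family_le[OF \<kappa>] show ?thesis
  proof eventually_elim
    case (elim \<omega>)
    define y where "y k = exp (- t * walk \<omega> k) * enn2real (family_sum t (fst (\<omega> k)))" for k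
    have y: "0 \<le> y k" for k by (simp add: y_def)
    have fam: "family_sum t (fst (\<omega> k)) = ennreal (enn2real (family_sum t (fst (\<omega> k))))" for k
      using elim(2) by simp
    have "\<forall>\<^sub>F k in sequentially. norm (y k) \<le> exp \<kappa> * exp (- \<kappa>) ^ k"
      using elim(1,3)
    proof eventually_elim
      case (elim k)
      have "enn2real (family_sum t (fst (\<omega> k))) \<le> exp (\<kappa> * (real k + 1))"
        using elim(2) by (subst (asm) fam) simp
      moreover have "exp (- t * walk \<omega> k) \<le> exp (- t * (drift / 2 * real k))"
        using elim(1) t_pos by simp
      ultimately have "y k \<le> exp (- t * (drift / 2 * real k)) * exp (\<kappa> * (real k + 1))"
        unfolding y_def by (intro mult_mono) auto
      also have "\<dots> = exp \<kappa> * exp (- \<kappa>) ^ k"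
        by (simp add: \<kappa>_def algebra_simps flip: exp_add exp_of_nat_mult)
      finally show ?case using y[of k] by simp
    qed
    moreover have "summable (\<lambda>k. exp \<kappa> * exp (- \<kappa>) ^ k)"
      using \<kappa> by (intro summable_mult summable_geometric) auto
    ultimately have summ: "summable y"
      by (rule summable_comparison_test_ev)
    have "ennreal (exp (- suminf y)) \<le> damping r \<omega>" for r
    proof -
      have "exp (- suminf y) \<le> exp (- (\<Sum>k<r. y k))"
        using sum_le_suminf[OF summ, of "{..<r}"] y by simp
      also have "\<dots> = (\<Prod>k<r. exp (- y k))"
        by (simp add: exp_sum flip: sum_negf)
      also have "\<dots> \<le> (\<Prod>k<r. inverse (1 + y k))"
      proof (rule prod_mono)
        fix k
        have "exp (- y k) \<le> inverse (1 + y k)"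
          using y[of k] exp_ge_add_one_self[of "y k"] by (simp add: exp_minus le_imp_inverse_le)
        then show "0 \<le> exp (- y k) \<and> exp (- y k) \<le> inverse (1 + y k)" by simp
      qed
      finally have "ennreal (exp (- suminf y)) \<le> ennreal (\<Prod>k<r. inverse (1 + y k))"
        by (rule ennreal_leI)
      also have "\<dots> = (\<Prod>k<r. ennreal (inverse (1 + y k)))"
        using y by (intro prod_ennreal[symmetric]) (simp add: add_nonneg_nonneg)
      also have "\<dots> = damping r \<omega>"
        unfolding damping_def
      proof (rule prod.cong)
        fix k
        have "ennreal (inverse (1 + y k)) = inverse (ennreal (1 + y k))"
          using y[of k] by (intro inverse_ennreal[symmetric]) simp
        also have "ennreal (1 + y k) = 1 + ennreal (exp (- t * walk \<omega> k)) * family_sum t (fst (\<omega> k))"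
          using y[of k] by (subst fam) (simp add: y_def flip: ennreal_mult ennreal_plus ennreal_1)
        finally show "ennreal (inverse (1 + y k))
            = inverse (1 + ennreal (exp (- t * walk \<omega> k)) * family_sum t (fst (\<omega> k)))" .
      qed simp
      finally show ?thesis .
    qed
    then have "ennreal (exp (- suminf y)) \<le> (INF r. damping r \<omega>)"
      by (intro INF_greatest)
    then show ?case
      by (rule less_le_trans[rotated]) simp
  qed
qed

lemma walk_slow_tendsto_0:
  "(\<lambda>r. S.prob {\<omega>. walk \<omega> r \<le> drift / 2 * real r}) \<longlonglongrightarrow> 0"
proof -
  obtain C where C: "C > 0" "\<And>n. n \<ge> 1 \<Longrightarrow> S.prob {\<omega>. walk \<omega> n \<le> drift / 2 * real n} \<le> C * real n powr (1 - \<alpha>)"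
    using walk_slow_le by blast
  have "((\<lambda>x. x powr (1 - \<alpha>)) \<longlongrightarrow> 0) at_top"
    using \<alpha> by real_asymp
  then have lim: "(\<lambda>n. C * real n powr (1 - \<alpha>)) \<longlonglongrightarrow> 0"
    by (intro tendsto_mult_right_zero filterlim_compose[OF _ filterlim_real_sequentially])
  have "\<forall>\<^sub>F n in sequentially. S.prob {\<omega>. walk \<omega> n \<le> drift / 2 * real n} \<le> C * real n powr (1 - \<alpha>)"
    using C(2) by (rule eventually_sequentiallyI)
  from tendsto_sandwich[OF _ this tendsto_const lim] show ?thesis by simp
qed

lemma good_lower_bound:
  "\<exists>q>0. \<exists>K\<ge>1. \<forall>\<^sub>F r in sequentially. ennreal q \<le> good (drift / 2 * real r) (K * real r) r 0"
proof -
  define Q where "Q = (\<integral>\<^sup>+\<omega>. (INF r. damping r \<omega>) \<partial>S)"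
  have "Q \<le> (\<integral>\<^sup>+\<omega>. 1 \<partial>S)"
    unfolding Q_def by (intro nn_integral_mono INF_lower2[of 0] damping_le_1) simp
  then have "Q \<le> 1" using S.emeasure_space_1 by simp
  then have Q_fin: "Q < \<infinity>" by (rule order.strict_trans1) simp
  have Q_pos: "Q \<noteq> 0"
  proof
    assume "Q = 0"
    then have "AE \<omega> in S. (INF r. damping r \<omega>) = 0"
      unfolding Q_def by (subst (asm) nn_integral_0_iff_AE) measurable
    with AE_damping_pos have "AE \<omega> in S. False"
      by eventually_elim auto
    then show False by simp
  qed
  \<comment> \<open>\<open>Q\<close> is a lower bound for the mean damping at every
    \<open>r\<close>. Two exceptional events, a slow walk and a walk above \<open>K * r\<close>,
    take away at most \<open>q\<close> each; the \<open>K\<close> below makes Markov's bound for the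
    second one at most \<open>q\<close>.\<close>
  define q where "q = enn2real Q / 4"
  have q: "q > 0" and Qq: "Q = ennreal (4 * q)"
    using Q_fin Q_pos by (auto simp: q_def enn2real_positive_iff less_top zero_less_iff_neq_zero)
  define \<mu> where "\<mu> = (\<integral>z. max (step z) 0 \<partial>spine)"
  have \<mu>: "0 \<le> \<mu>" unfolding \<mu>_def by (intro integral_nonneg_AE) auto
  define K where "K = max 1 (\<mu> / q)"
  have K: "K \<ge> 1" "\<mu> / K \<le> q"
  proof -
    show "K \<ge> 1" by (simp add: K_def)
    have "\<mu> / q \<le> K" by (simp add: K_def)
    then show "\<mu> / K \<le> q" using q \<open>K \<ge> 1\<close> by (simp add: field_simps)
  qed
  have "\<forall>\<^sub>F r in sequentially. S.prob {\<omega>. walk \<omega> r \<le> drift / 2 * real r} < q"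
    using walk_slow_tendsto_0 q by (rule order_tendstoD)
  then have "\<forall>\<^sub>F r in sequentially. ennreal q \<le> good (drift / 2 * real r) (K * real r) r 0"
    using eventually_gt_at_top[of 0]
  proof eventually_elim
    case (elim r)
    let ?H = "K * real r" and ?lo = "drift / 2 * real r"
    let ?A = "{\<omega>. (\<forall>k\<le>r. walk \<omega> k \<le> ?H) \<and> ?lo \<le> walk \<omega> r}"
    let ?B1 = "{\<omega>. walk \<omega> r \<le> ?lo}" and ?B2 = "{\<omega>. \<exists>k\<le>r. ?H < walk \<omega> k}"
    have "Measurable.pred S (\<lambda>\<omega>. (\<forall>k\<le>r. walk \<omega> k \<le> ?H) \<and> ?lo \<le> walk \<omega> r)"
      "Measurable.pred S (\<lambda>\<omega>. walk \<omega> r \<le> ?lo)" "Measurable.pred S (\<lambda>\<omega>. \<exists>k\<le>r. ?H < walk \<omega> k)"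
      by measurable
    then have sets [measurable]: "?A \<in> sets S" "?B1 \<in> sets S" "?B2 \<in> sets S"
      by (simp_all add: pred_def)
    have "Q \<le> (\<integral>\<^sup>+\<omega>. damping r \<omega> \<partial>S)"
      unfolding Q_def by (intro nn_integral_mono INF_lower) simp
    also have "\<dots> \<le> (\<integral>\<^sup>+\<omega>. indicator ?A \<omega> * damping r \<omega> + (indicator ?B1 \<omega> + indicator ?B2 \<omega>) \<partial>S)"
    proof (rule nn_integral_mono)
      fix \<omega>
      consider "\<omega> \<in> ?A" | "\<omega> \<in> ?B1" | "\<omega> \<in> ?B2" by fastforce
      then show "damping r \<omega> \<le> indicator ?A \<omega> * damping r \<omega> + (indicator ?B1 \<omega> + indicator ?B2 \<omega>)"
      proof cases
        case 1
        then have "damping r \<omega> \<le> indicator ?A \<omega> * damping r \<omega>"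
          by (simp only: indicator_simps mult_1 order_refl)
        then show ?thesis by (rule add_increasing2[OF zero_le])
      next
        case 2
        then have "damping r \<omega> \<le> indicator ?B1 \<omega>"
          by (simp only: indicator_simps damping_le_1)
        then show ?thesis by (intro add_increasing[OF zero_le] add_increasing2[OF zero_le])
      next
        case 3
        then have "damping r \<omega> \<le> indicator ?B2 \<omega>"
          by (simp only: indicator_simps damping_le_1)
        then show ?thesis by (intro add_increasing[OF zero_le])
      qed
    qed
    also have "\<dots> = (\<integral>\<^sup>+\<omega>. indicator ?A \<omega> * damping r \<omega> \<partial>S)
        + (\<integral>\<^sup>+\<omega>. indicator ?B1 \<omega> + indicator ?B2 \<omega> \<partial>S)"
      using sets by (intro nn_integral_add) measurable
    also have "(\<integral>\<^sup>+\<omega>. indicator ?B1 \<omega> + indicator ?B2 \<omega> \<partial>S) = emeasure S ?B1 + emeasure S ?B2"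
      using sets by (simp only: nn_integral_add nn_integral_indicator borel_measurable_indicator)
    also have "(\<integral>\<^sup>+\<omega>. indicator ?A \<omega> * damping r \<omega> \<partial>S) = good ?lo ?H r 0"
      by (simp add: good_eq damping_def)
    also have "emeasure S ?B1 \<le> ennreal q"
      using elim(1) by (simp add: S.emeasure_eq_measure ennreal_leI)
    also have "emeasure S ?B2 \<le> ennreal q"
    proof -
      have "S.prob ?B2 \<le> real r * \<mu> / ?H"
        unfolding \<mu>_def using K elim by (intro walk_high_le) auto
      also have "\<dots> = \<mu> / K" using elim by simp
      finally show ?thesis using K by (simp add: S.emeasure_eq_measure ennreal_leI)
    qed
    finally have le: "Q \<le> good ?lo ?H r 0 + (ennreal q + ennreal q)"
      by (simp add: add_left_mono add_mono)
    obtain g where g: "0 \<le> g" "good ?lo ?H r 0 = ennreal g"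
      using good_le_1[of ?lo ?H r 0] by (cases "good ?lo ?H r 0") (auto simp: top_unique)
    have "4 * q \<le> g + (q + q)"
      using le q g unfolding Qq by (simp flip: ennreal_plus)
    then show ?case using g q by (simp add: ennreal_leI)
  qed
  with q K show ?thesis by blast
qed

text \<open>With \<open>a = rate\<close> and \<open>f n = sqrt (n * ln n)\<close>, the blocks of
  \<open>W_tendsto_bound\<close> cost \<open>exp (- 2 * t * a * f n)\<close> up to a power of
  \<open>n\<close>. This exponent is twice the one gained by the change of measure at height
  \<open>a * f n\<close>; solving for \<open>a\<close> gives the square root.\<close>

definition rate :: real where
  "rate = sqrt ((\<alpha> - 1) * drift / (64 * t))"

lemma rate_pos: "rate > 0"
  unfolding rate_def using \<alpha> t_pos by (intro real_sqrt_gt_zero divide_pos_pos mult_pos_pos) auto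

text \<open>
  Split \<open>n\<close> into \<open>n / T\<close> blocks of length \<open>T\<close>, where \<open>T\<close> is a multiple of \<open>sqrt (n ln n)\<close>
  such that the walk exceeds the barrier after \<open>T\<close> steps unless it is atypically slow; in each block
  this costs a power of \<open>n\<close>.
\<close>

lemma W_tendsto_bound:
  assumes C: "0 \<le> C" and c: "0 \<le> c"
  shows "\<forall>\<^sub>F n in sequentially. W n (\<lambda>k. C + rate * sqrt (real k * ln (real k))) 0
    \<le> exp (- t * c) + exp (t * C - t * rate * sqrt (real n * ln (real n)) + (\<alpha> - 1) / 4 * ln (real n))"
proof -
  define \<delta> where "\<delta> = \<alpha> - 1"
  define a where "a = rate"
  define m where "m = drift"
  have pos: "\<delta> > 0" "a > 0" "m > 0"
    using \<alpha> rate_pos by (auto simp: \<delta>_def a_def m_def)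
  have a2: "a * a = \<delta> * m / (64 * t)"
    unfolding a_def rate_def \<delta>_def[symmetric] m_def[symmetric]
    using pos t_pos by (subst real_sqrt_mult_self, intro abs_of_nonneg divide_nonneg_pos mult_nonneg_nonneg) auto
  define f where "f n = sqrt (real n * ln (real n))" for n :: nat
  \<comment> \<open>At speed at least \<open>m / 2\<close> the walk climbs at least
    \<open>2 * a * f n\<close> during a block, and by \<open>ev1\<close> this is no less than
    \<open>C + a * f n + c\<close>.\<close>
  define T where "T n = nat \<lceil>4 * a / m * f n\<rceil>" for n
  obtain D where D: "D > 0" "\<And>n. n \<ge> 1 \<Longrightarrow> S.prob {\<omega>. walk \<omega> n \<le> m / 2 * real n} \<le> D * real n powr (- \<delta>)"
    using walk_slow_le by (auto simp: \<delta>_def m_def)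
  have f_mono: "f k \<le> f n" if "k \<le> n" for k n
  proof (cases "k = 0")
    case False
    then have "real k * ln (real k) \<le> real n * ln (real n)"
      using that by (intro mult_mono) auto
    then show ?thesis by (simp add: f_def)
  next
    case True
    then show ?thesis by (cases "n = 0") (auto simp: f_def)
  qed
  have ev1: "\<forall>\<^sub>F n in sequentially. C + c \<le> a * f n"
    unfolding f_def using pos by real_asymp
  have ev2: "\<forall>\<^sub>F n in sequentially. 1 \<le> 4 * a / m * f n"
  proof -
    have "0 < 4 * a / m" using pos by simp
    then show ?thesis unfolding f_def by real_asymp
  qed
  \<comment> \<open>The power \<open>- \<delta>\<close> of \<open>f n\<close> is of order
    \<open>n powr (- \<delta> / 2)\<close> up to a logarithm; the exponent
    \<open>- \<delta> / 4\<close> leaves room for the constants.\<close>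
  have ev3: "\<forall>\<^sub>F n in sequentially. D * (4 * a / m * f n) powr (- \<delta>) \<le> real n powr (- \<delta> / 4)"
  proof -
    define u where "u = 4 * a / m"
    have "u > 0" using pos by (simp add: u_def)
    then have "\<forall>\<^sub>F n in sequentially. D * (u * f n) powr (- \<delta>) \<le> real n powr (- \<delta> / 4)"
      unfolding f_def using pos D(1) by real_asymp
    then show ?thesis by (simp add: u_def)
  qed
  show ?thesis
    using ev1 ev2 ev3 eventually_gt_at_top[of 1]
  proof eventually_elim
    case (elim n)
    have fpos: "f n > 0" using elim(4) by (simp add: f_def)
    have f2: "f n * f n = real n * ln (real n)"
      using elim(4) by (simp add: f_def)
    have lnpos: "ln (real n) > 0" using elim(4) by simp
    have T_ge: "4 * a / m * f n \<le> real (T n)"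
      unfolding T_def by linarith
    have T_le: "real (T n) \<le> 8 * a / m * f n"
    proof -
      have "real (T n) \<le> 4 * a / m * f n + 1"
        unfolding T_def using elim(2) by linarith
      also have "\<dots> \<le> 4 * a / m * f n + 4 * a / m * f n" using elim(2) by simp
      finally show ?thesis by simp
    qed
    have T1: "T n \<ge> 1" using T_ge elim(2) by linarith
    let ?L = "C + a * f n"
    define p where "p = S.prob {\<omega>. walk \<omega> (T n) \<le> ?L + c}"
    have p: "0 \<le> p" "p \<le> real n powr (- \<delta> / 4)"
    proof -
      show "0 \<le> p" by (simp add: p_def)
      have "?L + c \<le> 2 * a * f n" using elim(1) by simp
      also have "\<dots> \<le> m / 2 * real (T n)"
        using T_ge pos by (simp add: field_simps)
      finally have "?L + c \<le> m / 2 * real (T n)" .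
      then have "p \<le> S.prob {\<omega>. walk \<omega> (T n) \<le> m / 2 * real (T n)}"
        unfolding p_def
      proof (intro S.finite_measure_mono)
        have "Measurable.pred S (\<lambda>\<omega>. walk \<omega> (T n) \<le> m / 2 * real (T n))" by measurable
        then show "{\<omega>. walk \<omega> (T n) \<le> m / 2 * real (T n)} \<in> sets S" by (simp add: pred_def)
      qed auto
      also have "\<dots> \<le> D * real (T n) powr (- \<delta>)"
        by (rule D(2)[OF T1])
      also have "\<dots> \<le> D * (4 * a / m * f n) powr (- \<delta>)"
        using D(1) T_ge elim(2) pos by (intro mult_left_mono powr_mono2') auto
      also have "\<dots> \<le> real n powr (- \<delta> / 4)" by (rule elim(3))
      finally show "p \<le> real n powr (- \<delta> / 4)" .
    qed
    \<comment> \<open>Rounding down loses one block, which accounts for the term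
      \<open>(\<alpha> - 1) / 4 * ln n\<close> in the result.\<close>
    have div_ge: "m / (8 * a) * (real n / f n) - 1 \<le> real (n div T n)"
    proof -
      have "real n / (8 * a / m * f n) \<le> real n / real (T n)"
        using T_le T1 pos fpos by (intro divide_left_mono mult_pos_pos divide_pos_pos) auto
      moreover have "real n / (8 * a / m * f n) = m / (8 * a) * (real n / f n)"
        using pos fpos by (simp add: field_simps)
      moreover have "real n / real (T n) - 1 \<le> real (n div T n)"
        using floor_divide_of_nat_eq[of n "T n", where ?'a = real] by linarith
      ultimately show ?thesis by linarith
    qed
    have "p ^ (n div T n) \<le> (real n powr (- \<delta> / 4)) ^ (n div T n)"
      using p by (intro power_mono) auto
    also have "\<dots> = exp (- (\<delta> / 4 * ln (real n) * real (n div T n)))"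
      using elim(4) by (simp add: powr_def mult_ac flip: exp_of_nat_mult)
    also have "\<dots> \<le> exp (- (\<delta> / 4 * ln (real n) * (m / (8 * a) * (real n / f n) - 1)))"
      using div_ge pos lnpos by (simp add: mult_left_mono)
    also have "\<delta> / 4 * ln (real n) * (m / (8 * a) * (real n / f n) - 1) = 2 * t * a * f n - \<delta> / 4 * ln (real n)"
    proof -
      have "ln (real n) * (real n / f n) = f n"
        using f2 fpos by (simp add: field_simps)
      moreover have "\<delta> * m = 64 * t * (a * a)"
        using a2 t_pos by (simp add: field_simps)
      moreover have "\<delta> / 4 * ln (real n) * (m / (8 * a) * (real n / f n) - 1)
          = (\<delta> * m) / (32 * a) * (ln (real n) * (real n / f n)) - \<delta> / 4 * ln (real n)"
        by (simp add: field_simps)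
      ultimately show ?thesis using pos by simp
    qed
    finally have pow: "p ^ (n div T n) \<le> exp (- (2 * t * a * f n - \<delta> / 4 * ln (real n)))" .
    have "W n (\<lambda>k. C + a * f k) 0 \<le> exp (- t * c) + exp (t * ?L) * p ^ (n div T n)"
      unfolding p_def
    proof (rule W_le_power)
      show "C + a * f k \<le> ?L" if "k \<le> n" for k
        using f_mono[OF that] pos by simp
    qed
    also have "\<dots> \<le> exp (- t * c) + exp (t * ?L) * exp (- (2 * t * a * f n - \<delta> / 4 * ln (real n)))"
      using pow by simp
    also have "exp (t * ?L) * exp (- (2 * t * a * f n - \<delta> / 4 * ln (real n)))
        = exp (t * C - t * a * f n + \<delta> / 4 * ln (real n))"
      by (simp add: algebra_simps flip: exp_add)
    finally show ?case by (simp add: f_def a_def \<delta>_def)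
  qed
qed

lemma W_tendsto_0:
  assumes C: "0 \<le> C"
  shows "(\<lambda>n. W n (\<lambda>k. C + rate * sqrt (real k * ln (real k))) 0) \<longlonglongrightarrow> 0"
proof (rule LIMSEQ_I)
  fix \<epsilon> :: real assume \<epsilon>: "\<epsilon> > 0"
  define c where "c = max 0 (- ln (\<epsilon> / 2) / t)"
  have "- ln (\<epsilon> / 2) / t \<le> c" by (simp add: c_def)
  then have "- t * c \<le> ln (\<epsilon> / 2)" using t_pos by (simp add: field_simps)
  then have c: "0 \<le> c" "exp (- t * c) \<le> \<epsilon> / 2"
    using \<epsilon> by (auto simp: c_def ln_ge_iff)
  define u v where "u = t * rate" and "v = (\<alpha> - 1) / 4"
  have u: "u > 0" using t_pos rate_pos by (simp add: u_def)
  have "(\<lambda>n. exp (t * C - u * sqrt (real n * ln (real n)) + v * ln (real n))) \<longlonglongrightarrow> 0"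
    using u by real_asymp
  then have "\<forall>\<^sub>F n in sequentially. exp (t * C - u * sqrt (real n * ln (real n)) + v * ln (real n)) < \<epsilon> / 2"
    by (rule order_tendstoD) (use \<epsilon> in simp)
  with W_tendsto_bound[OF C c(1)]
  have "\<forall>\<^sub>F n in sequentially. norm (W n (\<lambda>k. C + rate * sqrt (real k * ln (real k))) 0 - 0) < \<epsilon>"
  proof eventually_elim
    case (elim n)
    then show ?case using c(2) unfolding u_def v_def by simp
  qed
  then show "\<exists>N. \<forall>n\<ge>N. norm (W n (\<lambda>k. C + rate * sqrt (real k * ln (real k))) 0 - 0) < \<epsilon>"
    by (simp add: eventually_sequentially)
qed

end

section \<open>Cycles of climbing and jumping back\<close>

lemma sqrt_x_ln_x_mono: "1 \<le> x \<Longrightarrow> (x :: real) \<le> y \<Longrightarrow> sqrt (x * ln x) \<le> sqrt (y * ln y)"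
  by (intro real_sqrt_le_mono mult_mono) auto

locale jump_law = walk_law +
  fixes \<alpha>2 :: real
  assumes \<alpha>2_pos: "0 < \<alpha>2"
    and jumps: "\<forall>\<^sub>F y in at_top. exp (- t * y) * y powr (- \<alpha>2)
      \<le> prob {p. \<exists>i. enat i < fst p \<and> snd p i \<le> - y}"
begin

text \<open>
  One cycle: climb for \<open>r\<close> generations, then jump back.  At height \<open>y\<close> there are about
  \<open>exp (t y)\<close> particles, each of which jumps down to height \<open>\<gamma> ln r\<close> with probability at least
  \<open>exp (- t y)\<close>; this is where \<open>\<gamma>\<close> comes from.
\<close>

definition \<gamma> :: real where "\<gamma> = (\<alpha>2 + 1) / t"

lemma \<gamma>_pos: "\<gamma> > 0"
  using t_pos \<alpha>2_pos by (simp add: \<gamma>_def)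

text \<open>The same \<open>q\<close> stands in hypothesis and conclusion, so cycles can be chained
  without loss. From height \<open>y\<close> after the climb, a jump to
  \<open>\<gamma> * ln r\<close> followed by a success of probability \<open>q\<close> has
  probability at least \<open>exp (- t * y)\<close>; \<open>W_ge_good\<close> then returns the lower
  bound of \<open>good\<close>, which is again \<open>q\<close>.\<close>

lemma cycle_step:
  "\<exists>q>0. \<exists>K\<ge>1. \<exists>R\<ge>1. q \<le> 1 \<and> (\<forall>r\<ge>R. \<forall>b n. (\<forall>k\<le>r. K * real r \<le> b k) \<longrightarrow>
    q \<le> W n (\<lambda>k. b (Suc r + k)) (\<gamma> * ln (real r)) \<longrightarrow> q \<le> W (n + Suc r) b 0)"
proof -
  obtain q K where q: "q > 0" and K: "K \<ge> 1"
    and good: "\<forall>\<^sub>F r in sequentially. ennreal q \<le> good (drift / 2 * real r) (K * real r) r 0"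
    using good_lower_bound by blast
  obtain y0 where y0: "\<And>y. y \<ge> y0 \<Longrightarrow> exp (- t * y) * y powr (- \<alpha>2)
      \<le> prob {p. \<exists>i. enat i < fst p \<and> snd p i \<le> - y}"
    using jumps by (auto simp: eventually_at_top_linorder)
  define d where "d = drift"
  have d: "d > 0" by (simp add: d_def)
  have ev1: "\<forall>\<^sub>F r in sequentially. max y0 1 \<le> d / 2 * real r - \<gamma> * ln (real r)"
    using d \<gamma>_pos by real_asymp
  have qK: "q * K powr (- \<alpha>2) > 0" using q K by simp
  have ev2: "\<forall>\<^sub>F r in sequentially. 1 \<le> (q * K powr (- \<alpha>2)) * real r"
    using qK by real_asymp
  obtain R where R: "\<And>r. r \<ge> R \<Longrightarrow> ennreal q \<le> good (d / 2 * real r) (K * real r) r 0"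
    "\<And>r. r \<ge> R \<Longrightarrow> max y0 1 \<le> d / 2 * real r - \<gamma> * ln (real r)"
    "\<And>r. r \<ge> R \<Longrightarrow> 1 \<le> (q * K powr (- \<alpha>2)) * real r"
    using eventually_conj[OF good[folded d_def] eventually_conj[OF ev1 ev2]]
    by (auto simp: eventually_sequentially)
  have "ennreal q \<le> 1" using R(1)[of R] good_le_1 order_trans by blast
  then have q1: "q \<le> 1" by (simp add: ennreal_le_1)
  have "q \<le> W (n + Suc r) b 0"
    if r: "r \<ge> max R 1" and b: "\<And>k. k \<le> r \<Longrightarrow> K * real r \<le> b k"
      and next_ge: "q \<le> W n (\<lambda>k. b (Suc r + k)) (\<gamma> * ln (real r))" for r b n
  proof -
    let ?z = "\<gamma> * ln (real r)"
    have r1: "r \<ge> R" "r \<ge> 1" using r by auto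
    have z: "0 \<le> ?z" using r1 \<gamma>_pos by simp
    have "ennreal (exp (- t * 0)) * good (d / 2 * real r) (K * real r) r 0 \<le> ennreal (W (Suc n + r) b 0)"
    proof (rule W_ge_good)
      fix y assume y: "d / 2 * real r \<le> y" "y \<le> K * real r"
      have yz: "max y0 1 \<le> y - ?z" using R(2)[OF r1(1)] y by linarith
      \<comment> \<open>Here \<open>exp (t * ?z)\<close> equals
        \<open>r powr (\<alpha>2 + 1)\<close>: the power \<open>\<alpha>2\<close> offsets the
        polynomial factor of the jump tail at distances up to \<open>K * r\<close>, and the spare
        factor \<open>r\<close> offsets the constant
        \<open>q * K powr (- \<alpha>2)\<close>.\<close>
      have "exp (- t * y) \<le> q * (exp (- t * (y - ?z)) * (y - ?z) powr (- \<alpha>2))"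
      proof -
        have "1 \<le> q * K powr (- \<alpha>2) * real r" by (rule R(3)[OF r1(1)])
        also have "\<dots> = q * (exp (t * ?z) * (K * real r) powr (- \<alpha>2))"
        proof -
          have "exp (t * ?z) = real r powr (\<alpha>2 + 1)"
            using r1 t_pos by (simp add: \<gamma>_def powr_def)
          moreover have "(K * real r) powr (- \<alpha>2) = K powr (- \<alpha>2) * real r powr (- \<alpha>2)"
            using K by (simp add: powr_mult)
          moreover have "real r powr (\<alpha>2 + 1) * real r powr (- \<alpha>2) = real r"
            using r1 by (simp flip: powr_add)
          ultimately show ?thesis by (simp add: mult_ac)
        qed
        also have "\<dots> \<le> q * (exp (t * ?z) * (y - ?z) powr (- \<alpha>2))"
          using q y z yz \<alpha>2_pos by (intro mult_left_mono powr_mono2') auto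
        finally have "exp (- t * y) * 1 \<le> exp (- t * y) * (q * (exp (t * ?z) * (y - ?z) powr (- \<alpha>2)))"
          by (intro mult_left_mono) auto
        also have "\<dots> = q * (exp (- t * y) * exp (t * ?z) * (y - ?z) powr (- \<alpha>2))"
          by (simp add: mult_ac)
        also have "exp (- t * y) * exp (t * ?z) = exp (- t * (y - ?z))"
          by (simp add: algebra_simps flip: exp_add)
        finally show ?thesis by simp
      qed
      also have "\<dots> \<le> q * prob {p. \<exists>i. enat i < fst p \<and> snd p i \<le> - (y - ?z)}"
        using q yz by (intro mult_left_mono y0) auto
      also have "\<dots> = q * prob {p. \<exists>i. enat i < fst p \<and> snd p i \<le> ?z - y}"
        by simp
      also have "\<dots> \<le> W (Suc n) (\<lambda>k. b (r + k)) y"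
      proof (rule W_Suc_ge_jump)
        show "y \<le> b (r + 0)" using y b[of r] by simp
        show "q \<le> W n (\<lambda>k. b (r + Suc k)) ?z" using next_ge by simp
      qed (use q in simp)
      finally show "exp (- t * y) \<le> W (Suc n) (\<lambda>k. b (r + k)) y" .
    qed (rule b)
    then have "ennreal q \<le> ennreal (W (Suc n + r) b 0)"
      using R(1)[OF r1(1)] by (simp add: order_trans)
    then show ?thesis by (simp add: ennreal_le_iff)
  qed
  then show ?thesis
    using q K q1 by (intro exI[of _ q] exI[of _ K] exI[of _ "max R 1"] conjI) auto
qed

text \<open>Cycle \<open>j\<close> starts at generation \<open>N j\<close> from height at most
  \<open>Z j\<close> and takes \<open>T j\<close> generations of climbing and one for the jump.
  Since \<open>step\<close> deduces the bound for a cycle from its future, the induction on the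
  number of cycles ranges over all starting indices, and \<open>W_shift\<close> moves each start to
  height 0.\<close>

lemma W_lower_bound_cycles:
  fixes T N :: "nat \<Rightarrow> nat" and Z b :: "nat \<Rightarrow> real"
  assumes q: "0 < q" "q \<le> 1" and K: "0 \<le> K"
    and step: "\<And>r b n. r \<ge> R \<Longrightarrow> (\<And>k. k \<le> r \<Longrightarrow> K * real r \<le> b k) \<Longrightarrow>
      q \<le> W n (\<lambda>k. b (Suc r + k)) (\<gamma> * ln (real r)) \<Longrightarrow> q \<le> W (n + Suc r) b 0"
    and T: "\<And>j. T j \<ge> R"
    and N: "\<And>j. N j = (\<Sum>i<j. Suc (T i))" and Z: "\<And>j. Z j = \<gamma> * (\<Sum>i<j. ln (real (T i)))"
    and b: "\<And>j k. N j \<le> k \<Longrightarrow> Z j + K * real (T j) \<le> b k"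
  shows "q \<le> W n b 0"
proof -
  have N_Suc: "N (Suc j) = N j + Suc (T j)" for j by (simp add: N)
  have Z_Suc: "Z (Suc j) = Z j + \<gamma> * ln (real (T j))" for j by (simp add: Z distrib_left)
  have N_le: "N i \<le> N j" if "i \<le> j" for i j
    using that by (induction rule: dec_induct) (auto simp: N_Suc)
  have main: "q \<le> W (N (j + l) - N j) (\<lambda>k. b (N j + k)) (Z j)" for l j
  proof (induction l arbitrary: j)
    case 0
    have "Z j \<le> Z j + K * real (T j)" using K by simp
    also have "\<dots> \<le> b (N j)" by (rule b) simp
    finally show ?case using q by (simp add: W_0)
  next
    case (Suc l)
    let ?n = "N (Suc j + l) - N (Suc j)" and ?b = "\<lambda>k. b (N j + k) - Z j"
    have "q \<le> W ?n (\<lambda>k. b (N (Suc j) + k)) (Z (Suc j))" by (rule Suc.IH)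
    also have "\<dots> = W ?n (\<lambda>k. ?b (Suc (T j) + k)) (\<gamma> * ln (real (T j)))"
      using W_shift[of ?n "\<lambda>k. b (N (Suc j) + k)" "- Z j" "Z (Suc j)"]
      by (simp add: Z_Suc N_Suc add.assoc)
    finally have "q \<le> W (?n + Suc (T j)) ?b 0"
    proof (intro step T)
      fix k assume "k \<le> T j"
      show "K * real (T j) \<le> b (N j + k) - Z j"
        using b[of j "N j + k"] by simp
    qed
    moreover have "?n + Suc (T j) = N (j + Suc l) - N j"
      using N_le[of "Suc j" "Suc j + l"] by (simp add: N_Suc)
    ultimately show ?case
      using W_shift[of "N (j + Suc l) - N j" "?b" "Z j" 0] by simp
  qed
  have "n \<le> N n"
    by (induction n) (auto simp: N)
  then have "W (N n) b 0 \<le> W n b 0" by (rule W_le)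
  moreover have "q \<le> W (N n) b 0" using main[of 0 n] by (simp add: N Z)
  ultimately show ?thesis by linarith
qed

lemma W_lower_bound:
  "\<exists>C\<ge>0. \<exists>a>0. \<exists>q>0. \<forall>n. q \<le> W n (\<lambda>k. C + a * sqrt (real k * ln (real k))) 0"
proof -
  obtain q K R where qKR: "q > 0" "q \<le> 1" "K \<ge> 1" "R \<ge> 1"
    and step: "\<And>r b n. r \<ge> R \<Longrightarrow> (\<And>k. k \<le> r \<Longrightarrow> K * real r \<le> b k) \<Longrightarrow>
      q \<le> W n (\<lambda>k. b (Suc r + k)) (\<gamma> * ln (real r)) \<Longrightarrow> q \<le> W (n + Suc r) b 0"
    using cycle_step by blast
  \<comment> \<open>With this choice \<open>Z j\<close>, \<open>T j\<close> and \<open>sqrt (N j * ln (N j))\<close> are all of order \<open>j ln j\<close>.\<close>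
  define T where "T j = R + nat \<lceil>real j * ln (real j)\<rceil>" for j
  define N where "N j = (\<Sum>i<j. Suc (T i))" for j
  define Z where "Z j = \<gamma> * (\<Sum>i<j. ln (real (T i)))" for j
  have T_ge: "T j \<ge> R" for j by (simp add: T_def)
  have T_mono: "T i \<le> T j" if "i \<le> j" for i j
  proof -
    have "real i * ln (real i) \<le> real j * ln (real j)"
      using that by (cases "i = 0"; cases "j = 0") (auto intro!: mult_mono)
    then show ?thesis unfolding T_def by (intro add_left_mono nat_mono ceiling_mono)
  qed
  have lnT: "0 \<le> ln (real (T j))" for j using T_ge[of j] qKR by simp
  have Z_mono: "Z i \<le> Z j" if "i \<le> j" for i j
    unfolding Z_def using that \<gamma>_pos lnT by (intro mult_left_mono sum_mono2) auto
  have N_le: "N i \<le> N j" if "i \<le> j" for i j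
    unfolding N_def using that by (intro sum_mono2) auto
  have T_upper: "real (T j) \<le> real R + 1 + real j * ln (real j)" for j
  proof -
    have "0 \<le> real j * ln (real j)" by (cases "j = 0") auto
    then show ?thesis unfolding T_def by linarith
  qed
  have T_lower: "real j * ln (real j) \<le> real (T j)" for j
    unfolding T_def by linarith
  have Z_upper: "Z j \<le> \<gamma> * (real j * ln (real (T j)))" for j
  proof -
    have "(\<Sum>i<j. ln (real (T i))) \<le> (\<Sum>i<j. ln (real (T j)))"
    proof (rule sum_mono)
      fix i assume "i \<in> {..<j}"
      then show "ln (real (T i)) \<le> ln (real (T j))"
        using T_mono[of i j] T_ge[of i] qKR by simp
    qed
    then show ?thesis using \<gamma>_pos unfolding Z_def by (intro mult_left_mono) auto
  qed
  \<comment> \<open>The later half of the cycles alone is long enough, each having at least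
    \<open>T h\<close> generations.\<close>
  have N_lower: "(real j / 3)\<^sup>2 * ln (real j / 3) \<le> real (N j)" if "j \<ge> 3" for j
  proof -
    define h where "h = j div 2"
    have h: "real j / 3 \<le> real h" "h + h \<le> j" using that unfolding h_def by linarith+
    have "(real j / 3)\<^sup>2 * ln (real j / 3) \<le> real h * (real h * ln (real h))"
      using h that unfolding power2_eq_square mult.assoc
      by (intro mult_mono mult_nonneg_nonneg) auto
    also have "\<dots> \<le> real h * real (T h)"
      using T_lower by (intro mult_left_mono) auto
    also have "\<dots> = (\<Sum>i\<in>{h..<h + h}. real (T h))" by simp
    also have "\<dots> \<le> (\<Sum>i\<in>{h..<h + h}. real (Suc (T i)))"
    proof (rule sum_mono)
      fix i assume "i \<in> {h..<h + h}"
      then have "T h \<le> T i" by (intro T_mono) auto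
      then show "real (T h) \<le> real (Suc (T i))" by simp
    qed
    also have "\<dots> \<le> (\<Sum>i<j. real (Suc (T i)))"
      using h by (intro sum_mono2) auto
    finally show ?thesis by (simp add: N_def)
  qed
  \<comment> \<open>By \<open>ev1\<close> and \<open>ev2\<close> below, \<open>Z j\<close> is at
    most \<open>2 * \<gamma>\<close> and \<open>K * T j\<close> at most \<open>2 * K\<close> times
    \<open>j * ln j\<close>.\<close>
  define A where "A = 2 * \<gamma> + 2 * K"
  have A: "A > 0" using \<gamma>_pos qKR by (simp add: A_def)
  have ev1: "\<forall>\<^sub>F j in sequentially. real R + 1 + real j * ln (real j) \<le> 2 * (real j * ln (real j))"
    by real_asymp
  have ev2: "\<forall>\<^sub>F j in sequentially. ln (real R + 1 + real j * ln (real j)) \<le> 2 * ln (real j)"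
    by real_asymp
  have "filterlim (\<lambda>j. ln (real j / 3)) at_top sequentially"
    by real_asymp
  then have ev3: "\<forall>\<^sub>F j in sequentially. 1 \<le> ln (real j / 3)"
    by (simp add: filterlim_at_top)
  have "\<forall>\<^sub>F j in sequentially. Z j + K * real (T j) \<le> 5 * A * sqrt (real (N j) * ln (real (N j)))"
    using ev1 ev2 ev3 eventually_ge_at_top[of 9]
  proof eventually_elim
    case (elim j)
    have "ln (real (T j)) \<le> ln (real R + 1 + real j * ln (real j))"
      using T_upper[of j] T_ge[of j] qKR by (subst ln_le_cancel_iff) auto
    then have "Z j \<le> \<gamma> * (real j * (2 * ln (real j)))"
      using elim(2) \<gamma>_pos by (intro order_trans[OF Z_upper] mult_left_mono) auto
    moreover have "K * real (T j) \<le> K * (2 * (real j * ln (real j)))"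
      using T_upper[of j] elim(1) qKR by (intro mult_left_mono) auto
    ultimately have "Z j + K * real (T j) \<le> A * (real j * ln (real j))"
      by (simp add: A_def algebra_simps)
    also have "\<dots> \<le> A * (5 * sqrt (real (N j) * ln (real (N j))))"
    proof (rule mult_left_mono)
      \<comment> \<open>The lower bound for \<open>N j\<close> from \<open>N_lower\<close>. For
        \<open>j \<ge> 9\<close> one has \<open>ln (j / 3) \<ge> ln j / 2\<close> and, with
        \<open>ev3\<close>, also \<open>?x \<ge> j\<close>; the factor 18 that results is below
        \<open>5\<^sup>2\<close>.\<close>
      let ?x = "(real j / 3)\<^sup>2 * ln (real j / 3)"
      have j: "real j \<le> (real j / 3)\<^sup>2"
        using elim(4) by (simp add: power2_eq_square field_simps)
      have "ln (real j) \<le> ln ((real j / 3)\<^sup>2)"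
        using j elim(4) by (subst ln_le_cancel_iff) auto
      also have "\<dots> = 2 * ln (real j / 3)"
        using elim(4) by (simp add: ln_realpow)
      finally have ln_j: "ln (real j) / 2 \<le> ln (real j / 3)" by simp
      have "real j * 1 \<le> ?x"
        using j elim(3,4) by (intro mult_mono) auto
      then have x: "real j \<le> ?x" by simp
      have "(real j / 3)\<^sup>2 * (ln (real j) / 2) * ln (real j) \<le> ?x * ln ?x"
        using ln_j x elim(3,4) by (intro mult_mono mult_left_mono mult_nonneg_nonneg) auto
      moreover have "(real j * ln (real j))\<^sup>2 = 18 * ((real j / 3)\<^sup>2 * (ln (real j) / 2) * ln (real j))"
        by (simp add: power2_eq_square)
      moreover have "0 \<le> ?x * ln ?x"
        using x elim(4) by (intro mult_nonneg_nonneg) auto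
      moreover have "u \<le> 5\<^sup>2 * w" if "v \<le> w" "u = 18 * v" "0 \<le> w" for u v w :: real
        using that by simp
      ultimately have "(real j * ln (real j))\<^sup>2 \<le> 5\<^sup>2 * (?x * ln ?x)"
        by blast
      then have "real j * ln (real j) \<le> sqrt (5\<^sup>2 * (?x * ln ?x))"
        by (rule real_le_rsqrt)
      also have "\<dots> = 5 * sqrt (?x * ln ?x)"
        by (simp only: real_sqrt_mult) simp
      also have "\<dots> \<le> 5 * sqrt (real (N j) * ln (real (N j)))"
        using elim(4) x N_lower[of j] by (intro mult_left_mono sqrt_x_ln_x_mono) auto
      finally show "real j * ln (real j) \<le> 5 * sqrt (real (N j) * ln (real (N j)))" .
    qed (use A in simp)
    finally show ?case by simp
  qed
  then obtain J where J: "\<And>j. j \<ge> J \<Longrightarrow> Z j + K * real (T j) \<le> 5 * A * sqrt (real (N j) * ln (real (N j)))"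
    by (auto simp: eventually_sequentially)
  define C where "C = Z J + K * real (T J)"
  have C: "0 \<le> C" using Z_mono[of 0 J] qKR by (simp add: C_def Z_def)
  have nonneg: "0 \<le> sqrt (real k * ln (real k))" for k by (cases "k = 0") auto
  have "q \<le> W n (\<lambda>k. C + 5 * A * sqrt (real k * ln (real k))) 0" for n
  proof (rule W_lower_bound_cycles[OF qKR(1,2) _ step T_ge N_def Z_def])
    fix j k assume k: "N j \<le> k"
    show "Z j + K * real (T j) \<le> C + 5 * A * sqrt (real k * ln (real k))"
    proof (cases "j \<ge> J")
      case False
      then have "Z j + K * real (T j) \<le> C"
        unfolding C_def using qKR T_mono[of j J] by (intro add_mono Z_mono mult_left_mono) auto
      moreover have "0 \<le> 5 * A * sqrt (real k * ln (real k))"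
        using A nonneg[of k] by (intro mult_nonneg_nonneg) auto
      ultimately show ?thesis by linarith
    next
      case True
      have "sqrt (real (N j) * ln (real (N j))) \<le> sqrt (real k * ln (real k))"
      proof (cases "N j = 0")
        case False
        then show ?thesis using k by (intro sqrt_x_ln_x_mono) auto
      qed (use nonneg[of k] in simp)
      then have "5 * A * sqrt (real (N j) * ln (real (N j))) \<le> 5 * A * sqrt (real k * ln (real k))"
        using A by (intro mult_left_mono) auto
      then show ?thesis using J[OF True] C by linarith
    qed
  qed (use qKR in auto)
  then show ?thesis using C A qKR by (intro exI[of _ C] conjI exI[of _ "5 * A"] exI[of _ q]) auto
qed

end

section \<open>Rays and barriers\<close>

text \<open>An environment serves as its own sample point: with the coordinate maps as
  reproductions, the notions of the theorem apply to environments directly.\<close>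

abbreviation (input) env_tree :: "environment \<Rightarrow> nat list set" where
  "env_tree e \<equiv> tree (\<lambda>u e. e u) e"

abbreviation (input) env_position :: "environment \<Rightarrow> nat list \<Rightarrow> real" where
  "env_position e \<equiv> position (\<lambda>u e. e u) e"

abbreviation (input) env_rays :: "environment \<Rightarrow> (nat \<Rightarrow> nat list) set" where
  "env_rays e \<equiv> infinite_rays (\<lambda>u e. e u) e"

lemma tree_Cons: "i # v \<in> env_tree e \<longleftrightarrow> enat i < fst (e []) \<and> v \<in> env_tree (subenv i e)"
proof -
  have "(\<forall>k<length (i # v). enat ((i # v) ! k) < fst (e (take k (i # v))))
      \<longleftrightarrow> enat i < fst (e []) \<and> (\<forall>k<length v. enat (v ! k) < fst (e (i # take k v)))"
    by (simp add: All_less_Suc2)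
  then show ?thesis by (simp add: tree_def subenv_def)
qed

lemma position_Cons:
  "env_position e (i # v) = snd (e []) i + env_position (subenv i e) v"
  unfolding position_def by (subst length_Cons, subst sum.lessThan_Suc_shift) (simp add: subenv_def)

lemma below_iff:
  "below n b x e \<longleftrightarrow> (\<exists>u\<in>env_tree e. length u = n \<and>
    (\<forall>k\<le>n. x + env_position e (take k u) \<le> b k))"
proof (induction n arbitrary: b x e)
  case 0
  show ?case by (auto simp: position_Nil tree_Nil)
next
  case (Suc n)
  have "below (Suc n) b x e \<longleftrightarrow> x \<le> b 0 \<and> (\<exists>i v. enat i < fst (e []) \<and> v \<in> env_tree (subenv i e) \<and>
      length v = n \<and> (\<forall>k\<le>n. x + snd (e []) i + env_position (subenv i e) (take k v) \<le> b (Suc k)))"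
    unfolding below.simps Suc.IH by blast
  also have "\<dots> \<longleftrightarrow> (\<exists>i v. i # v \<in> env_tree e \<and> length (i # v) = Suc n \<and>
      (\<forall>k\<le>Suc n. x + env_position e (take k (i # v)) \<le> b k))"
    unfolding all_le_Suc_split tree_Cons by (auto simp: position_Nil position_Cons add.assoc)
  also have "\<dots> \<longleftrightarrow> (\<exists>u\<in>env_tree e. length u = Suc n \<and>
      (\<forall>k\<le>Suc n. x + env_position e (take k u) \<le> b k))" (is "?L \<longleftrightarrow> ?R")
  proof
    assume ?R
    then obtain u where u: "u \<in> env_tree e" "length u = Suc n"
      "\<forall>k\<le>Suc n. x + env_position e (take k u) \<le> b k" by blast
    moreover obtain i v where "u = i # v" using u(2) by (cases u) auto
    ultimately show ?L by blast
  qed blast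
  finally show ?case .
qed

section \<open>Slow environments: inheritance from a child, and Koenig's lemma\<close>

definition barrier :: "real \<Rightarrow> real \<Rightarrow> nat \<Rightarrow> real" where
  "barrier a C k = C + a * sqrt (real k * ln (real k))"

lemma sqrt_nat_ln_nonneg: "0 \<le> sqrt (real k * ln (real k))"
  by (cases "k = 0") auto

lemma barrier_mono: "a \<le> a' \<Longrightarrow> C \<le> C' \<Longrightarrow> barrier a C k \<le> barrier a' C' k"
  unfolding barrier_def using sqrt_nat_ln_nonneg by (intro add_mono mult_right_mono)

lemma sqrt_nat_ln_mono: "k \<le> n \<Longrightarrow> sqrt (real k * ln (real k)) \<le> sqrt (real n * ln (real n))"
proof (cases "k = 0")
  case False
  then show "k \<le> n \<Longrightarrow> ?thesis" by (intro sqrt_x_ln_x_mono) auto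
qed (use sqrt_nat_ln_nonneg[of n] in simp)

text \<open>Integer constants make the event a countable union; by \<open>slowI\<close>, real ones
  give nothing more.\<close>

definition slow :: "real \<Rightarrow> environment \<Rightarrow> bool" where
  "slow a e \<longleftrightarrow> (\<exists>C::nat. \<forall>n. below n (barrier a (real C)) 0 e)"

lemma slowI:
  assumes "\<And>n. below n (barrier a C) 0 e"
  shows "slow a e"
proof -
  have "below n (barrier a (real (nat \<lceil>C\<rceil>))) 0 e" for n
    by (rule below_mono_barrier[OF assms]) (intro barrier_mono order_refl real_nat_ceiling_ge)
  then show ?thesis unfolding slow_def by blast
qed

lemma slow_mono: "slow a e \<Longrightarrow> a \<le> a' \<Longrightarrow> slow a' e"
  unfolding slow_def by (blast intro: below_mono_barrier barrier_mono[OF _ order_refl])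

text \<open>The free constant absorbs the displacement of the child, and for
  \<open>a \<ge> 0\<close> the barrier is nondecreasing, so reading it one generation later does no
  harm. The maximum with 0 lets the root itself pass.\<close>

lemma slow_of_child:
  assumes "0 \<le> a" and i: "enat i < fst (e [])" and "slow a (subenv i e)"
  shows "slow a e"
proof -
  obtain C :: nat where C: "\<And>n. below n (barrier a (real C)) 0 (subenv i e)"
    using assms(3) by (auto simp: slow_def)
  define C' where "C' = max 0 (real C + snd (e []) i)"
  have "below n (barrier a C') 0 e" for n
  proof (cases n)
    case 0
    then show ?thesis by (simp add: barrier_def C'_def)
  next
    case (Suc m)
    have "below m (\<lambda>k. barrier a (real C) k + snd (e []) i) (0 + snd (e []) i) (subenv i e)"
      unfolding below_shift by (rule C)
    moreover have "barrier a (real C) k + snd (e []) i \<le> barrier a C' (Suc k)" for k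
      using mult_left_mono[OF sqrt_nat_ln_mono[of k "Suc k"] \<open>0 \<le> a\<close>]
      unfolding barrier_def C'_def by linarith
    ultimately have "below m (\<lambda>k. barrier a C' (Suc k)) (0 + snd (e []) i) (subenv i e)"
      by (rule below_mono_barrier)
    then show ?thesis
      using i Suc by (auto simp: barrier_def C'_def)
  qed
  then show ?thesis by (rule slowI)
qed

lemma infinite_tree_of_slow:
  assumes "slow a e"
  shows "infinite (env_tree e)"
proof
  assume fin: "finite (env_tree e)"
  define n where "n = Suc (Max (length ` env_tree e))"
  obtain C :: nat where "below n (barrier a (real C)) 0 e"
    using assms by (auto simp: slow_def)
  then obtain u where u: "u \<in> env_tree e" "length u = n"
    unfolding below_iff by blast
  have "length u \<le> Max (length ` env_tree e)"
    using fin u by (intro Max_ge) auto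
  with u show False by (simp add: n_def)
qed

lemma finite_tree_of_children:
  assumes "fst (e []) = enat k" and "\<And>i. i < k \<Longrightarrow> finite (env_tree (subenv i e))"
  shows "finite (env_tree e)"
proof -
  have "env_tree e \<subseteq> insert [] (\<Union>i<k. Cons i ` env_tree (subenv i e))"
  proof
    fix u assume "u \<in> env_tree e"
    then show "u \<in> insert [] (\<Union>i<k. Cons i ` env_tree (subenv i e))"
      using assms(1) by (cases u) (auto simp: tree_Cons)
  qed
  then show ?thesis
    by (rule finite_subset) (use assms(2) in auto)
qed

definition locally_finite :: "environment \<Rightarrow> bool" where
  "locally_finite e \<longleftrightarrow> (\<forall>u c. finite {i. enat i < fst (e u) \<and> snd (e u) i \<le> c})"

text \<open>Only the finitely many children at or below \<open>b 1\<close> can carry a path. If each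
  of them failed at some length, none would carry a path as long as the sum of these
  lengths.\<close>

lemma below_child:
  assumes fin: "finite {i. enat i < fst (e []) \<and> snd (e []) i \<le> b 1 - x}"
    and below: "\<And>n. below n b x e"
  shows "\<exists>i. enat i < fst (e []) \<and> (\<forall>n. below n (\<lambda>k. b (Suc k)) (x + snd (e []) i) (subenv i e))"
proof (rule ccontr)
  let ?I = "{i. enat i < fst (e []) \<and> snd (e []) i \<le> b 1 - x}"
  assume "\<not> ?thesis"
  then have "\<forall>i. \<exists>n. enat i < fst (e []) \<longrightarrow> \<not> below n (\<lambda>k. b (Suc k)) (x + snd (e []) i) (subenv i e)"
    by blast
  then obtain n where n: "\<And>i. enat i < fst (e []) \<Longrightarrow>
      \<not> below (n i) (\<lambda>k. b (Suc k)) (x + snd (e []) i) (subenv i e)"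
    by metis
  define m where "m = (\<Sum>i\<in>?I. n i)"
  from below[of "Suc m"] obtain i where i: "enat i < fst (e [])"
    "below m (\<lambda>k. b (Suc k)) (x + snd (e []) i) (subenv i e)"
    by auto
  have "x + snd (e []) i \<le> b 1"
    using below_le[OF i(2), of 0] by simp
  then have "i \<in> ?I" using i by auto
  then have "n i \<le> m" unfolding m_def using fin by (intro member_le_sum) auto
  with below_le[OF i(2)] n[OF i(1)] show False by blast
qed

lemma ray_below:
  assumes lf: "locally_finite e" and below: "\<And>n. below n b x e"
  shows "\<exists>\<xi>\<in>env_rays e. \<forall>n. x + env_position e (\<xi> n) \<le> b n"
proof -
  let ?V = "env_position e"
  define G where "G u \<longleftrightarrow> u \<in> env_tree e \<and>
    (\<forall>n. below n (\<lambda>k. b (length u + k)) (x + ?V u) (\<lambda>v. e (u @ v)))" for u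
  have "\<exists>\<xi>. \<forall>n. (G (\<xi> n) \<and> length (\<xi> n) = n) \<and> (\<exists>i. \<xi> (Suc n) = \<xi> n @ [i])"
  proof (rule dependent_nat_choice)
    show "\<exists>u. G u \<and> length u = 0"
      using below by (auto simp: G_def tree_Nil position_Nil)
  next
    fix u n assume u: "G u \<and> length u = n"
    then have "\<And>n. below n (\<lambda>k. b (length u + k)) (x + ?V u) (\<lambda>v. e (u @ v))"
      by (auto simp: G_def)
    then obtain i where i: "enat i < fst (e u)"
      "\<And>n. below n (\<lambda>k. b (length u + Suc k)) (x + ?V u + snd (e u) i) (subenv i (\<lambda>v. e (u @ v)))"
      using below_child[of "\<lambda>v. e (u @ v)" "\<lambda>k. b (length u + k)" "x + ?V u"] lf
      by (auto simp: locally_finite_def)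
    have "G (u @ [i])"
      using i u by (auto simp: G_def tree_snoc position_snoc subenv_def add.assoc)
    then show "\<exists>w. (G w \<and> length w = Suc n) \<and> (\<exists>i. w = u @ [i])"
      using u by auto
  qed
  then obtain \<xi> where \<xi>: "\<And>n. G (\<xi> n)" "\<And>n. length (\<xi> n) = n" "\<And>n. \<exists>i. \<xi> (Suc n) = \<xi> n @ [i]"
    by blast
  have "x + ?V (\<xi> n) \<le> b n" for n
    using \<xi>(1)[of n] \<xi>(2)[of n] unfolding G_def by (auto dest: spec[of _ 0])
  moreover have "\<xi> 0 = []"
    using \<xi>(2)[of 0] by (simp only: length_0_conv)
  then have "\<xi> \<in> env_rays e"
    using \<xi> by (auto simp: infinite_rays_def G_def)
  ultimately show ?thesis by blast
qed

lemma below_of_ray: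
  assumes \<xi>: "\<xi> \<in> env_rays e"
    and le: "\<And>n. x + env_position e (\<xi> n) \<le> b n"
  shows "below n b x e"
proof -
  have len: "length (\<xi> n) = n" for n
    by (induction n) (use \<xi> in \<open>auto simp: infinite_rays_def\<close>, metis length_append_singleton)
  have take: "take k (\<xi> n) = \<xi> k" if "k \<le> n" for k n
    using that
  proof (induction n)
    case (Suc n)
    obtain i where "\<xi> (Suc n) = \<xi> n @ [i]" using \<xi> by (auto simp: infinite_rays_def)
    then show ?case using Suc len[of n] len[of "Suc n"] by (cases "k = Suc n") auto
  qed (use len[of 0] in auto)
  show ?thesis
    unfolding below_iff using \<xi> len take le
    by (intro bexI[of _ "\<xi> n"]) (auto simp: infinite_rays_def)
qed

text \<open>Convexity of the \<open>k\<close>-th power between \<open>q\<close> and 1, strict for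
  \<open>k \<ge> 2\<close>. By the identity \<open>diff\<close>, raising the exponent from
  \<open>k\<close> to \<open>Suc k\<close> opens the gap
  \<open>l * (1 - l) * (1 - q) * (1 - q ^ k)\<close>, which is positive for
  \<open>k \<ge> 1\<close>.\<close>

lemma power_convex_combination:
  fixes q l :: real
  assumes q: "0 \<le> q" "q < 1" and l: "0 < l" "l < 1"
  shows "((1 - l) * q + l) ^ k \<le> (1 - l) * q ^ k + l"
    and "2 \<le> k \<Longrightarrow> ((1 - l) * q + l) ^ k < (1 - l) * q ^ k + l"
proof -
  define s where "s = (1 - l) * q + l"
  have s: "0 \<le> s" using q l by (simp add: s_def)
  have diff: "s * ((1 - l) * q ^ k + l) = (1 - l) * q ^ Suc k + l - l * (1 - l) * (1 - q) * (1 - q ^ k)" for k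
    by (simp add: s_def algebra_simps)
  have le: "s ^ k \<le> (1 - l) * q ^ k + l" for k
  proof (induction k)
    case (Suc k)
    have "s ^ Suc k \<le> s * ((1 - l) * q ^ k + l)"
      using Suc s by (simp add: mult_left_mono)
    moreover have "0 \<le> l * (1 - l) * (1 - q) * (1 - q ^ k)"
      using q l power_le_one[of q k] by (intro mult_nonneg_nonneg) auto
    ultimately show ?case unfolding diff by linarith
  qed simp
  then show "((1 - l) * q + l) ^ k \<le> (1 - l) * q ^ k + l" by (simp add: s_def)
  assume "2 \<le> k"
  then obtain j where j: "k = Suc j" "j > 0" by (cases k) auto
  have "s ^ Suc j \<le> s * ((1 - l) * q ^ j + l)"
    using le[of j] s by (simp add: mult_left_mono)
  moreover have "0 < l * (1 - l) * (1 - q) * (1 - q ^ j)"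
    using q l j power_strict_mono[of q 1 j] by (intro mult_pos_pos) auto
  ultimately show "((1 - l) * q + l) ^ k < (1 - l) * q ^ k + l"
    unfolding s_def[symmetric] j diff by linarith
qed

section \<open>Zero-one law\<close>

text \<open>The integrand of the generating function. The value 0 at infinity is the limit of
  \<open>s ^ k\<close> for \<open>s < 1\<close>; for the event of a finite tree it is right at
  \<open>s = 1\<close> too, because an infinite family makes the tree infinite.\<close>

definition enat_power :: "real \<Rightarrow> enat \<Rightarrow> real" where
  "enat_power s N = (case N of enat k \<Rightarrow> s ^ k | \<infinity> \<Rightarrow> 0)"

lemma enat_power_nonneg: "0 \<le> s \<Longrightarrow> 0 \<le> enat_power s N"
  and enat_power_le_1: "0 \<le> s \<Longrightarrow> s \<le> 1 \<Longrightarrow> enat_power s N \<le> 1"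
  by (auto simp: enat_power_def power_le_one split: enat.split)

lemma prod_if_less_enat:
  fixes s :: real
  shows "(\<Prod>i<m. if enat i < N then s else 1) = (case N of enat k \<Rightarrow> s ^ min m k | \<infinity> \<Rightarrow> s ^ m)"
proof (cases N)
  case (enat k)
  have "(\<Prod>i<m. if enat i < N then s else 1) = (\<Prod>i\<in>{..<m} \<inter> {i. i < k}. s)"
    unfolding enat by (subst prod.inter_restrict) auto
  also have "{..<m} \<inter> {i. i < k} = {..<min m k}" by auto
  finally show ?thesis using enat by simp
qed simp

context offspring_law
begin

lemma measurable_enat_power [measurable]: "(\<lambda>p. enat_power s (fst p)) \<in> borel_measurable P"
  by (rule measurable_compose[of fst P "count_space UNIV"]) measurable

lemma pred_slow [measurable]: "Measurable.pred E (slow a)"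
  unfolding slow_def[abs_def] by measurable

lemma pred_number [measurable]: "Measurable.pred E (\<lambda>e. enat i < fst (e u))"
  by (rule measurable_compose[OF measurable_E_component, where g = "\<lambda>p. enat i < fst p"]) measurable

lemma pred_finite_tree [measurable]: "Measurable.pred E (\<lambda>e. finite (env_tree e))"
proof -
  have "finite (env_tree e) \<longleftrightarrow> (\<exists>us. \<forall>u. u \<in> env_tree e \<longrightarrow> u \<in> set us)"
    for e :: environment
    by (metis List.finite_set finite_list finite_subset subsetI)
  moreover have "Measurable.pred E (\<lambda>e. u \<in> env_tree e)" for u
    unfolding tree_def by simp measurable
  then have "Measurable.pred E (\<lambda>e. \<exists>us. \<forall>u. u \<in> env_tree e \<longrightarrow> u \<in> set us)"
    by measurable
  ultimately show ?thesis by simp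
qed

text \<open>If the root is not slow, then by \<open>slow_of_child\<close> no child is; hence
  \<open>s \<le> f s\<close> for the generating function \<open>f\<close>. Independence handles the
  first \<open>m\<close> children, dominated convergence the limit in \<open>m\<close>, where
  \<open>s < 1\<close> settles infinite families.\<close>

lemma prob_not_slow_le:
  assumes a: "0 \<le> a" and lt: "E.prob {e. \<not> slow a e} < 1"
  shows "E.prob {e. \<not> slow a e} \<le> (\<integral>p. enat_power (E.prob {e. \<not> slow a e}) (fst p) \<partial>P)"
proof -
  define s where "s = E.prob {e. \<not> slow a e}"
  have s: "0 \<le> s" "s < 1" using lt by (auto simp: s_def)
  let ?f = "\<lambda>m p. \<Prod>i<m. if enat i < fst p then s else 1"
  have f_meas [measurable]: "?f m \<in> borel_measurable P" for m by measurable
  have f01: "0 \<le> ?f m p \<and> ?f m p \<le> 1" for m and p :: offspring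
    using s by (auto intro!: prod_nonneg prod_le_1)
  have Q [measurable]: "Measurable.pred (P \<Otimes>\<^sub>M E) (\<lambda>z. enat i < fst (fst z) \<longrightarrow> \<not> slow a (snd z))" for i
  proof -
    have "Measurable.pred (P \<Otimes>\<^sub>M E) (\<lambda>z. slow a (snd z))"
      by (rule measurable_compose[OF measurable_snd pred_slow])
    moreover have "Measurable.pred (P \<Otimes>\<^sub>M E) (\<lambda>z. enat i < fst (fst z))"
      by (rule measurable_compose[OF measurable_fst, where g = "\<lambda>p. enat i < fst p"]) measurable
    ultimately show ?thesis by (intro pred_intros_logic)
  qed
  have "s \<le> (\<integral>p. ?f m p \<partial>P)" for m
  proof -
    let ?A = "{e. \<forall>i<m. enat i < fst (e []) \<longrightarrow> \<not> slow a (subenv i e)}"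
    have "Measurable.pred E (\<lambda>e. \<forall>i<m. enat i < fst (e []) \<longrightarrow> \<not> slow a (subenv i e))"
    proof -
      have "Measurable.pred E (\<lambda>e. slow a (subenv i e))" for i
        by (rule measurable_compose[OF measurable_E_subenv pred_slow])
      then show ?thesis by measurable
    qed
    then have A: "?A \<in> sets E" by (simp add: pred_def)
    have em: "emeasure E {e. enat i < fst p \<longrightarrow> \<not> slow a e} = ennreal (if enat i < fst p then s else 1)"
      for i and p :: offspring
      using E.emeasure_space_1 by (auto simp: s_def E.emeasure_eq_measure)
    have "emeasure E ?A = (\<integral>\<^sup>+p. (\<Prod>i<m. emeasure E {e. enat i < fst p \<longrightarrow> \<not> slow a e}) \<partial>P)"
      using emeasure_E_branching[of "\<lambda>_. True" "\<lambda>i p e. enat i < fst p \<longrightarrow> \<not> slow a e" m] Q by simp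
    also have "\<dots> = (\<integral>\<^sup>+p. ennreal (?f m p) \<partial>P)"
      unfolding em using s by (subst prod_ennreal) auto
    also have "\<dots> = ennreal (\<integral>p. ?f m p \<partial>P)"
      using f01 by (intro nn_integral_eq_integral integrable_const_bound[where B = 1]) auto
    finally have "E.prob ?A = (\<integral>p. ?f m p \<partial>P)"
      using f01 by (simp add: measure_def integral_nonneg_AE)
    moreover have "s \<le> E.prob ?A"
      unfolding s_def using A a by (intro E.finite_measure_mono) (auto dest: slow_of_child)
    ultimately show ?thesis by simp
  qed
  moreover have "(\<lambda>m. \<integral>p. ?f m p \<partial>P) \<longlonglongrightarrow> (\<integral>p. enat_power s (fst p) \<partial>P)"
  proof (rule integral_dominated_convergence[where w = "\<lambda>_. 1"])
    show "AE p in P. (\<lambda>m. ?f m p) \<longlonglongrightarrow> enat_power s (fst p)"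
    proof (rule AE_I2)
      fix p :: offspring
      show "(\<lambda>m. ?f m p) \<longlonglongrightarrow> enat_power s (fst p)"
        unfolding prod_if_less_enat enat_power_def
      proof (cases "fst p")
        case (enat k)
        have "(\<lambda>m. s ^ min m k) \<longlonglongrightarrow> s ^ k"
          by (rule tendsto_eventually) (auto simp: eventually_sequentially min_def intro!: exI[of _ k])
        then show "(\<lambda>m. case fst p of enat k \<Rightarrow> s ^ min m k | \<infinity> \<Rightarrow> s ^ m) \<longlonglongrightarrow>
            (case fst p of enat k \<Rightarrow> s ^ k | \<infinity> \<Rightarrow> 0)" using enat by simp
      next
        case infinity
        then show "(\<lambda>m. case fst p of enat k \<Rightarrow> s ^ min m k | \<infinity> \<Rightarrow> s ^ m) \<longlonglongrightarrow>
            (case fst p of enat k \<Rightarrow> s ^ k | \<infinity> \<Rightarrow> 0)"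
          using s by (simp add: LIMSEQ_realpow_zero)
      qed
    qed
  qed (use f01 in auto)
  ultimately show ?thesis
    unfolding s_def[symmetric] by (intro LIMSEQ_le_const) auto
qed

text \<open>The opposite inequality \<open>f q \<le> q\<close>: a tree is finite as soon as the root
  has finitely many children, all with finite subtrees. Summation is over the number of
  children.\<close>

lemma prob_finite_tree_ge:
  "(\<integral>p. enat_power (E.prob {e. finite (env_tree e)}) (fst p) \<partial>P) \<le> E.prob {e. finite (env_tree e)}"
proof -
  let ?F = "\<lambda>e :: environment. finite (env_tree e)"
  define q where "q = E.prob {e. ?F e}"
  have q: "0 \<le> q" "q \<le> 1" by (auto simp: q_def)
  define A where "A k = {e. fst (e []) = enat k \<and> (\<forall>i<k. ?F (subenv i e))}" for k
  have F [measurable]: "{e. ?F e} \<in> sets E" using pred_finite_tree by (simp add: pred_def)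
  have A [measurable]: "A k \<in> sets E" for k
  proof -
    have "Measurable.pred E (\<lambda>e. ?F (subenv i e))" for i
      by (rule measurable_compose[OF measurable_E_subenv pred_finite_tree])
    moreover have "Measurable.pred E (\<lambda>e. fst (e []) = enat k)"
      by (rule measurable_compose[OF measurable_E_component, where g = "\<lambda>p. fst p = enat k"]) measurable
    ultimately have "Measurable.pred E (\<lambda>e. fst (e []) = enat k \<and> (\<forall>i<k. ?F (subenv i e)))"
      by (intro pred_intros_logic pred_intros_finite) auto
    then show ?thesis by (simp add: pred_def A_def)
  qed
  have em: "emeasure E (A k) = (\<integral>\<^sup>+p. ennreal (if fst p = enat k then q ^ k else 0) \<partial>P)" for k
  proof -
    have R: "Measurable.pred P (\<lambda>p. fst p = enat k)" by measurable
    have Q: "Measurable.pred (P \<Otimes>\<^sub>M E) (\<lambda>z. ?F (snd z))"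
      by (rule measurable_compose[OF measurable_snd pred_finite_tree])
    have "emeasure E (A k) = (\<integral>\<^sup>+p. indicator {p. fst p = enat k} p * (\<Prod>i<k. emeasure E {e. ?F e}) \<partial>P)"
      unfolding A_def using emeasure_E_branching[of "\<lambda>p. fst p = enat k" "\<lambda>_ _ e. ?F e" k] R Q by simp
    also have "\<dots> = (\<integral>\<^sup>+p. ennreal (if fst p = enat k then q ^ k else 0) \<partial>P)"
      by (intro nn_integral_cong)
        (auto simp: indicator_def E.emeasure_eq_measure q_def ennreal_power)
    finally show ?thesis .
  qed
  have sum: "(\<Sum>k. ennreal (if N = enat k then q ^ k else 0)) = ennreal (enat_power q N)" for N
  proof (cases N)
    case (enat j)
    have "(\<Sum>k. ennreal (if N = enat k then q ^ k else 0)) = (\<Sum>k\<in>{j}. ennreal (if N = enat k then q ^ k else 0))"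
      using enat by (intro suminf_finite) auto
    then show ?thesis using enat by (simp add: enat_power_def)
  qed (simp add: enat_power_def)
  have "ennreal (\<integral>p. enat_power q (fst p) \<partial>P) = (\<integral>\<^sup>+p. ennreal (enat_power q (fst p)) \<partial>P)"
    using q enat_power_nonneg enat_power_le_1
    by (intro nn_integral_eq_integral[symmetric] integrable_const_bound[where B = 1]) auto
  also have "\<dots> = (\<Sum>k. emeasure E (A k))"
    unfolding em sum[symmetric] by (rule nn_integral_suminf) measurable
  also have "\<dots> = emeasure E (\<Union>k. A k)"
    using A by (intro suminf_emeasure) (auto simp: disjoint_family_on_def A_def)
  also have "\<dots> \<le> emeasure E {e. ?F e}"
    using F by (intro emeasure_mono) (auto simp: A_def intro: finite_tree_of_children)
  also have "\<dots> = ennreal q"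
    by (simp add: q_def E.emeasure_eq_measure)
  finally show ?thesis
    using q by (simp add: ennreal_le_iff flip: q_def)
qed

text \<open>
  The generating function of the number of children is strictly convex, hence has at most one
  fixed point below \<open>1\<close>.
\<close>

lemma AE_slow_of_infinite_tree:
  assumes a: "0 \<le> a" and pos: "0 < E.prob {e. slow a e}"
    and branching: "\<not> (AE p in P. fst p \<le> 1)"
  shows "AE e in E. infinite (env_tree e) \<longrightarrow> slow a e"
proof -
  let ?F = "\<lambda>e :: environment. finite (env_tree e)"
  define s q where "s = E.prob {e. \<not> slow a e}" and "q = E.prob {e. ?F e}"
  have F [measurable]: "{e. ?F e} \<in> sets E" using pred_finite_tree by (simp add: pred_def)
  have sl: "{e. slow a e} \<in> sets E" using pred_slow[of a] by (simp add: pred_def)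
  have "Measurable.pred E (\<lambda>e. \<not> slow a e)" by measurable
  then have nsl [measurable]: "{e. \<not> slow a e} \<in> sets E" by (simp add: pred_def)
  have "space E - {e. slow a e} = {e. \<not> slow a e}" by auto
  then have s1: "s < 1" using E.prob_compl[OF sl] pos by (simp add: s_def)
  have sub: "{e. ?F e} \<subseteq> {e. \<not> slow a e}" using infinite_tree_of_slow by blast
  then have qs: "q \<le> s" unfolding q_def s_def by (intro E.finite_measure_mono) auto
  have q0: "0 \<le> q" by (simp add: q_def)
  have "s = q"
  proof (rule ccontr)
    assume "s \<noteq> q"
    with qs have lt: "q < s" by simp
    define l where "l = (s - q) / (1 - q)"
    have l: "0 < l" "l < 1" using lt s1 by (auto simp: l_def)
    have "l * (1 - q) = s - q" using lt s1 by (simp add: l_def)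
    then have s_eq: "s = (1 - l) * q + l" by (simp add: algebra_simps)
    \<comment> \<open>The convexity gap at \<open>s\<close>, a point strictly between
      \<open>q\<close> and 1. It is nonnegative, while \<open>f q \<le> q\<close> and
      \<open>s \<le> f s\<close> force its mean to be at most 0; so it vanishes almost surely, which
      excludes two or more children.\<close>
    let ?g = "\<lambda>p. (1 - l) * enat_power q (fst p) + l - enat_power s (fst p)"
    have bounds: "0 \<le> enat_power q N" "enat_power q N \<le> 1" "0 \<le> enat_power s N" "enat_power s N \<le> 1" for N
      using q0 lt s1 by (auto intro!: enat_power_nonneg enat_power_le_1)
    have int: "integrable P (\<lambda>p. enat_power q (fst p))" "integrable P (\<lambda>p. enat_power s (fst p))"
      using bounds by (auto intro!: integrable_const_bound[where B = 1])
    have g_nonneg: "0 \<le> ?g p" for p :: offspring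
      using power_convex_combination(1)[OF q0 _ l] lt s1 l
      by (cases "fst p") (auto simp: enat_power_def s_eq)
    have "(\<integral>p. ?g p \<partial>P) = (1 - l) * (\<integral>p. enat_power q (fst p) \<partial>P) + l - (\<integral>p. enat_power s (fst p) \<partial>P)"
      using int prob_space by simp
    also have "\<dots> \<le> (1 - l) * q + l - s"
    proof -
      have "(1 - l) * (\<integral>p. enat_power q (fst p) \<partial>P) \<le> (1 - l) * q"
        using prob_finite_tree_ge l unfolding q_def by (intro mult_left_mono) auto
      moreover have "s \<le> (\<integral>p. enat_power s (fst p) \<partial>P)"
        using prob_not_slow_le[OF a] s1 unfolding s_def by simp
      ultimately show ?thesis by linarith
    qed
    also have "\<dots> = 0" using s_eq by simp
    finally have "(\<integral>p. ?g p \<partial>P) = 0"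
      using g_nonneg by (intro antisym integral_nonneg_AE) auto
    then have "AE p in P. ?g p = 0"
      using g_nonneg int by (subst (asm) integral_nonneg_eq_0_iff_AE) auto
    then have "AE p in P. fst p \<le> 1"
    proof eventually_elim
      case (elim p)
      show ?case
      proof (cases "fst p")
        case (enat k)
        have "\<not> 2 \<le> k"
          using power_convex_combination(2)[OF q0 _ l, of k] lt s1 elim enat
          by (auto simp: enat_power_def s_eq)
        then show ?thesis using enat by (simp add: one_enat_def)
      next
        case infinity
        then show ?thesis using elim l by (simp add: enat_power_def)
      qed
    qed
    then show False using branching by simp
  qed
  then have "E.prob ({e. \<not> slow a e} - {e. ?F e}) = 0"
    using E.finite_measure_Diff[OF nsl F sub] by (simp add: s_def q_def)
  then have "{e. \<not> slow a e} - {e. ?F e} \<in> null_sets E"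
    by (intro null_setsI sets.Diff nsl F) (simp add: E.emeasure_eq_measure)
  then show ?thesis
    by (rule AE_I') auto
qed

lemma prob_slow_ge:
  assumes "\<And>n. q \<le> W n (barrier a (real C)) 0"
  shows "q \<le> E.prob {e. slow a e}"
proof -
  define A where "A n = {e. below n (barrier a (real C)) 0 e}" for n
  have dec: "decseq A"
    unfolding decseq_Suc_iff A_def using below_Suc_imp by blast
  have "range A \<subseteq> sets E" by (auto simp: A_def)
  then have "(\<lambda>n. E.prob (A n)) \<longlonglongrightarrow> E.prob (\<Inter>n. A n)"
    using dec by (rule E.finite_Lim_measure_decseq)
  then have "q \<le> E.prob (\<Inter>n. A n)"
    using assms by (intro LIMSEQ_le_const) (auto simp: A_def W_def)
  also have "\<dots> \<le> E.prob {e. slow a e}"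
    using pred_slow[of a] by (intro E.finite_measure_mono) (auto simp: A_def slow_def pred_def)
  finally show ?thesis .
qed

lemma prob_slow_eq_0:
  assumes "\<And>C. 0 \<le> C \<Longrightarrow> (\<lambda>n. W n (barrier a C) 0) \<longlonglongrightarrow> 0"
  shows "E.prob {e. slow a e} = 0"
proof -
  define B where "B C = {e. \<forall>n. below n (barrier a (real C)) 0 e}" for C :: nat
  have "Measurable.pred E (\<lambda>e. \<forall>n. below n (barrier a (real C)) 0 e)" for C :: nat
    by measurable
  then have B: "B C \<in> sets E" for C by (simp add: B_def pred_def)
  have "E.prob (B C) = 0" for C
  proof -
    have "E.prob (B C) \<le> W n (barrier a (real C)) 0" for n
      unfolding W_def by (intro E.finite_measure_mono) (auto simp: B_def)
    then have "E.prob (B C) \<le> 0"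
      using assms[of "real C"] by (intro LIMSEQ_le_const) auto
    then show ?thesis by (simp add: measure_le_0_iff)
  qed
  then have "emeasure E (\<Union>C. B C) = 0"
    using B by (intro emeasure_UN_eq_0) (auto simp: E.emeasure_eq_measure)
  moreover have "{e. slow a e} = (\<Union>C. B C)"
    by (auto simp: slow_def B_def)
  ultimately show ?thesis by (simp add: measure_def)
qed

end

text \<open>The family sum has mean 1, hence is finite almost surely; the weights then tend to 0,
  whereas a child at or below \<open>c\<close> has weight at least
  \<open>exp (- t * c)\<close>.\<close>

lemma (in critical_law) AE_locally_finite: "AE e in E. locally_finite e"
proof -
  have "(\<integral>\<^sup>+p. family_sum t p \<partial>P) \<noteq> \<infinity>" using critical by simp
  then have "AE p in P. family_sum t p \<noteq> \<infinity>"
    by (intro nn_integral_PInf_AE) auto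
  then have "AE p in P. \<forall>c. finite {i. enat i < fst p \<and> snd p i \<le> c}"
  proof eventually_elim
    case (elim p)
    have summ: "summable (weight t p)"
      using elim by (intro summable_suminf_not_top) (auto simp: family_sum_def)
    show ?case
    proof
      fix c
      have "(\<lambda>i. weight t p i) \<longlonglongrightarrow> 0" using summ by (rule summable_LIMSEQ_zero)
      then have "\<forall>\<^sub>F i in sequentially. weight t p i < exp (- t * c)"
        by (rule order_tendstoD) simp
      then obtain m where m: "\<And>i. i \<ge> m \<Longrightarrow> weight t p i < exp (- t * c)"
        by (auto simp: eventually_sequentially)
      have "{i. enat i < fst p \<and> snd p i \<le> c} \<subseteq> {..<m}"
      proof
        fix i assume i: "i \<in> {i. enat i < fst p \<and> snd p i \<le> c}"
        then have "exp (- t * c) \<le> weight t p i" using t_pos by (simp add: weight_def)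
        with m[of i] show "i \<in> {..<m}" by (cases "i < m") auto
      qed
      then show "finite {i. enat i < fst p \<and> snd p i \<le> c}" by (rule finite_subset) simp
    qed
  qed
  then have "AE e in E. \<forall>c. finite {i. enat i < fst (e u) \<and> snd (e u) i \<le> c}" for u
    unfolding E_def by (intro AE_PiM_component[of UNIV "\<lambda>_. P"]) (auto intro: prob_space_axioms)
  then show ?thesis by (simp add: locally_finite_def AE_all_countable)
qed

section \<open>From barriers to the limsup along rays\<close>

abbreviation (input) scale :: "nat \<Rightarrow> real" where
  "scale n \<equiv> sqrt (real n * ln (real n))"

lemma filterlim_scale: "filterlim scale at_top sequentially"
  by real_asymp

lemma limsup_ray_le:
  assumes "\<And>n. v n \<le> barrier a C n"
  shows "limsup (\<lambda>n. ereal (v n / scale n)) \<le> ereal a"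
proof -
  have "(\<lambda>n. C / scale n + a) \<longlonglongrightarrow> 0 + a"
    by (intro tendsto_add tendsto_const real_tendsto_divide_at_top[OF tendsto_const filterlim_scale])
  then have "(\<lambda>n. ereal (C / scale n + a)) \<longlonglongrightarrow> ereal a"
    by simp
  then have "limsup (\<lambda>n. ereal (C / scale n + a)) = ereal a"
    by (rule lim_imp_Limsup[rotated]) simp
  moreover have aux: "x / y \<le> C / y + a" if "x \<le> C + a * y" "0 < y" for x y
    using that by (simp add: field_simps)
  have "limsup (\<lambda>n. ereal (v n / scale n)) \<le> limsup (\<lambda>n. ereal (C / scale n + a))"
  proof (rule Limsup_mono)
    show "\<forall>\<^sub>F n in sequentially. ereal (v n / scale n) \<le> ereal (C / scale n + a)"
      \<comment> \<open>\<open>scale\<close> vanishes at 0 and 1, where division yields 0 by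
        convention; the limsup ignores these indices.\<close>
      using eventually_gt_at_top[of 1]
    proof eventually_elim
      case (elim n)
      then have "0 < scale n" by simp
      then show ?case
        using aux[of "v n" "scale n"] assms[of n] by (simp only: barrier_def ereal_less_eq)
    qed
  qed
  ultimately show ?thesis by simp
qed

lemma barrier_of_limsup_ray_less:
  assumes "limsup (\<lambda>n. ereal (v n / scale n)) < ereal a"
  shows "\<exists>C. \<forall>n. v n \<le> barrier a C n"
proof -
  have "\<forall>\<^sub>F n in sequentially. ereal (v n / scale n) < ereal a"
    using assms by (rule Limsup_lessD)
  then have "\<forall>\<^sub>F n in sequentially. v n \<le> a * scale n"
    using eventually_gt_at_top[of 1]
  proof eventually_elim
    case (elim n)
    then have "0 < scale n" by simp
    then show ?case using elim(1) by (simp add: field_simps)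
  qed
  then obtain m where m: "\<And>n. n \<ge> m \<Longrightarrow> v n \<le> a * scale n"
    by (auto simp: eventually_sequentially)
  define C where "C = (\<Sum>n<m. \<bar>v n - a * scale n\<bar>)"
  have C: "0 \<le> C" by (simp add: C_def sum_nonneg)
  have "v n \<le> barrier a C n" for n
  proof (cases "n < m")
    case True
    then have "\<bar>v n - a * scale n\<bar> \<le> C"
      unfolding C_def by (intro member_le_sum) auto
    then show ?thesis unfolding barrier_def by linarith
  next
    case False
    then show ?thesis using m[of n] C by (simp add: barrier_def)
  qed
  then show ?thesis by blast
qed

text \<open>At \<open>a\<close> itself \<open>slow\<close> may hold or fail, so the infimum is
  squeezed between levels on either side. Local finiteness enters in the upper half, to extract an
  actual ray from finite paths.\<close>

lemma INF_rays_eq: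
  assumes lf: "locally_finite e"
    and slow: "\<And>n. slow (a + 1 / real (Suc n)) e"
    and not_slow: "\<And>n. \<not> slow (a - 1 / real (Suc n)) e"
  shows "(INF \<xi>\<in>env_rays e.
    limsup (\<lambda>n. ereal (env_position e (\<xi> n) / scale n))) = ereal a"
proof (rule antisym)
  let ?l = "\<lambda>\<xi>. limsup (\<lambda>n. ereal (env_position e (\<xi> n) / scale n))"
  let ?I = "INF \<xi>\<in>env_rays e. ?l \<xi>"
  have "?I \<le> ereal (a + 1 / real (Suc n))" for n
  proof -
    obtain C :: nat where "\<And>k. below k (barrier (a + 1 / real (Suc n)) (real C)) 0 e"
      using slow[of n] by (auto simp: slow_def)
    from ray_below[OF lf this] obtain \<xi> where \<xi>: "\<xi> \<in> env_rays e"
      "\<And>k. 0 + env_position e (\<xi> k) \<le> barrier (a + 1 / real (Suc n)) (real C) k"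
      by blast
    then have "?l \<xi> \<le> ereal (a + 1 / real (Suc n))"
      by (intro limsup_ray_le) simp
    with \<xi>(1) show ?thesis by (rule INF_lower2[where f = ?l])
  qed
  moreover have lim: "(\<lambda>n. ereal (a + 1 / real (Suc n))) \<longlonglongrightarrow> ereal a"
    by (subst lim_ereal) real_asymp
  ultimately show "?I \<le> ereal a"
    using LIMSEQ_le_const[OF lim] by blast
  show "ereal a \<le> ?I"
  proof (rule INF_greatest)
    fix \<xi> assume \<xi>: "\<xi> \<in> env_rays e"
    have "ereal (a - 1 / real (Suc n)) \<le> ?l \<xi>" for n
    proof (rule ccontr)
      assume "\<not> ?thesis"
      then have "?l \<xi> < ereal (a - 1 / real (Suc n))" by simp
      from barrier_of_limsup_ray_less[OF this] obtain C where
        C: "\<And>k. env_position e (\<xi> k) \<le> barrier (a - 1 / real (Suc n)) C k"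
        by blast
      have "slow (a - 1 / real (Suc n)) e"
        by (rule slowI[of _ C], rule below_of_ray[OF \<xi>]) (use C in simp)
      with not_slow show False by blast
    qed
    moreover have lim: "(\<lambda>n. ereal (a - 1 / real (Suc n))) \<longlonglongrightarrow> ereal a"
      by (subst lim_ereal) real_asymp
    ultimately show "ereal a \<le> ?l \<xi>"
      using LIMSEQ_le_const2[OF lim] by blast
  qed
qed

context jump_law
begin

lemma AE_INF_rays:
  assumes branching: "\<not> (AE p in P. fst p \<le> 1)"
  shows "\<exists>a>0. AE e in E. infinite (env_tree e) \<longrightarrow>
    (INF \<xi>\<in>env_rays e.
      limsup (\<lambda>n. ereal (env_position e (\<xi> n) / scale n))) = ereal a"
proof -
  have sl: "{e. slow a e} \<in> sets E" for a
    using pred_slow[of a] by (simp add: pred_def)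
  have mono: "E.prob {e. slow a e} \<le> E.prob {e. slow a' e}" if "a \<le> a'" for a a'
    using sl that by (intro E.finite_measure_mono) (auto intro: slow_mono)
  \<comment> \<open>Upwards closed by \<open>mono\<close>, bounded below by \<open>rate\<close>,
    where the probability is 0, and nonempty by \<open>W_lower_bound\<close>; so its infimum is a
    positive real.\<close>
  define A where "A = {a. 0 < E.prob {e. slow a e}}"
  have rate0: "E.prob {e. slow rate e} = 0"
    using W_tendsto_0 by (intro prob_slow_eq_0) (simp add: barrier_def[abs_def])
  have A_ge: "rate \<le> a" if "a \<in> A" for a
  proof (rule ccontr)
    assume "\<not> rate \<le> a"
    with mono[of a rate] rate0 that show False by (simp add: A_def)
  qed
  have "A \<noteq> {}"
  proof -
    obtain C a q where Ca: "C \<ge> 0" "a > 0" "q > 0" "\<And>n. q \<le> W n (\<lambda>k. C + a * scale k) 0"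
      using W_lower_bound by blast
    have "q \<le> W n (barrier a (real (nat \<lceil>C\<rceil>))) 0" for n
      by (rule order_trans[OF Ca(4) W_mono_barrier]) (simp add: barrier_def real_nat_ceiling_ge)
    then have "q \<le> E.prob {e. slow a e}" by (rule prob_slow_ge)
    then have "0 < E.prob {e. slow a e}" using Ca(3) by linarith
    then show ?thesis unfolding A_def by blast
  qed
  define a where "a = Inf A"
  have bdd: "bdd_below A" using A_ge by (intro bdd_belowI)
  have "rate \<le> a" unfolding a_def using \<open>A \<noteq> {}\<close> A_ge by (intro cInf_greatest)
  then have a_pos: "a > 0" using rate_pos by simp
  have "AE e in E. infinite (env_tree e) \<longrightarrow> slow (a + 1 / real (Suc n)) e" for n
  proof (rule AE_slow_of_infinite_tree[OF _ _ branching])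
    have "Inf A < a + 1 / real (Suc n)" by (simp add: a_def)
    then obtain a' where "a' \<in> A" "a' < a + 1 / real (Suc n)"
      using cInf_lessD[OF \<open>A \<noteq> {}\<close>] by blast
    then show "0 < E.prob {e. slow (a + 1 / real (Suc n)) e}"
      using mono[of a' "a + 1 / real (Suc n)"] by (auto simp: A_def)
  qed (use a_pos in simp)
  moreover have "AE e in E. \<not> slow (a - 1 / real (Suc n)) e" for n
  proof -
    have "a - 1 / real (Suc n) \<notin> A"
    proof
      assume "a - 1 / real (Suc n) \<in> A"
      then have "a \<le> a - 1 / real (Suc n)" unfolding a_def using bdd by (rule cInf_lower)
      then show False by simp
    qed
    then have "E.prob {e. slow (a - 1 / real (Suc n)) e} = 0"
      by (simp add: A_def not_less measure_le_0_iff)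
    then have "{e. slow (a - 1 / real (Suc n)) e} \<in> null_sets E"
      by (intro null_setsI sl) (simp add: E.emeasure_eq_measure)
    then show ?thesis by (rule AE_I') auto
  qed
  ultimately have "AE e in E. \<forall>n. (infinite (env_tree e) \<longrightarrow> slow (a + 1 / real (Suc n)) e) \<and>
      \<not> slow (a - 1 / real (Suc n)) e"
    by (simp add: AE_all_countable)
  with AE_locally_finite have "AE e in E. infinite (env_tree e) \<longrightarrow>
    (INF \<xi>\<in>env_rays e.
      limsup (\<lambda>n. ereal (env_position e (\<xi> n) / scale n))) = ereal a"
  proof eventually_elim
    case (elim e)
    then show ?case by (intro impI INF_rays_eq) auto
  qed
  with a_pos show ?thesis by blast
qed

end

section \<open>Transfer to the branching random walk\<close>

context branching_random_walk
begin

lemma nn_integral_generation_1: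
  "(\<integral>\<^sup>+u. g (position X \<omega> u) \<partial>count_space (generation X 1 \<omega>))
    = (\<Sum>i. if enat i < fst (X [] \<omega>) then g (snd (X [] \<omega>) i) else 0)"
proof -
  let ?I = "{i. enat i < fst (X [] \<omega>)}"
  have "bij_betw (\<lambda>i. [i]) ?I (generation X 1 \<omega>)"
    unfolding bij_betw_def
  proof
    show "(\<lambda>i. [i]) ` ?I = generation X 1 \<omega>"
    proof (intro set_eqI iffI)
      fix u assume "u \<in> generation X 1 \<omega>"
      then obtain i where "u = [i]" "[i] \<in> tree X \<omega>"
        by (auto simp: generation_def length_Suc_conv)
      then show "u \<in> (\<lambda>i. [i]) ` ?I" by (auto simp: tree_def)
    qed (auto simp: generation_def tree_def)
  qed (auto simp: inj_on_def)
  then have "(\<integral>\<^sup>+u. g (position X \<omega> u) \<partial>count_space (generation X 1 \<omega>))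
      = (\<integral>\<^sup>+i. g (position X \<omega> [i]) \<partial>count_space ?I)"
    by (rule nn_integral_bij_count_space[symmetric])
  also have "\<dots> = (\<integral>\<^sup>+i. g (position X \<omega> [i]) * indicator ?I i \<partial>count_space UNIV)"
    by (rule nn_integral_count_space_indicator) simp
  also have "\<dots> = (\<Sum>i. g (position X \<omega> [i]) * indicator ?I i)"
    by (rule nn_integral_count_space_nat)
  also have "\<dots> = (\<Sum>i. if enat i < fst (X [] \<omega>) then g (snd (X [] \<omega>) i) else 0)"
    by (intro suminf_cong) (auto simp: position_def)
  finally show ?thesis .
qed

definition law :: "offspring measure" where
  "law = distr M offspring_space (X [])"

sublocale law: offspring_law law
proof -
  interpret L: prob_space law
    unfolding law_def by (rule prob_space_distr) measurable
  show "offspring_law law"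
    by unfold_locales (simp add: law_def)
qed

lemma nn_integral_law:
  "f \<in> borel_measurable offspring_space \<Longrightarrow> (\<integral>\<^sup>+p. f p \<partial>law) = (\<integral>\<^sup>+\<omega>. f (X [] \<omega>) \<partial>M)"
  unfolding law_def by (rule nn_integral_distr) measurable

lemma distr_environment: "distr M (\<Pi>\<^sub>M u\<in>UNIV. offspring_space) (\<lambda>\<omega> u. X u \<omega>) = law.E"
proof -
  have "distr M (\<Pi>\<^sub>M u\<in>UNIV. offspring_space) (\<lambda>\<omega>. \<lambda>u\<in>UNIV. X u \<omega>)
      = (\<Pi>\<^sub>M u\<in>UNIV. distr M offspring_space (X u))"
    using indep_offspring by (subst (asm) indep_vars_iff_distr_eq_PiM) auto
  also have "\<dots> = law.E"
  proof -
    have "distr M offspring_space (X u) = law" for u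
      unfolding law_def by (rule identically_distributed_offspring)
    then show ?thesis by (simp add: law.E_def)
  qed
  finally show ?thesis by (simp only: restrict_UNIV)
qed

text \<open>\<open>Q\<close> is not assumed measurable, which matters for an infimum over
  uncountably many rays.\<close>

lemma AE_environment:
  assumes "AE e in law.E. Q e"
  shows "AE \<omega> in M. Q (\<lambda>u. X u \<omega>)"
proof (rule AE_distrD[of "\<lambda>\<omega> u. X u \<omega>" M "\<Pi>\<^sub>M u\<in>UNIV. offspring_space" Q])
  show "(\<lambda>\<omega> u. X u \<omega>) \<in> M \<rightarrow>\<^sub>M (\<Pi>\<^sub>M u\<in>UNIV. offspring_space)"
    by (rule measurable_PiM_single') (auto simp: space_PiM)
  show "AE e in distr M (\<Pi>\<^sub>M u\<in>UNIV. offspring_space) (\<lambda>\<omega> u. X u \<omega>). Q e"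
    unfolding distr_environment by (rule assms)
qed

text \<open>The intensity as an image of a density, a form in which integrals can be computed;
  \<open>intensity\<close> itself is given by its values on sets.\<close>

definition counted_displacements :: "real measure" where
  "counted_displacements = distr (density (law \<Otimes>\<^sub>M count_space UNIV)
    (\<lambda>z. if enat (snd z) < fst (fst z) then 1 else 0)) borel step"

lemma nn_integral_counted_displacements:
  assumes f [measurable]: "f \<in> borel_measurable borel"
  shows "(\<integral>\<^sup>+x. f x \<partial>counted_displacements)
    = (\<integral>\<^sup>+p. (\<Sum>i. if enat i < fst p then f (snd p i) else 0) \<partial>law)"
proof -
  interpret C: sigma_finite_measure "count_space (UNIV :: nat set)"
    by (rule sigma_finite_measure_count_space)
  let ?w = "\<lambda>z :: offspring \<times> nat. if enat (snd z) < fst (fst z) then 1 else 0 :: ennreal"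
  let ?D = "density (law \<Otimes>\<^sub>M count_space UNIV) ?w"
  have w [measurable]: "?w \<in> borel_measurable (law \<Otimes>\<^sub>M count_space UNIV)"
    by (rule law.borel_measurable_pair_nat) measurable
  have step [measurable]: "step \<in> borel_measurable (law \<Otimes>\<^sub>M count_space UNIV)"
    unfolding step_def[abs_def] by (rule law.borel_measurable_pair_nat) measurable
  have m: "(\<lambda>z. ?w z * f (step z)) \<in> borel_measurable (law \<Otimes>\<^sub>M count_space UNIV)"
    by measurable
  have "(\<integral>\<^sup>+x. f x \<partial>counted_displacements) = (\<integral>\<^sup>+z. f (step z) \<partial>?D)"
    unfolding counted_displacements_def by (rule nn_integral_distr) auto
  also have "\<dots> = (\<integral>\<^sup>+z. ?w z * f (step z) \<partial>(law \<Otimes>\<^sub>M count_space UNIV))"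
    by (rule nn_integral_density) measurable
  also have "\<dots> = (\<integral>\<^sup>+p. \<integral>\<^sup>+i. ?w (p, i) * f (step (p, i)) \<partial>count_space UNIV \<partial>law)"
    using C.nn_integral_fst[OF m] by simp
  also have "\<dots> = (\<integral>\<^sup>+p. (\<Sum>i. if enat i < fst p then f (snd p i) else 0) \<partial>law)"
    unfolding nn_integral_count_space_nat
    by (intro nn_integral_cong suminf_cong) (simp add: step_def)
  finally show ?thesis .
qed

lemma intensity_eq: "intensity M X = counted_displacements"
proof (rule measure_eqI)
  fix A assume "A \<in> sets (intensity M X)"
  then have A [measurable]: "A \<in> sets borel" by simp
  have repr: "emeasure (reproduction X \<omega>) A
      = (\<Sum>i. if enat i < fst (X [] \<omega>) then indicator A (snd (X [] \<omega>) i) else 0)" for \<omega>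
  proof -
    have "emeasure (reproduction X \<omega>) A = (\<integral>\<^sup>+x. indicator A x \<partial>reproduction X \<omega>)"
      using A by (intro nn_integral_indicator[symmetric]) (simp add: reproduction_def)
    also have "\<dots> = (\<integral>\<^sup>+u. indicator A (position X \<omega> u) \<partial>count_space (generation X 1 \<omega>))"
      unfolding reproduction_def by (rule nn_integral_distr) auto
    finally show ?thesis unfolding nn_integral_generation_1 .
  qed
  have "emeasure counted_displacements A = (\<integral>\<^sup>+x. indicator A x \<partial>counted_displacements)"
    using A by (intro nn_integral_indicator[symmetric]) (simp add: counted_displacements_def)
  also have "\<dots> = (\<integral>\<^sup>+p. (\<Sum>i. if enat i < fst p then indicator A (snd p i) else 0) \<partial>law)"
    by (rule nn_integral_counted_displacements) measurable
  also have "\<dots> = (\<integral>\<^sup>+\<omega>. (\<Sum>i. if enat i < fst (X [] \<omega>) then indicator A (snd (X [] \<omega>) i) else 0) \<partial>M)"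
    by (rule nn_integral_law) measurable
  also have "\<dots> = emeasure (intensity M X) A"
    unfolding emeasure_intensity[OF A] repr ..
  finally show "emeasure (intensity M X) A = emeasure counted_displacements A" ..
qed (simp add: counted_displacements_def)

lemmas nn_integral_intensity = nn_integral_counted_displacements[folded intensity_eq]

lemma sum_gen1_eq:
  "sum_gen1 X f \<omega> = (\<Sum>i. if enat i < fst (X [] \<omega>) then ennreal (f (snd (X [] \<omega>) i)) else 0)"
  unfolding sum_gen1_def by (rule nn_integral_generation_1)

lemma family_sum_eq_sum_gen1: "family_sum t (X [] \<omega>) = sum_gen1 X (\<lambda>x. exp (- t * x)) \<omega>"
  unfolding sum_gen1_eq family_sum_def by (rule suminf_cong) (simp add: weight_def)

lemma nn_integral_family_sum:
  "(\<integral>\<^sup>+p. family_sum t p \<partial>law) = (\<integral>\<^sup>+x. ennreal (exp (- t * x)) \<partial>intensity M X)"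
proof -
  have "(\<integral>\<^sup>+x. ennreal (exp (- t * x)) \<partial>intensity M X)
      = (\<integral>\<^sup>+p. (\<Sum>i. if enat i < fst p then ennreal (exp (- t * snd p i)) else 0) \<partial>law)"
    by (rule nn_integral_intensity) measurable
  moreover have "family_sum t p = (\<Sum>i. if enat i < fst p then ennreal (exp (- t * snd p i)) else 0)" for p
    unfolding family_sum_def weight_def by (rule suminf_cong) simp
  ultimately show ?thesis by simp
qed

text \<open>With at most one child almost surely, the mean number of children would be at most
  1.\<close>

lemma branching_of_supercritical:
  assumes "emeasure (intensity M X) UNIV > 1"
  shows "\<not> (AE p in law. fst p \<le> 1)"
proof
  assume AE: "AE p in law. fst p \<le> 1"
  have "emeasure (intensity M X) UNIV = (\<integral>\<^sup>+x. 1 \<partial>intensity M X)"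
    using sets_eq_imp_space_eq[OF sets_intensity[of M X]] by simp
  also have "\<dots> = (\<integral>\<^sup>+p. (\<Sum>i. if enat i < fst p then 1 else 0) \<partial>law)"
    by (rule nn_integral_intensity) simp
  also have "\<dots> \<le> (\<integral>\<^sup>+p. 1 \<partial>law)"
    using AE
  proof (intro nn_integral_mono_AE, eventually_elim)
    case (elim p)
    have "(\<Sum>i. if enat i < fst p then 1 else 0 :: ennreal) \<le> (\<Sum>i. if i = 0 then 1 else 0)"
    proof (intro suminf_le)
      fix i
      show "(if enat i < fst p then 1 else 0 :: ennreal) \<le> (if i = 0 then 1 else 0)"
        using elim by (cases "fst p") (auto simp: one_enat_def)
    qed auto
    also have "\<dots> = 1"
      using suminf_finite[of "{0 :: nat}" "\<lambda>i. if i = 0 then 1 else 0 :: ennreal"] by simp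
    finally show ?case .
  qed
  also have "\<dots> = 1" using law.emeasure_space_1 by simp
  finally show False using assms by simp
qed

end

section \<open>From the hypotheses of the theorem to the locale \<open>jump_law\<close>\<close>

lemma ext_ln_eq_0_iff: "ext_ln x = 0 \<longleftrightarrow> x = 1"
proof (cases x)
  case (real r)
  then show ?thesis by (cases "r = 0") (auto simp: ext_ln_def zero_ereal_def)
qed (auto simp: ext_ln_def)

lemma (in critical_law) nn_integral_spine_step:
  assumes [measurable]: "g \<in> borel_measurable borel"
  shows "(\<integral>\<^sup>+z. g (step z) \<partial>spine)
    = (\<integral>\<^sup>+p. (\<Sum>i. if enat i < fst p then ennreal (exp (- t * snd p i)) * g (snd p i) else 0) \<partial>P)"
  by (subst nn_integral_spine) (auto simp: weight_def step_def intro!: nn_integral_cong suminf_cong)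

lemma (in critical_law) nn_integral_spine_family:
  assumes [measurable]: "g \<in> borel_measurable borel"
  shows "(\<integral>\<^sup>+z. g (family_sum t (fst z)) \<partial>spine) = (\<integral>\<^sup>+p. family_sum t p * g (family_sum t p) \<partial>P)"
proof -
  have "(\<integral>\<^sup>+z. g (family_sum t (fst z)) \<partial>spine)
      = (\<integral>\<^sup>+p. (\<Sum>i. ennreal (weight t p i) * g (family_sum t (fst (p, i)))) \<partial>P)"
    by (rule nn_integral_spine) measurable
  also have "\<dots> = (\<integral>\<^sup>+p. family_sum t p * g (family_sum t p) \<partial>P)"
    unfolding fst_conv ennreal_suminf_multc by (simp only: family_sum_def)
  finally show ?thesis .
qed

lemma (in branching_random_walk) jump_law_of_assumptions:
  assumes H1: "H1' (intensity M X) t"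
    and \<alpha>: "1 < \<alpha>1" "\<alpha>1 \<le> \<alpha>2"
    and moment: "(\<integral>\<^sup>+\<omega>. sum_gen1 X (\<lambda>x. exp (- t * x) * \<bar>x\<bar> powr \<alpha>1) \<omega> \<partial>M) < \<infinity>"
    and jumps: "\<forall>\<^sub>F y in at_top.
      measure M {\<omega> \<in> space M. \<exists>u \<in> generation X 1 \<omega>. position X \<omega> u \<le> - y}
        \<ge> exp (- t * y) * y powr (- \<alpha>2)"
    and log_moment: "(\<integral>\<^sup>+\<omega>. sum_gen1 X (\<lambda>x. exp (- t * x)) \<omega> *
      ext_ln_plus (sum_gen1 X (\<lambda>x. exp (- t * x)) \<omega>) \<partial>M) < \<infinity>"
  shows "jump_law law t (min \<alpha>1 2) \<alpha>2"
proof -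
  let ?\<mu> = "intensity M X"
  have t: "t > 0" using H1 by (simp add: H1'_def)
  have "log_laplace ?\<mu> t = 0" using H1 by (simp add: H1'_def)
  then have "(\<integral>\<^sup>+x. ennreal (exp (- t * x)) \<partial>?\<mu>) = 1"
    by (simp add: log_laplace_def ext_ln_eq_0_iff)
  then interpret critical_law law t
    by unfold_locales (use t in \<open>simp_all add: nn_integral_family_sum\<close>)
  have step_\<mu>: "(\<integral>\<^sup>+z. g (step z) \<partial>spine) = (\<integral>\<^sup>+x. ennreal (exp (- t * x)) * g x \<partial>?\<mu>)"
    if [measurable]: "g \<in> borel_measurable borel" for g
    by (subst nn_integral_spine_step, measurable) (subst nn_integral_intensity, auto)
  have "(\<integral>\<^sup>+z. ennreal (\<bar>step z\<bar> powr \<alpha>1) \<partial>spine)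
      = (\<integral>\<^sup>+p. (\<Sum>i. if enat i < fst p then ennreal (exp (- t * snd p i)) * ennreal (\<bar>snd p i\<bar> powr \<alpha>1) else 0) \<partial>law)"
    by (rule nn_integral_spine_step) measurable
  also have "\<dots> = (\<integral>\<^sup>+\<omega>. (\<Sum>i. if enat i < fst (X [] \<omega>) then ennreal (exp (- t * snd (X [] \<omega>) i)) *
      ennreal (\<bar>snd (X [] \<omega>) i\<bar> powr \<alpha>1) else 0) \<partial>M)"
    by (rule nn_integral_law) measurable
  also have "\<dots> = (\<integral>\<^sup>+\<omega>. sum_gen1 X (\<lambda>x. exp (- t * x) * \<bar>x\<bar> powr \<alpha>1) \<omega> \<partial>M)"
    unfolding sum_gen1_eq by (intro nn_integral_cong suminf_cong) (auto simp: ennreal_mult)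
  finally have moment1: "(\<integral>\<^sup>+z. ennreal (\<bar>step z\<bar> powr \<alpha>1) \<partial>spine) < \<infinity>"
    using moment by simp
  \<comment> \<open>The spine measure is a probability measure, so lower moments are finite too:
    order 1 makes the step integrable, and order \<open>min \<alpha>1 2\<close> respects the upper
    limit 2 of the truncation argument.\<close>
  have moments: "(\<integral>\<^sup>+z. ennreal (\<bar>step z\<bar> powr \<beta>) \<partial>spine) < \<infinity>" if "0 \<le> \<beta>" "\<beta> \<le> \<alpha>1" for \<beta>
  proof -
    have "(\<integral>\<^sup>+z. ennreal (\<bar>step z\<bar> powr \<beta>) \<partial>spine) \<le> (\<integral>\<^sup>+z. 1 + ennreal (\<bar>step z\<bar> powr \<alpha>1) \<partial>spine)"
      using powr_le_one_plus_powr[OF that]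
      by (intro nn_integral_mono) (simp flip: ennreal_plus ennreal_1 add: ennreal_leI)
    also have "\<dots> = 1 + (\<integral>\<^sup>+z. ennreal (\<bar>step z\<bar> powr \<alpha>1) \<partial>spine)"
      using spine.emeasure_space_1 by (subst nn_integral_add) auto
    also have "\<dots> < \<infinity>" using moment1 by (simp add: ennreal_add_less_top)
    finally show ?thesis .
  qed
  have int: "integrable spine step"
  proof (rule integrableI_bounded)
    have "ennreal (norm (step z)) = ennreal (\<bar>step z\<bar> powr 1)" for z by simp
    then show "(\<integral>\<^sup>+z. ennreal (norm (step z)) \<partial>spine) < \<infinity>"
      using moments[of 1] \<alpha> by simp
  qed measurable
  have drift: "0 < (\<integral>z. step z \<partial>spine)"
  proof -
    define p where "p = (\<integral>\<^sup>+x\<in>{0<..}. ennreal (x * exp (- t * x)) \<partial>?\<mu>)"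
    define n where "n = (\<integral>\<^sup>+x\<in>{..<0}. ennreal (\<bar>x\<bar> * exp (- t * x)) \<partial>?\<mu>)"
    have pn: "enn2ereal p - enn2ereal n > 0"
      using H1 by (simp add: H1'_def Let_def p_def n_def)
    have p: "p = (\<integral>\<^sup>+z. ennreal (step z) \<partial>spine)"
    proof -
      have "(\<integral>\<^sup>+z. ennreal (step z) \<partial>spine) = (\<integral>\<^sup>+x. ennreal (exp (- t * x)) * ennreal x \<partial>?\<mu>)"
        by (rule step_\<mu>) measurable
      also have "\<dots> = p"
        unfolding p_def
      proof (rule nn_integral_cong)
        fix x :: real
        show "ennreal (exp (- t * x)) * ennreal x = ennreal (x * exp (- t * x)) * indicator {0<..} x"
          by (cases "0 < x") (auto simp: ennreal_mult mult.commute ennreal_neg)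
      qed
      finally show ?thesis ..
    qed
    have n: "n = (\<integral>\<^sup>+z. ennreal (- step z) \<partial>spine)"
    proof -
      have "(\<integral>\<^sup>+z. ennreal (- step z) \<partial>spine) = (\<integral>\<^sup>+x. ennreal (exp (- t * x)) * ennreal (- x) \<partial>?\<mu>)"
        by (rule step_\<mu>[of "\<lambda>x. ennreal (- x)"]) measurable
      also have "\<dots> = n"
        unfolding n_def
      proof (rule nn_integral_cong)
        fix x :: real
        show "ennreal (exp (- t * x)) * ennreal (- x) = ennreal (\<bar>x\<bar> * exp (- t * x)) * indicator {..<0} x"
          by (cases "x < 0") (simp_all add: ennreal_neg mult.commute flip: ennreal_mult)
      qed
      finally show ?thesis ..
    qed
    \<comment> \<open>By integrability of the step both parts are finite, so the difference of
      extended reals in \<open>H1'\<close> is an ordinary one.\<close>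
    have fin: "p < \<infinity>" "n < \<infinity>"
      using int by (auto simp: p n real_integrable_def less_top)
    obtain p' n' where pn': "0 \<le> p'" "p = ennreal p'" "0 \<le> n'" "n = ennreal n'"
      using fin by (cases p; cases n) auto
    have "(\<integral>z. step z \<partial>spine) = p' - n'"
      using real_lebesgue_integral_def[OF int] pn' p n by simp
    then show ?thesis using pn pn' by (simp add: enn2ereal_ennreal)
  qed
  have meas_ln: "ext_ln_plus \<in> borel_measurable borel"
    by (rule borel_measurable_ext_ln_plus)
  have "(\<integral>\<^sup>+z. ext_ln_plus (family_sum t (fst z)) \<partial>spine)
      = (\<integral>\<^sup>+p. family_sum t p * ext_ln_plus (family_sum t p) \<partial>law)"
    by (rule nn_integral_spine_family[OF meas_ln])
  also have "\<dots> = (\<integral>\<^sup>+\<omega>. family_sum t (X [] \<omega>) * ext_ln_plus (family_sum t (X [] \<omega>)) \<partial>M)"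
    by (rule nn_integral_law)
      (intro borel_measurable_times_ennreal measurable_compose[OF _ meas_ln] borel_measurable_family_sum)
  finally have log_spine: "(\<integral>\<^sup>+z. ext_ln_plus (family_sum t (fst z)) \<partial>spine) < \<infinity>"
    using log_moment by (simp add: family_sum_eq_sum_gen1)
  have jumps': "\<forall>\<^sub>F y in at_top. exp (- t * y) * y powr (- \<alpha>2)
      \<le> measure law {p. \<exists>i. enat i < fst p \<and> snd p i \<le> - y}"
    using jumps
  proof eventually_elim
    case (elim y)
    let ?B = "{p. \<exists>i. enat i < fst p \<and> snd p i \<le> - y}"
    have "Measurable.pred offspring_space (\<lambda>p. \<exists>i. enat i < fst p \<and> snd p i \<le> - y)"
      by measurable
    then have B: "?B \<in> sets offspring_space" by (simp add: pred_def)
    have "measure law ?B = measure M (X [] -` ?B \<inter> space M)"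
      unfolding law_def using B by (intro measure_distr) auto
    also have "X [] -` ?B \<inter> space M = {\<omega> \<in> space M. \<exists>u \<in> generation X 1 \<omega>. position X \<omega> u \<le> - y}"
    proof -
      have "(\<exists>u \<in> generation X 1 \<omega>. position X \<omega> u \<le> - y) \<longleftrightarrow> X [] \<omega> \<in> ?B" for \<omega>
      proof
        assume "\<exists>u \<in> generation X 1 \<omega>. position X \<omega> u \<le> - y"
        then obtain i where "[i] \<in> tree X \<omega>" "position X \<omega> [i] \<le> - y"
          by (auto simp: generation_def length_Suc_conv)
        then show "X [] \<omega> \<in> ?B" by (auto simp: tree_def position_def)
      next
        assume "X [] \<omega> \<in> ?B"
        then obtain i where "enat i < fst (X [] \<omega>)" "snd (X [] \<omega>) i \<le> - y" by auto
        then have "[i] \<in> generation X 1 \<omega>" "position X \<omega> [i] \<le> - y"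
          by (auto simp: generation_def tree_def position_def)
        then show "\<exists>u \<in> generation X 1 \<omega>. position X \<omega> u \<le> - y" by blast
      qed
      then show ?thesis by auto
    qed
    finally show ?case using elim by simp
  qed
  show ?thesis
    by unfold_locales (use \<alpha> moments[of "min \<alpha>1 2"] drift log_spine jumps' in auto)
qed

theorem theorem1p2:
  fixes M :: "'w measure"
    and X :: "nat list \<Rightarrow> 'w \<Rightarrow> offspring"
    and tstar \<alpha>1 \<alpha>2 :: real
  assumes "branching_random_walk M X"
    and "emeasure (intensity M X) UNIV > 1"
    and "H1' (intensity M X) tstar"
    and "1 < \<alpha>1" and "\<alpha>1 \<le> \<alpha>2"
    and "(\<integral>\<^sup>+\<omega>. sum_gen1 X (\<lambda>x. exp (- tstar * x) * \<bar>x\<bar> powr \<alpha>1) \<omega> \<partial>M) < \<infinity>"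
    and "\<forall>\<^sub>F y in at_top.
      measure M {\<omega> \<in> space M. \<exists>u \<in> generation X 1 \<omega>. position X \<omega> u \<le> - y}
        \<ge> exp (- tstar * y) * y powr (- \<alpha>2)"
    and "(\<integral>\<^sup>+\<omega>. sum_gen1 X (\<lambda>x. exp (- tstar * x)) \<omega> *
      ext_ln_plus (sum_gen1 X (\<lambda>x. exp (- tstar * x)) \<omega>) \<partial>M) < \<infinity>"
  shows "\<exists>a\<^sub>1::real. a\<^sub>1 > 0 \<and>
    (AE \<omega> in uniform_measure M (survival M X).
      (INF \<xi> \<in> infinite_rays X \<omega>.
        limsup (\<lambda>n. ereal (position X \<omega> (\<xi> n) / sqrt (real n * ln (real n))))) = ereal a\<^sub>1)"
proof -
  interpret branching_random_walk M X by fact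
  interpret jump_law law tstar "min \<alpha>1 2" \<alpha>2
    by (rule jump_law_of_assumptions[OF assms(3-8)])
  from AE_INF_rays[OF branching_of_supercritical[OF assms(2)]]
  obtain a where a: "a > 0" "AE e in law.E. infinite (env_tree e) \<longrightarrow>
    (INF \<xi>\<in>env_rays e.
      limsup (\<lambda>n. ereal (env_position e (\<xi> n) / scale n))) = ereal a"
    by blast
  have tree_eq: "env_tree (\<lambda>u. X u \<omega>) = tree X \<omega>" for \<omega>
    by (simp add: tree_def)
  have position_eq: "env_position (\<lambda>u. X u \<omega>) = position X \<omega>" for \<omega>
    by (simp add: position_def fun_eq_iff)
  have rays_eq: "env_rays (\<lambda>u. X u \<omega>) = infinite_rays X \<omega>" for \<omega>
    by (simp add: infinite_rays_def tree_eq)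
  have "AE \<omega> in M. \<omega> \<in> survival M X \<longrightarrow> (INF \<xi>\<in>infinite_rays X \<omega>.
      limsup (\<lambda>n. ereal (position X \<omega> (\<xi> n) / scale n))) = ereal a"
    using AE_environment[OF a(2)] unfolding tree_eq position_eq rays_eq
    by eventually_elim (simp add: survival_def)
  then have "AE \<omega> in uniform_measure M (survival M X). (INF \<xi>\<in>infinite_rays X \<omega>.
      limsup (\<lambda>n. ereal (position X \<omega> (\<xi> n) / scale n))) = ereal a"
    by (rule AE_uniform_measureI[OF survival_in_sets])
  with a(1) show ?thesis by (intro exI[of _ a] conjI)
qed

end
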